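(* Let $q\ge1$ be a fixed integer and suppose that the null hypothesis holds, i.e. the observations are $\mathbf x_t=\mathbf z_t$, $t=1,\ldots,n$, where $\mathbf z_t=(z_{1,t},\ldots,z_{p,t})^\top$ is a $p$-dimensional mean-zero white noise with $\boldsymbol\Sigma=\mathrm{Cov}(\mathbf z_t)$, whose eigenvalues are $\lambda_1\ge\cdots\ge\lambda_p$. The dimension $p$ is either fixed, or $p=p_n\to\infty$ as $n\to\infty$ (with no restriction on the relative rate of $p$ and $n$). Assume: (1) $\{\mathbf{z}_t\}_{t\in\mathbb Z}$ is a sequence of i.i.d. random vectors such that $\mathbb E\{(\mathbf z_t^\top\mathbf z_s)^4\}=O(p^2)$ for $t\ne s$, and $\max_{1\le i\le p}\mathbb E(z_{i,t}^4)\le C_1$ for some universal constant $C_1>0$; (2) the largest eigenvalue of $\boldsymbol\Sigma$ is bounded by a constant not depending on $p$, and $\lim_{p\to\infty}p^{-1}\mathrm{tr}(\boldsymbol\Sigma^\ell)>0$ for $\ell=1,2$ (when $p$ is fixed, this is read as $\mathrm{tr}(\boldsymbol\Sigma^\ell)>0$). Then, as $n\to\infty$, $(H_{n,1},\ldots,H_{n,q})\xrightarrow{\mathrm d}(H_1,\ldots,H_q)$, where $H_{n,\tau}$ is defined in the context, and $H_1,\ldots,H_q$ are independent random variables such that, for each $\tau\in\{1,\ldots,q\}$, $$H_\tau\stackrel{\mathrm d}{=}\begin{cases}\dfrac{\sum_{i,j=1}^p\lambda_i\lambda_j(\varepsilon_{i,j,\tau}^2-1)}{\sqrt2\sum_{i=1}^p\lambda_i^2},&\text{if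 }p\text{ is fixed},\\[2mm] \mathcal N(0,1),&\text{if }p\to\infty,\end{cases}$$ with $\{\varepsilon_{i,j,\tau}\}_{1\le i,j\le p,\,1\le\tau\le q}$ i.i.d. standard Gaussian random variables.
   Context: For $\mathbf x_1,\ldots,\mathbf x_n\in\mathbb R^p$ use the circular convention $\mathbf x_{t+\tau}=\mathbf x_{t+\tau-n}$ if $t+\tau>n$. Sums $\sum_{t\neq s}$ run over $t,s\in\{1,\ldots,n\}$ with $t\ne s$. For $\tau\in\{1,\ldots,q\}$, $$G_{n,\tau,1}=\frac1{np}\sum_{t\ne s}\mathbf x_t^\top\mathbf x_s\,\mathbf x_{t+\tau}^\top\mathbf x_{s+\tau},\qquad \hat\sigma_{n1}=\frac{\sqrt2}{p}\cdot\frac1{n(n-1)}\sum_{t\ne s}(\mathbf x_t^\top\mathbf x_s)^2,\qquad H_{n,\tau}=\frac{G_{n,\tau,1}}{\hat\sigma_{n1}}.$$ The law of $\mathbf z_t$ (and hence $\boldsymbol\Sigma$) may depend on $p$ but not otherwise on $n$; constants in $O(\cdot)$ do not depend on $p$ or $n$. *)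

theory Defs
  imports "HOL-Probability.Probability" "Jordan_Normal_Form.Char_Poly"
begin

text \<open>
  A vector in p-dimensional Euclidean space, with p a natural number varying with the sample
  size, is a function \<^typ>\<open>nat \<Rightarrow> real\<close> of which only the coordinates below p are used; as a
  random element it takes values in the product of p copies of the Borel line. So coordinates
  are numbered from 0 to p - 1, whereas times and lags keep their usual numbering from 1.
\<close>

definition vec_space :: "nat \<Rightarrow> (nat \<Rightarrow> real) measure" where
  "vec_space p = PiM {..<p} (\<lambda>_. borel)"

definition dotp :: "nat \<Rightarrow> (nat \<Rightarrow> real) \<Rightarrow> (nat \<Rightarrow> real) \<Rightarrow> real" where
  "dotp p u v = (\<Sum>i<p. u i * v i)"

definition cov_mat :: "'a measure \<Rightarrow> nat \<Rightarrow> ('a \<Rightarrow> nat \<Rightarrow> real) \<Rightarrow> real mat" where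
  "cov_mat M p X = mat p p (\<lambda>(i, j).
     LINT \<omega>|M. (X \<omega> i - (LINT \<xi>|M. X \<xi> i)) * (X \<omega> j - (LINT \<xi>|M. X \<xi> j)))"

definition mat_trace :: "real mat \<Rightarrow> real" where
  "mat_trace A = (\<Sum>i<dim_row A. A $$ (i, i))"

text \<open>Eigenvalues are counted with algebraic multiplicity and listed in decreasing order.\<close>

definition ordered_eigenvalues :: "real mat \<Rightarrow> (nat \<Rightarrow> real) \<Rightarrow> bool" where
  "ordered_eigenvalues A l \<longleftrightarrow>
     char_poly A = (\<Prod>i<dim_row A. [:- l i, 1:]) \<and>
     (\<forall>i j. i \<le> j \<and> j < dim_row A \<longrightarrow> l j \<le> l i)"

text \<open>The circular convention, for times \<open>1, \<dots>, n\<close> shifted by a lag of at most \<open>n\<close>.\<close>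

definition circ :: "nat \<Rightarrow> int \<Rightarrow> int" where
  "circ n t = (if t > int n then t - int n else t)"

definition offdiag :: "nat \<Rightarrow> (int \<times> int) set" where
  "offdiag n = {(t, s). t \<in> {1..int n} \<and> s \<in> {1..int n} \<and> t \<noteq> s}"

definition G_stat :: "nat \<Rightarrow> nat \<Rightarrow> nat \<Rightarrow> (int \<Rightarrow> nat \<Rightarrow> real) \<Rightarrow> real" where
  "G_stat p n \<tau> x = 1 / (real n * real p) *
     (\<Sum>(t, s)\<in>offdiag n. dotp p (x t) (x s) *
        dotp p (x (circ n (t + int \<tau>))) (x (circ n (s + int \<tau>))))"

definition sigma_hat :: "nat \<Rightarrow> nat \<Rightarrow> (int \<Rightarrow> nat \<Rightarrow> real) \<Rightarrow> real" where
  "sigma_hat p n x = sqrt 2 / real p * (1 / (real n * (real n - 1))) *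
     (\<Sum>(t, s)\<in>offdiag n. (dotp p (x t) (x s))\<^sup>2)"

definition H_stat :: "nat \<Rightarrow> nat \<Rightarrow> nat \<Rightarrow> (int \<Rightarrow> nat \<Rightarrow> real) \<Rightarrow> real" where
  "H_stat p n \<tau> x = G_stat p n \<tau> x / sigma_hat p n x"

text \<open>
  The joint law of the real random variables \<open>X i\<close>, \<open>i \<in> I\<close>, and weak convergence of such laws
  (convergence of the integrals of bounded continuous functions). The points of the product
  topology over \<open>I\<close> are the extensional functions on \<open>I\<close>, as for \<^const>\<open>PiM\<close>.
\<close>

definition joint_law :: "'i set \<Rightarrow> 'a measure \<Rightarrow> ('i \<Rightarrow> 'a \<Rightarrow> real) \<Rightarrow> ('i \<Rightarrow> real) measure" where
  "joint_law I M X = distr M (PiM I (\<lambda>_. borel)) (\<lambda>\<omega>. \<lambda>i\<in>I. X i \<omega>)"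

definition weak_conv_joint ::
    "'i set \<Rightarrow> (nat \<Rightarrow> ('i \<Rightarrow> real) measure) \<Rightarrow> ('i \<Rightarrow> real) measure \<Rightarrow> bool" where
  "weak_conv_joint I \<mu> \<nu> \<longleftrightarrow>
     (\<forall>f :: ('i \<Rightarrow> real) \<Rightarrow> real.
        continuous_map (product_topology (\<lambda>_. euclidean) I) euclidean f \<and>
        bounded (f ` (\<Pi>\<^sub>E i\<in>I. UNIV)) \<longrightarrow>
        (\<lambda>n. LINT x|\<mu> n. f x) \<longlonglongrightarrow> (LINT x|\<nu>. f x))"

end

theory Submission
  imports Defs "Jordan_Normal_Form.Schur_Decomposition"
begin

text \<open>
  Characteristic functions are compared with errors of order \<open>1 / sqrt n\<close> that depend on the
  dimension only through the constants of the hypotheses, which is why \<open>p\<close> may grow at any rate.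

  A rotation of the noise that diagonalizes \<open>\<Sigma>\<close> preserves scalar products, and yields vectors
  \<open>w t\<close> with uncorrelated coordinates. Up to terms of order \<open>1 / sqrt n\<close>, a combination
  \<open>\<Sum> \<theta> \<tau> * H n \<tau>\<close> is a quadratic form \<open>\<Sum> \<langle>v s, v t\<rangle>\<close>, over \<open>s + q < t\<close>, in the vectors \<open>v t\<close>
  formed by the tensor products of \<open>w t\<close> with \<open>w (t - \<tau>)\<close>, \<open>\<tau> = 1, \<dots>, q\<close>. Lindeberg's method
  replaces the \<open>v t\<close> one after the other by independent Gaussian vectors with the same covariance.
  The terms of first order vanish because \<open>v t\<close> is linear in \<open>w t\<close>, which is independent of the past;
  for the terms of second order the \<open>q\<close> times before \<open>t\<close>, which share noise vectors with \<open>v t\<close>,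
  are first removed from the rest of the form; and the third order is controlled by fourth
  moments of the martingale type. The Gaussian form is close to a weighted sum of independent centred
  chi-squared variables. Its weights converge if \<open>p\<close> is fixed; if \<open>p\<close> diverges they become uniformly
  small, while the sum of their squares converges, and the limit is normal.
\<close>


section \<open>Weak convergence from trigonometric moments\<close>

text \<open>The orders of magnitude explain the rate. After normalization the weights of the form
  are of order 1/(n p). A scalar product of two different noise vectors has fourth moment O(p^2), so
  a form at two distant times has fourth moment of order p^4 / (n p)^4 = n^-4. The forms that
  involve one fixed time behave like martingale differences: their sum has fourth moment of order
  n^2 n^-4 = n^-2, where plain convexity would only give n^4 n^-4. A replacement therefore costs
  n^(-3/2), all of them cost n^(-1/2), and \<open>p\<close> has cancelled. Both regimes share this
  approximation: up to n^(-1/2) the characteristic function is an explicit product of characteristic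
  functions of centred chi-squared variables, and the regime matters only for the limit of that
  product. Cosines with an arbitrary phase stand for complex characteristic functions, so that
  Taylor expansions and their error terms remain real.\<close>

inductive trig_poly :: "'i set \<Rightarrow> (('i \<Rightarrow> real) \<Rightarrow> real) \<Rightarrow> bool" for I where
  monomial: "trig_poly I (\<lambda>x. c * cos ((\<Sum>i\<in>I. \<theta> i * x i) + \<phi>))"
| add: "trig_poly I f \<Longrightarrow> trig_poly I g \<Longrightarrow> trig_poly I (\<lambda>x. f x + g x)"

lemma trig_poly_const: "trig_poly I (\<lambda>_. c)"
  using trig_poly.monomial[of I c "\<lambda>_. 0" 0] by simp

lemma trig_poly_sin_coordinate:
  assumes "finite I" "i \<in> I"
  shows "trig_poly I (\<lambda>x. sin (a * x i))"
proof -
  have "(\<Sum>j\<in>I. (if j = i then a else 0) * x j) = a * x i" for x :: "'a \<Rightarrow> real"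
  proof -
    have "(\<Sum>j\<in>I. (if j = i then a else 0) * x j) = (\<Sum>j\<in>I. if j = i then a * x j else 0)"
      by (intro sum.cong) auto
    then show ?thesis using assms by simp
  qed
  then show ?thesis
    using trig_poly.monomial[of I 1 "\<lambda>j. if j = i then a else 0" "-pi/2"]
    by (simp add: cos_diff)
qed

text \<open>The product-to-sum formula keeps products inside the class, which makes it an algebra to
  which the Stone-Weierstrass theorem applies. The free phase of the monomials accounts for sines
  and constants as well.\<close>

lemma trig_poly_mult_monomial:
  assumes "trig_poly I g"
  shows "trig_poly I (\<lambda>x. c * cos ((\<Sum>i\<in>I. \<theta> i * x i) + \<phi>) * g x)"
  using assms
proof induction
  case (monomial c' \<theta>' \<phi>')
  have eq: "c * cos ((\<Sum>i\<in>I. \<theta> i * x i) + \<phi>) * (c' * cos ((\<Sum>i\<in>I. \<theta>' i * x i) + \<phi>')) =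
      (c * c' / 2) * cos ((\<Sum>i\<in>I. (\<theta> i - \<theta>' i) * x i) + (\<phi> - \<phi>')) +
      (c * c' / 2) * cos ((\<Sum>i\<in>I. (\<theta> i + \<theta>' i) * x i) + (\<phi> + \<phi>'))" for x :: "'a \<Rightarrow> real"
  proof -
    have 1: "(\<Sum>i\<in>I. (\<theta> i - \<theta>' i) * x i) + (\<phi> - \<phi>') =
        ((\<Sum>i\<in>I. \<theta> i * x i) + \<phi>) - ((\<Sum>i\<in>I. \<theta>' i * x i) + \<phi>')"
      by (simp add: algebra_simps sum.distrib sum_subtractf)
    have 2: "(\<Sum>i\<in>I. (\<theta> i + \<theta>' i) * x i) + (\<phi> + \<phi>') =
        ((\<Sum>i\<in>I. \<theta> i * x i) + \<phi>) + ((\<Sum>i\<in>I. \<theta>' i * x i) + \<phi>')"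
      by (simp add: algebra_simps sum.distrib sum_subtractf)
    show ?thesis
      unfolding 1 2 cos_diff cos_add by (simp add: field_simps)
  qed
  show ?case
    unfolding eq by (intro trig_poly.intros)
next
  case (add f g)
  then show ?case
    by (auto simp: distrib_left intro: trig_poly.add)
qed

lemma trig_poly_mult:
  assumes "trig_poly I f" "trig_poly I g"
  shows "trig_poly I (\<lambda>x. f x * g x)"
  using assms(1)
proof induction
  case (monomial c \<theta> \<phi>)
  then show ?case by (rule trig_poly_mult_monomial[OF assms(2)])
next
  case (add f g)
  then show ?case by (auto simp: distrib_right intro: trig_poly.add)
qed

lemma trig_poly_measurable [measurable]:
  "trig_poly I f \<Longrightarrow> f \<in> borel_measurable (PiM I (\<lambda>_. borel))"
  by (induction rule: trig_poly.induct) auto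

text \<open>The sine of a coordinate inverts the arcsine on a cube, and is bounded elsewhere: so a
  polynomial that approximates \<open>f (L arcsin y)\<close> on the cube yields an approximation of \<open>f\<close> that
  stays bounded on the whole space.\<close>

lemma trig_poly_approx:
  fixes f :: "('i :: countable \<Rightarrow> real) \<Rightarrow> real"
  assumes I: "finite I"
    and f: "continuous_map (product_topology (\<lambda>_. euclidean) I) euclidean f"
    and B: "\<And>x. x \<in> (\<Pi>\<^sub>E i\<in>I. UNIV) \<Longrightarrow> \<bar>f x\<bar> \<le> B"
    and L: "L > 0" and e: "e > 0"
  obtains T where "trig_poly I T" "\<And>x. \<bar>T x\<bar> \<le> B + e"
    "\<And>x. x \<in> (\<Pi>\<^sub>E i\<in>I. UNIV) \<Longrightarrow> (\<And>i. i \<in> I \<Longrightarrow> \<bar>x i\<bar> \<le> L) \<Longrightarrow> \<bar>f x - T x\<bar> < e"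
proof -
  \<comment> \<open>Coordinates outside \<open>I\<close> are frozen at 0. So \<open>S\<close> is
    compact in the full product space, and two different points of \<open>S\<close> differ in a
    coordinate of \<open>I\<close>, which pulls back to a sine and separates them.\<close>
  define S where "S = (\<Pi>\<^sub>E i\<in>UNIV. if i \<in> I then {-1..1::real} else {0})"
  define F where "F = (\<lambda>y. f (\<lambda>i\<in>I. L * arcsin (y i)))"
  define s where "s = (\<lambda>x :: 'i \<Rightarrow> real. \<lambda>i. if i \<in> I then sin (x i / L) else 0)"
  define P where "P = (\<lambda>g :: ('i \<Rightarrow> real) \<Rightarrow> real. continuous_on UNIV g \<and> trig_poly I (\<lambda>x. g (s x)))"
  have "compactin (product_topology (\<lambda>i. euclidean) UNIV) S"
    unfolding S_def by (subst compactin_PiE) auto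
  then have S: "compact S"
    by (simp add: euclidean_product_topology)
  have cmp: "continuous_map (top_of_set S) euclidean (\<lambda>y. L * arcsin (y k))" if "k \<in> I" for k
  proof -
    have "continuous_on S (\<lambda>y. L * arcsin (y k))"
      using that by (intro continuous_intros continuous_on_subset[OF continuous_on_product_coordinates]) (auto simp: S_def PiE_iff split: if_splits)
    then show ?thesis by simp
  qed
  have "continuous_map (top_of_set S) (product_topology (\<lambda>_. euclidean) I) (\<lambda>y. \<lambda>i\<in>I. L * arcsin (y i))"
    unfolding continuous_map_componentwise using cmp by (auto simp: restrict_def extensional_def)
  from continuous_map_compose[OF this f] have FS: "continuous_on S F"
    by (simp add: F_def o_def)
  have "\<exists>g. P g \<and> (\<forall>x\<in>S. \<bar>F x - g x\<bar> < e)"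
  proof (rule Stone_Weierstrass_HOL[OF S])
    show "P (\<lambda>x. c)" for c by (auto simp: P_def trig_poly_const)
    show "continuous_on S g" if "P g" for g using that by (auto simp: P_def intro: continuous_on_subset)
    show "P (\<lambda>x. f x + g x)" if "P f \<and> P g" for f g
      using that by (auto simp: P_def intro!: continuous_intros trig_poly.add)
    show "P (\<lambda>x. f x * g x)" if "P f \<and> P g" for f g
      using that by (auto simp: P_def intro!: continuous_intros trig_poly_mult)
    show "\<exists>f. P f \<and> f x \<noteq> f y" if xy: "x \<in> S \<and> y \<in> S \<and> x \<noteq> y" for x y
    proof -
      from xy obtain i where i: "x i \<noteq> y i" by auto
      have "x i \<in> (if i \<in> I then {-1..1} else {0})" "y i \<in> (if i \<in> I then {-1..1} else {0})"
        using xy by (auto simp: S_def PiE_iff)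
      with i have "i \<in> I" by (auto split: if_splits)
      then have "P (\<lambda>y. y i)"
        using trig_poly_sin_coordinate[OF I, of i "1/L"]
        by (auto simp: P_def s_def intro: continuous_on_product_coordinates)
      with i show ?thesis by (intro exI[of _ "\<lambda>y. y i"]) auto
    qed
  qed (use FS e in auto)
  then obtain g where g: "P g" "\<And>y. y \<in> S \<Longrightarrow> \<bar>F y - g y\<bar> < e" by auto
  have sS: "s x \<in> S" for x by (auto simp: S_def s_def)
  have "\<bar>g (s x)\<bar> \<le> B + e" for x
    using g(2)[OF sS[of x]] B[of "\<lambda>i\<in>I. L * arcsin (s x i)"] by (auto simp: F_def)
  moreover have "\<bar>f x - g (s x)\<bar> < e" if x: "x \<in> (\<Pi>\<^sub>E i\<in>I. UNIV)" "\<And>i. i \<in> I \<Longrightarrow> \<bar>x i\<bar> \<le> L" for x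
  proof -
    have "L * arcsin (s x i) = x i" if "i \<in> I" for i
    proof -
      have "\<bar>x i / L\<bar> \<le> 1" using x(2)[OF that] L by (simp add: field_simps)
      then have "arcsin (sin (x i / L)) = x i / L"
        using pi_ge_two by (intro arcsin_sin) linarith+
      then show ?thesis using that L by (simp add: s_def)
    qed
    then have "(\<lambda>i\<in>I. L * arcsin (s x i)) = x" using x(1) by (auto simp: PiE_iff extensional_def)
    with g(2)[OF sS[of x]] show ?thesis by (simp add: F_def)
  qed
  ultimately show ?thesis
    using that[of "\<lambda>x. g (s x)"] g(1) by (auto simp: P_def)
qed

text \<open>The trigonometric approximations on growing cubes converge pointwise, since every point
  eventually lies in the cube. They are measurable for the product sigma-algebra, and the limit
  inherits this.\<close>

lemma continuous_map_bounded_measurable: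
  fixes f :: "('i :: countable \<Rightarrow> real) \<Rightarrow> real"
  assumes I: "finite I"
    and f: "continuous_map (product_topology (\<lambda>_. euclidean) I) euclidean f"
    and B: "\<And>x. x \<in> (\<Pi>\<^sub>E i\<in>I. UNIV) \<Longrightarrow> \<bar>f x\<bar> \<le> B"
  shows "f \<in> borel_measurable (PiM I (\<lambda>_. borel))"
proof -
  have "\<exists>T. trig_poly I T \<and> (\<forall>x\<in>(\<Pi>\<^sub>E i\<in>I. UNIV). (\<forall>i\<in>I. \<bar>x i\<bar> \<le> real (Suc n)) \<longrightarrow>
      \<bar>f x - T x\<bar> < 1 / real (Suc n))" for n
    by (rule trig_poly_approx[OF I f B, of "real (Suc n)" "1 / real (Suc n)"]) auto
  then obtain T where T: "\<And>n. trig_poly I (T n)"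
      "\<And>n x. x \<in> (\<Pi>\<^sub>E i\<in>I. UNIV) \<Longrightarrow> (\<And>i. i \<in> I \<Longrightarrow> \<bar>x i\<bar> \<le> real (Suc n)) \<Longrightarrow>
      \<bar>f x - T n x\<bar> < 1 / real (Suc n)"
    by metis
  show ?thesis
  proof (rule borel_measurable_LIMSEQ_real)
    show "T n \<in> borel_measurable (PiM I (\<lambda>_. borel))" for n using T(1) by measurable
    fix x :: "'i \<Rightarrow> real" assume "x \<in> space (PiM I (\<lambda>_. borel))"
    then have x: "x \<in> (\<Pi>\<^sub>E i\<in>I. UNIV)" by (simp add: space_PiM)
    obtain k :: nat where k: "(\<Sum>i\<in>I. \<bar>x i\<bar>) \<le> real k" using real_arch_simple by blast
    have "\<forall>\<^sub>F n in sequentially. norm (T n x - f x) \<le> 1 / real (Suc n)"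
      unfolding eventually_sequentially
    proof (intro exI[of _ k] allI impI)
      fix n assume "k \<le> n"
      have "\<bar>x i\<bar> \<le> real (Suc n)" if "i \<in> I" for i
        using member_le_sum[OF that, of "\<lambda>i. \<bar>x i\<bar>"] I k \<open>k \<le> n\<close> by auto
      then show "norm (T n x - f x) \<le> 1 / real (Suc n)"
        using T(2)[OF x, of n] by (simp add: abs_minus_commute)
    qed
    then have "(\<lambda>n. T n x - f x) \<longlonglongrightarrow> 0"
      by (rule Lim_null_comparison) (rule LIMSEQ_Suc[OF lim_1_over_n])
    then show "(\<lambda>n. T n x) \<longlonglongrightarrow> f x" by (simp add: LIM_zero_iff)
  qed
qed

text \<open>Trigonometric polynomials converge by hypothesis, but they approximate \<open>f\<close>
  only on cubes, so the mass outside a cube must be small uniformly in n. This tightness comes from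
  the one-dimensional margins, to which Levy's continuity theorem applies.\<close>

lemma weak_conv_joint_if_cos:
  fixes X :: "nat \<Rightarrow> 'i :: countable \<Rightarrow> 'a \<Rightarrow> real" and H :: "'i \<Rightarrow> 'b \<Rightarrow> real"
  assumes I: "finite I"
    and M: "\<And>n. prob_space (M n)" and N: "prob_space N"
    and X [measurable]: "\<And>n i. i \<in> I \<Longrightarrow> X n i \<in> borel_measurable (M n)"
    and H [measurable]: "\<And>i. i \<in> I \<Longrightarrow> H i \<in> borel_measurable N"
    and conv: "\<And>\<theta> \<phi>. (\<lambda>n. LINT \<omega>|M n. cos ((\<Sum>i\<in>I. \<theta> i * X n i \<omega>) + \<phi>)) \<longlonglongrightarrow>
                  (LINT \<omega>|N. cos ((\<Sum>i\<in>I. \<theta> i * H i \<omega>) + \<phi>))"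
  shows "weak_conv_joint I (\<lambda>n. joint_law I (M n) (X n)) (joint_law I N H)"
  unfolding weak_conv_joint_def
proof safe
  fix f :: "('i \<Rightarrow> real) \<Rightarrow> real"
  assume f: "continuous_map (product_topology (\<lambda>_. euclidean) I) euclidean f"
    and bd: "bounded (f ` (\<Pi>\<^sub>E i\<in>I. UNIV))"
  from bd obtain B0 where B0: "\<And>x. x \<in> (\<Pi>\<^sub>E i\<in>I. UNIV) \<Longrightarrow> \<bar>f x\<bar> \<le> B0"
    by (auto simp: bounded_iff)
  define B where "B = max 1 B0"
  have B: "\<bar>f x\<bar> \<le> B" if "x \<in> (\<Pi>\<^sub>E i\<in>I. UNIV)" for x
    using B0[OF that] by (simp add: B_def)
  have B1: "B \<ge> 1" by (simp add: B_def)
  note fm [measurable] = continuous_map_bounded_measurable[OF I f B]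
  have Ym [measurable]: "(\<lambda>\<omega>. \<lambda>i\<in>I. X n i \<omega>) \<in> measurable (M n) (PiM I (\<lambda>_. borel))" for n
    by measurable
  have Hm [measurable]: "(\<lambda>\<omega>. \<lambda>i\<in>I. H i \<omega>) \<in> measurable N (PiM I (\<lambda>_. borel))"
    by measurable
  have bint: "integrable (M n) g" if "g \<in> borel_measurable (M n)" "\<And>x. \<bar>g x\<bar> \<le> K" for g :: "'a \<Rightarrow> real" and n K
    using M[of n] that by (intro finite_measure.integrable_const_bound[of _ _ K])
      (auto simp: prob_space_def)
  have bintN: "integrable N g" if "g \<in> borel_measurable N" "\<And>x. \<bar>g x\<bar> \<le> K" for g :: "'b \<Rightarrow> real" and K
    using N that by (intro finite_measure.integrable_const_bound[of _ _ K])
      (auto simp: prob_space_def)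
  have cos_int: "integrable (M n) (\<lambda>\<omega>. cos ((\<Sum>i\<in>I. \<theta> i * X n i \<omega>) + \<phi>))" for n \<theta> \<phi>
    by (rule bint[of _ _ 1]) auto
  have cos_intN: "integrable N (\<lambda>\<omega>. cos ((\<Sum>i\<in>I. \<theta> i * H i \<omega>) + \<phi>))" for \<theta> \<phi>
    by (rule bintN[of _ 1]) auto
  have trig: "(\<forall>n. integrable (M n) (\<lambda>\<omega>. T (\<lambda>i\<in>I. X n i \<omega>))) \<and> integrable N (\<lambda>\<omega>. T (\<lambda>i\<in>I. H i \<omega>)) \<and>
     (\<lambda>n. LINT \<omega>|M n. T (\<lambda>i\<in>I. X n i \<omega>)) \<longlonglongrightarrow> (LINT \<omega>|N. T (\<lambda>i\<in>I. H i \<omega>))"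
    if "trig_poly I T" for T
    using that
  proof induction
    case (monomial c \<theta> \<phi>)
    then show ?case
      using conv[of \<theta> \<phi>] cos_int cos_intN by (auto cong: sum.cong intro!: tendsto_intros)
  next
    case (add f g)
    then show ?case by (auto intro!: tendsto_add)
  qed
  \<comment> \<open>A continuous majorant of the indicator of the points beyond \<open>L\<close>,
    vanishing up to \<open>L - 1\<close>: being continuous, it can be integrated along weakly
    convergent laws.\<close>
  define h :: "real \<Rightarrow> real \<Rightarrow> real" where "h = (\<lambda>L x. min 1 (max 0 (\<bar>x\<bar> - (L - 1))))"
  have h_m [measurable]: "h L \<in> borel_measurable borel" for L unfolding h_def by measurable
  have h01: "0 \<le> h L x" "h L x \<le> 1" for L x by (auto simp: h_def)
  have h_conv: "(\<lambda>n. LINT \<omega>|M n. h L (X n i \<omega>)) \<longlonglongrightarrow> (LINT \<omega>|N. h L (H i \<omega>))"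
    if i: "i \<in> I" for i L
  proof -
    note [measurable] = X[OF i] H[OF i]
    define \<mu> where "\<mu> = (\<lambda>n. distr (M n) borel (X n i))"
    define \<nu> where "\<nu> = distr N borel (H i)"
    have \<mu>: "real_distribution (\<mu> n)" for n
      using M unfolding \<mu>_def by (intro prob_space.real_distribution_distr) auto
    have \<nu>: "real_distribution \<nu>"
      using N unfolding \<nu>_def by (intro prob_space.real_distribution_distr) auto
    have one: "(\<Sum>j\<in>I. (if j = i then t else 0) * x j) = t * x i" for t and x :: "'i \<Rightarrow> real"
    proof -
      have "(\<Sum>j\<in>I. (if j = i then t else 0) * x j) = (\<Sum>j\<in>I. if j = i then t * x j else 0)"
        by (intro sum.cong) auto
      then show ?thesis using I i by simp
    qed
    \<comment> \<open>All weight is put on one coordinate; the phases 0 and -pi/2 yield the real and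
      the imaginary part of the characteristic function of this margin.\<close>
    have cs: "(\<lambda>n. LINT \<omega>|M n. cos (t * X n i \<omega>)) \<longlonglongrightarrow> (LINT \<omega>|N. cos (t * H i \<omega>))"
       "(\<lambda>n. LINT \<omega>|M n. sin (t * X n i \<omega>)) \<longlonglongrightarrow> (LINT \<omega>|N. sin (t * H i \<omega>))" for t
      using conv[of "\<lambda>j. if j = i then t else 0" 0] conv[of "\<lambda>j. if j = i then t else 0" "-pi/2"]
      by (simp_all add: one cos_diff)
    have ch: "char (distr M' borel Z) t = Complex (LINT \<omega>|M'. cos (t * Z \<omega>)) (LINT \<omega>|M'. sin (t * Z \<omega>))"
      if "prob_space M'" and [measurable]: "Z \<in> borel_measurable M'" for M' :: "'c measure" and Z t
    proof -
      have ii: "integrable M' (\<lambda>\<omega>. iexp (t * Z \<omega>))"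
        by (rule prob_space.integrable_iexp[OF that(1)]) auto
      have "char (distr M' borel Z) t = (CLINT \<omega>|M'. iexp (t * Z \<omega>))"
        unfolding char_def by (subst integral_distr) auto
      moreover have "Re (CLINT \<omega>|M'. iexp (t * Z \<omega>)) = (LINT \<omega>|M'. cos (t * Z \<omega>))"
        by (subst integral_Re[OF ii, symmetric]) (simp add: Re_exp)
      moreover have "Im (CLINT \<omega>|M'. iexp (t * Z \<omega>)) = (LINT \<omega>|M'. sin (t * Z \<omega>))"
        by (subst integral_Im[OF ii, symmetric]) (simp add: Im_exp)
      ultimately show ?thesis by (simp add: complex_eq_iff)
    qed
    have "(\<lambda>n. char (\<mu> n) t) \<longlonglongrightarrow> char \<nu> t" for t
      unfolding \<mu>_def \<nu>_def using M N by (simp add: ch cs tendsto_Complex)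
    then have "weak_conv_m \<mu> \<nu>" by (rule levy_continuity[OF \<mu> \<nu>])
    then have "(\<lambda>n. integral\<^sup>L (\<mu> n) (h L)) \<longlonglongrightarrow> integral\<^sup>L \<nu> (h L)"
      by (rule weak_conv_imp_integral_bdd_continuous_conv[OF \<mu> \<nu>, where B = 1])
         (auto simp: h_def intro!: continuous_intros)
    then show ?thesis unfolding \<mu>_def \<nu>_def by (simp add: integral_distr)
  qed
  have h_tail: "(\<lambda>k. \<Sum>i\<in>I. LINT \<omega>|N. h (real k) (H i \<omega>)) \<longlonglongrightarrow> (\<Sum>i\<in>I. LINT \<omega>|N. 0)"
  proof (intro tendsto_sum integral_dominated_convergence[where w = "\<lambda>_. 1"])
    fix i assume i: "i \<in> I"
    note [measurable] = H[OF i]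
    show "integrable N (\<lambda>_. 1 :: real)" by (rule bintN[of _ 1]) auto
    show "AE x in N. (\<lambda>k. h (real k) (H i x)) \<longlonglongrightarrow> 0"
    proof (intro always_eventually allI)
      fix x
      obtain k0 :: nat where k0: "\<bar>H i x\<bar> + 1 \<le> real k0" using real_arch_simple by blast
      have "\<forall>\<^sub>F k in sequentially. h (real k) (H i x) = 0"
        unfolding eventually_sequentially
        by (rule exI[of _ k0]) (use k0 in \<open>auto simp: h_def\<close>)
      then show "(\<lambda>k. h (real k) (H i x)) \<longlonglongrightarrow> 0" by (rule tendsto_eventually)
    qed
    show "AE x in N. norm (h (real k) (H i x)) \<le> 1" for k using h01 by (auto simp: abs_le_iff)
  qed (use H in auto)
  have h_fin: "\<exists>k>0. (\<Sum>i\<in>I. LINT \<omega>|N. h (real k) (H i \<omega>)) < d" if "d > 0" for d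
  proof -
    have "\<forall>\<^sub>F k in sequentially. (\<Sum>i\<in>I. LINT \<omega>|N. h (real k) (H i \<omega>)) < d"
      using order_tendstoD(2)[OF h_tail, of d] that by simp
    then have "\<forall>\<^sub>F k in sequentially. k > 0 \<and> (\<Sum>i\<in>I. LINT \<omega>|N. h (real k) (H i \<omega>)) < d"
      using eventually_gt_at_top[of 0] by eventually_elim auto
    then show ?thesis by (auto simp: eventually_sequentially)
  qed
  have approx: "\<bar>(LINT \<omega>|M'. f (\<lambda>i\<in>I. Z i \<omega>)) - (LINT \<omega>|M'. T (\<lambda>i\<in>I. Z i \<omega>))\<bar> \<le>
      e + (2 * B + e) * (\<Sum>i\<in>I. LINT \<omega>|M'. h L (Z i \<omega>))"
    if M': "prob_space M'" and Z: "\<And>i. i \<in> I \<Longrightarrow> Z i \<in> borel_measurable M'"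
      and T: "trig_poly I T" "\<And>x. \<bar>T x\<bar> \<le> B + e"
       "\<And>x. x \<in> (\<Pi>\<^sub>E i\<in>I. UNIV) \<Longrightarrow> (\<And>i. i \<in> I \<Longrightarrow> \<bar>x i\<bar> \<le> L) \<Longrightarrow> \<bar>f x - T x\<bar> < e"
      and e: "e > 0"
    for M' :: "'c measure" and Z T L e
  proof -
    interpret prob_space M' by fact
    note [measurable] = Z T(1)
    have Zm [measurable]: "(\<lambda>\<omega>. \<lambda>i\<in>I. Z i \<omega>) \<in> measurable M' (PiM I (\<lambda>_. borel))"
      by measurable
    have Zs: "(\<lambda>i\<in>I. Z i \<omega>) \<in> (\<Pi>\<^sub>E i\<in>I. UNIV)" for \<omega> by auto
    have i1: "integrable M' (\<lambda>\<omega>. f (\<lambda>i\<in>I. Z i \<omega>))"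
      by (rule integrable_const_bound[of _ B]) (auto intro!: B)
    have i2: "integrable M' (\<lambda>\<omega>. T (\<lambda>i\<in>I. Z i \<omega>))"
      by (rule integrable_const_bound[of _ "B + e"]) (auto intro!: T(2))
    have i3: "integrable M' (\<lambda>\<omega>. h L (Z i \<omega>))" if "i \<in> I" for i
    proof -
      note [measurable] = Z[OF that]
      show ?thesis by (rule integrable_const_bound[of _ 1]) (use h01 in \<open>auto simp: abs_le_iff\<close>)
    qed
    have pt: "\<bar>f (\<lambda>i\<in>I. Z i \<omega>) - T (\<lambda>i\<in>I. Z i \<omega>)\<bar> \<le> e + (2 * B + e) * (\<Sum>i\<in>I. h L (Z i \<omega>))" for \<omega>
    proof (cases "\<forall>i\<in>I. \<bar>Z i \<omega>\<bar> \<le> L")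
      case True
      then have "\<bar>f (\<lambda>i\<in>I. Z i \<omega>) - T (\<lambda>i\<in>I. Z i \<omega>)\<bar> < e" by (intro T(3)[OF Zs]) auto
      moreover have "0 \<le> (2 * B + e) * (\<Sum>i\<in>I. h L (Z i \<omega>))"
        using B1 e h01 by (intro mult_nonneg_nonneg sum_nonneg) auto
      ultimately show ?thesis by linarith
    next
      case False
      then obtain i where i: "i \<in> I" "\<bar>Z i \<omega>\<bar> > L" by auto
      then have "h L (Z i \<omega>) = 1" by (auto simp: h_def)
      then have "1 \<le> (\<Sum>i\<in>I. h L (Z i \<omega>))"
        using member_le_sum[OF i(1), of "\<lambda>i. h L (Z i \<omega>)"] h01 I by auto
      then have "2 * B + e \<le> (2 * B + e) * (\<Sum>i\<in>I. h L (Z i \<omega>))"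
        using B1 e by simp
      moreover have "\<bar>f (\<lambda>i\<in>I. Z i \<omega>) - T (\<lambda>i\<in>I. Z i \<omega>)\<bar> \<le> B + (B + e)"
        using B[OF Zs[of \<omega>]] T(2)[of "\<lambda>i\<in>I. Z i \<omega>"] by linarith
      ultimately show ?thesis using e by linarith
    qed
    have "\<bar>(LINT \<omega>|M'. f (\<lambda>i\<in>I. Z i \<omega>)) - (LINT \<omega>|M'. T (\<lambda>i\<in>I. Z i \<omega>))\<bar> =
        \<bar>LINT \<omega>|M'. f (\<lambda>i\<in>I. Z i \<omega>) - T (\<lambda>i\<in>I. Z i \<omega>)\<bar>"
      using i1 i2 by simp
    also have "\<dots> \<le> (LINT \<omega>|M'. \<bar>f (\<lambda>i\<in>I. Z i \<omega>) - T (\<lambda>i\<in>I. Z i \<omega>)\<bar>)"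
      by (rule integral_abs_bound)
    also have "\<dots> \<le> (LINT \<omega>|M'. e + (2 * B + e) * (\<Sum>i\<in>I. h L (Z i \<omega>)))"
      using i1 i2 i3 pt by (intro integral_mono) auto
    also have "\<dots> = e + (2 * B + e) * (\<Sum>i\<in>I. LINT \<omega>|M'. h L (Z i \<omega>))"
      using i3 by (simp add: prob_space)
    finally show ?thesis .
  qed
  have "(\<lambda>n. LINT \<omega>|M n. f (\<lambda>i\<in>I. X n i \<omega>)) \<longlonglongrightarrow> (LINT \<omega>|N. f (\<lambda>i\<in>I. H i \<omega>))"
  proof (rule LIMSEQ_I)
    fix r :: real assume r: "r > 0"
    \<comment> \<open>Five errors of size \<open>e\<close> add up: inside and outside the cube under
      each of the two laws, and one from the convergence of the integrals of
      \<open>T\<close>.\<close>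
    define e where "e = min 1 (r / 5)"
    have e: "e > 0" "e \<le> 1" "5 * e \<le> r" using r by (auto simp: e_def min_def)
    have pos: "2 * B + e > 0" using B1 e by auto
    obtain k where k: "k > 0" "(\<Sum>i\<in>I. LINT \<omega>|N. h (real k) (H i \<omega>)) < e / (2 * B + e)"
      using h_fin[of "e / (2 * B + e)"] e pos by auto
    obtain T where T: "trig_poly I T" "\<And>x. \<bar>T x\<bar> \<le> B + e"
       "\<And>x. x \<in> (\<Pi>\<^sub>E i\<in>I. UNIV) \<Longrightarrow> (\<And>i. i \<in> I \<Longrightarrow> \<bar>x i\<bar> \<le> real k) \<Longrightarrow> \<bar>f x - T x\<bar> < e"
      using trig_poly_approx[OF I f B, of "real k" e] k(1) e(1) by auto
    have "(\<lambda>n. \<Sum>i\<in>I. LINT \<omega>|M n. h (real k) (X n i \<omega>)) \<longlonglongrightarrow> (\<Sum>i\<in>I. LINT \<omega>|N. h (real k) (H i \<omega>))"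
      by (intro tendsto_sum h_conv)
    then have ev1: "\<forall>\<^sub>F n in sequentially. (\<Sum>i\<in>I. LINT \<omega>|M n. h (real k) (X n i \<omega>)) < e / (2 * B + e)"
      using k(2) by (rule order_tendstoD(2))
    have ev2: "\<forall>\<^sub>F n in sequentially. dist (LINT \<omega>|M n. T (\<lambda>i\<in>I. X n i \<omega>)) (LINT \<omega>|N. T (\<lambda>i\<in>I. H i \<omega>)) < e"
      using trig[OF T(1)] e(1) by (auto dest!: tendstoD[of _ _ _ e])
    have "\<forall>\<^sub>F n in sequentially. norm ((LINT \<omega>|M n. f (\<lambda>i\<in>I. X n i \<omega>)) - (LINT \<omega>|N. f (\<lambda>i\<in>I. H i \<omega>))) < r"
      using ev1 ev2
    proof eventually_elim
      case (elim n)
      have "(2 * B + e) * (\<Sum>i\<in>I. LINT \<omega>|M n. h (real k) (X n i \<omega>)) < e"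
        using elim(1) pos by (simp add: field_simps)
      moreover have "(2 * B + e) * (\<Sum>i\<in>I. LINT \<omega>|N. h (real k) (H i \<omega>)) < e"
        using k(2) pos by (simp add: field_simps)
      moreover have "\<bar>(LINT \<omega>|M n. f (\<lambda>i\<in>I. X n i \<omega>)) - (LINT \<omega>|M n. T (\<lambda>i\<in>I. X n i \<omega>))\<bar> \<le>
          e + (2 * B + e) * (\<Sum>i\<in>I. LINT \<omega>|M n. h (real k) (X n i \<omega>))"
        by (rule approx[OF M _ T _]) (use X e(1) in auto)
      moreover have "\<bar>(LINT \<omega>|N. f (\<lambda>i\<in>I. H i \<omega>)) - (LINT \<omega>|N. T (\<lambda>i\<in>I. H i \<omega>))\<bar> \<le>
          e + (2 * B + e) * (\<Sum>i\<in>I. LINT \<omega>|N. h (real k) (H i \<omega>))"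
        by (rule approx[OF N _ T _]) (use H e(1) in auto)
      ultimately show ?case using elim(2) e(3) unfolding dist_real_def real_norm_def
        by (smt (verit))
    qed
    then show "\<exists>no. \<forall>n\<ge>no. norm ((LINT \<omega>|M n. f (\<lambda>i\<in>I. X n i \<omega>)) - (LINT \<omega>|N. f (\<lambda>i\<in>I. H i \<omega>))) < r"
      by (simp add: eventually_sequentially)
  qed
  then show "(\<lambda>n. LINT x|joint_law I (M n) (X n). f x) \<longlonglongrightarrow> (LINT x|joint_law I N H. f x)"
    unfolding joint_law_def by (simp add: integral_distr)
qed

section \<open>Orthogonal diagonalization of a real symmetric matrix\<close>

text \<open>Gram-Schmidt does not move the first vector, so that normalization only rescales
  \<open>v\<close>. The value of \<open>c\<close> is irrelevant, since any multiple of an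
  eigenvector satisfies the same equation.\<close>

lemma orthonormal_completion:
  fixes v :: "real vec"
  assumes v: "v \<in> carrier_vec n" "v \<noteq> 0\<^sub>v n"
  obtains W c where "W \<in> carrier_mat n n" "transpose_mat W * W = 1\<^sub>m n" "col W 0 = c \<cdot>\<^sub>v v"
proof -
  interpret cof_vec_space n "TYPE(real)" .
  have n: "n \<noteq> 0" using v by (metis vec_of_dim_0 carrier_vecD)
  define ws where "ws = gram_schmidt n (basis_completion v)"
  note bc = basis_completion[OF v]
  note gs = gram_schmidt_result[OF bc(2,4,5) ws_def]
  have len: "length ws = n" using gs(4) bc(6) by simp
  have hd: "ws ! 0 = v"
  proof -
    obtain vs where "basis_completion v = v # vs"
      using bc(6,7) n by (cases "basis_completion v") auto
    then have "hd ws = v" unfolding ws_def using gram_schmidt_hd[OF v(1)] by simp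
    then show ?thesis using len n hd_conv_nth[of ws] by auto
  qed
  have cr: "ws ! i \<in> carrier_vec n" if "i < n" for i using gs(3) len that by auto
  have conj: "conjugate (x :: real vec) = x" for x by (rule eq_vecI) auto
  have orth: "ws ! i \<bullet> ws ! j = 0 \<longleftrightarrow> i \<noteq> j" if "i < n" "j < n" for i j
    using corthogonalD[OF gs(2), of i j] that len by (simp add: conj)
  have pos: "ws ! i \<bullet> ws ! i > 0" if "i < n" for i
  proof -
    have "ws ! i \<bullet> ws ! i \<ge> 0" by (simp add: scalar_prod_def sum_nonneg)
    with orth[OF that that] show ?thesis by simp
  qed
  define us where "us = map (\<lambda>w. (1 / sqrt (w \<bullet> w)) \<cdot>\<^sub>v w) ws"
  define W where "W = mat_of_cols n us"
  have W: "W \<in> carrier_mat n n" unfolding W_def us_def using len by auto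
  have colW: "col W i = (1 / sqrt (ws ! i \<bullet> ws ! i)) \<cdot>\<^sub>v (ws ! i)" if "i < n" for i
    unfolding W_def us_def using that len cr[OF that] by (subst col_mat_of_cols) auto
  have "transpose_mat W * W = 1\<^sub>m n"
  proof (rule eq_matI)
    fix i j assume "i < dim_row (1\<^sub>m n)" "j < dim_col (1\<^sub>m n)"
    then have ij: "i < n" "j < n" by auto
    have "(transpose_mat W * W) $$ (i, j) = col W i \<bullet> col W j" using W ij by simp
    also have "\<dots> = (1 / sqrt (ws ! i \<bullet> ws ! i)) * (1 / sqrt (ws ! j \<bullet> ws ! j)) * (ws ! i \<bullet> ws ! j)"
      using ij cr[of i] cr[of j] by (simp add: colW)
    also have "\<dots> = 1\<^sub>m n $$ (i, j)"
      using orth[OF ij] pos[OF ij(1)] ij by (cases "i = j") auto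
    finally show "(transpose_mat W * W) $$ (i, j) = 1\<^sub>m n $$ (i, j)" .
  qed (use W in auto)
  then show ?thesis using that[OF W] colW[of 0] n hd by simp
qed

text \<open>Deflation: an eigenvector as first column of an orthogonal \<open>W\<close> clears the
  rest of the first column of \<open>A'\<close>, symmetry clears the first row, and the remaining
  block has the remaining roots. Induction over the list of roots, rather than over the dimension
  alone, keeps the diagonal in the order of the list, as needed for eigenvalues that are given in
  decreasing order.\<close>

lemma real_symmetric_diagonalization:
  fixes A :: "real mat"
  assumes "A \<in> carrier_mat n n" "transpose_mat A = A"
    and "char_poly A = (\<Prod>e\<leftarrow>es. [:- e, 1:])"
  shows "\<exists>U \<in> carrier_mat n n. transpose_mat U * U = 1\<^sub>m n \<and>
           transpose_mat U * A * U = mat n n (\<lambda>(i, j). if i = j then es ! i else 0)"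
  using assms
proof (induction es arbitrary: n A)
  case Nil
  with degree_monic_char_poly[of A n] have "n = 0" by auto
  then show ?case by (intro bexI[of _ "1\<^sub>m n"]) auto
next
  case (Cons e es n A)
  note A = Cons.prems(1) and sym = Cons.prems(2)
  have cp: "char_poly A = [:- e, 1:] * (\<Prod>e\<leftarrow>es. [:- e, 1:])" using Cons.prems(3) by simp
  have mon: "monic (\<Prod>e\<leftarrow>es. [:- e, 1:])" by (rule monic_prod_list) auto
  have deg: "degree (char_poly A) = Suc (degree (\<Prod>e\<leftarrow>es. [:- e, 1:]))" unfolding cp
    by (subst degree_mult_eq, insert mon, auto)
  with degree_monic_char_poly[OF A] have n: "n \<noteq> 0" by auto
  then obtain m where m: "n = Suc m" by (cases n) auto
  have "eigenvalue A e" unfolding eigenvalue_root_char_poly[OF A] cp by simp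
  then obtain v where v: "v \<in> carrier_vec n" "v \<noteq> 0\<^sub>v n" "A *\<^sub>v v = e \<cdot>\<^sub>v v"
    unfolding eigenvalue_def eigenvector_def using A by auto
  obtain W c where W: "W \<in> carrier_mat n n" and WW: "transpose_mat W * W = 1\<^sub>m n"
    and W0: "col W 0 = c \<cdot>\<^sub>v v"
    using orthonormal_completion[OF v(1,2)] by blast
  let ?Wt = "transpose_mat W"
  have Wt: "?Wt \<in> carrier_mat n n" using W by simp
  have WW': "W * ?Wt = 1\<^sub>m n" using mat_mult_left_right_inverse[OF Wt W WW] .
  define A' where "A' = ?Wt * A * W"
  have A': "A' \<in> carrier_mat n n" unfolding A'_def using W A by auto
  have symA': "transpose_mat A' = A'"
    unfolding A'_def using W A Wt sym
    by (simp add: transpose_mult[of _ n n _ n] assoc_mult_mat[of _ n n _ n _ n])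
  have sim: "similar_mat A' A"
    unfolding similar_mat_def
    by (intro exI[of _ ?Wt] exI[of _ W] similar_mat_witI[of _ _ n]) (use W Wt WW WW' A A' A'_def in auto)
  have A'0: "A' $$ (i, 0) = (if i = 0 then e else 0)" if i: "i < n" for i
  proof -
    have "A' $$ (i, 0) = row ?Wt i \<bullet> col (A * W) 0"
      unfolding A'_def using W A Wt i n by (simp add: assoc_mult_mat[of _ n n _ n _ n])
    also have "col (A * W) 0 = A *\<^sub>v col W 0" using W A n by (intro col_mult2) auto
    also have "\<dots> = e \<cdot>\<^sub>v col W 0"
      unfolding W0 using v A by (simp add: mult_mat_vec smult_smult_assoc mult.commute)
    also have "row ?Wt i \<bullet> (e \<cdot>\<^sub>v col W 0) = e * (row ?Wt i \<bullet> col W 0)"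
      using W i by (intro scalar_prod_smult_distrib[of _ n]) auto
    also have "row ?Wt i \<bullet> col W 0 = (?Wt * W) $$ (i, 0)" using W i n by simp
    finally show ?thesis unfolding WW using i n by simp
  qed
  have A'0': "A' $$ (0, j) = (if j = 0 then e else 0)" if j: "j < n" for j
    using A'0[OF j] symA' A' j n by (metis carrier_matD index_transpose_mat(1) neq0_conv)
  define A3 where "A3 = mat m m (\<lambda>(i, j). A' $$ (Suc i, Suc j))"
  have A3: "A3 \<in> carrier_mat m m" by (simp add: A3_def)
  define E where "E = mat 1 1 (\<lambda>_. e)"
  have E: "E \<in> carrier_mat 1 1" by (simp add: E_def)
  have blk: "A' = four_block_mat E (0\<^sub>m 1 m) (0\<^sub>m m 1) A3"
    by (rule eq_matI) (use A' A'0 A'0' in \<open>auto simp: m E_def A3_def\<close>)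
  have symA3: "transpose_mat A3 = A3"
  proof (rule eq_matI)
    fix i j assume "i < dim_row A3" "j < dim_col A3"
    then have ij: "i < m" "j < m" using A3 by auto
    have "A' $$ (Suc j, Suc i) = transpose_mat A' $$ (Suc i, Suc j)"
      using A' ij m by simp
    then show "transpose_mat A3 $$ (i, j) = A3 $$ (i, j)"
      unfolding symA' using ij by (simp add: A3_def)
  qed (use A3 in auto)
  have "char_poly A' = char_poly E * char_poly A3"
    unfolding blk by (rule char_poly_four_block_zeros_col[OF E _ A3]) simp
  moreover have "char_poly E = [:- e, 1:]"
    by (simp add: E_def char_poly_defs det_def sign_def)
  ultimately have "char_poly A3 = (\<Prod>e\<leftarrow>es. [:- e, 1:])"
    using char_poly_similar[OF sim] cp by (metis mult_cancel_left pCons_eq_0_iff zero_neq_one)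
  from Cons.IH[OF A3 symA3 this] obtain U3 where U3: "U3 \<in> carrier_mat m m"
    and UU3: "transpose_mat U3 * U3 = 1\<^sub>m m"
    and UAU3: "transpose_mat U3 * A3 * U3 = mat m m (\<lambda>(i, j). if i = j then es ! i else 0)"
    by blast
  define F where "F = four_block_mat (1\<^sub>m 1) (0\<^sub>m 1 m) (0\<^sub>m m 1) U3"
  have F: "F \<in> carrier_mat n n" unfolding F_def m using U3 by auto
  have Ft: "transpose_mat F = four_block_mat (1\<^sub>m 1) (0\<^sub>m 1 m) (0\<^sub>m m 1) (transpose_mat U3)"
    unfolding F_def using U3 by (subst transpose_four_block_mat[of _ 1 1 _ m _ m]) auto
  have FF: "transpose_mat F * F = 1\<^sub>m n"
    unfolding Ft unfolding F_def using U3 UU3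
    by (subst mult_four_block_mat[of _ 1 1 _ m _ m _ _ 1 _ m]) (auto simp: m)
  have FA: "transpose_mat F * A' = four_block_mat E (0\<^sub>m 1 m) (0\<^sub>m m 1) (transpose_mat U3 * A3)"
    unfolding Ft blk using U3 A3 E
    by (subst mult_four_block_mat[of _ 1 1 _ m _ m _ _ 1 _ m]) auto
  have FAF: "transpose_mat F * A' * F = four_block_mat E (0\<^sub>m 1 m) (0\<^sub>m m 1)
      (mat m m (\<lambda>(i, j). if i = j then es ! i else 0))"
    unfolding FA unfolding F_def using U3 A3 E UAU3
    by (subst mult_four_block_mat[of _ 1 1 _ m _ m _ _ 1 _ m]) auto
  have "transpose_mat F * A' * F = mat n n (\<lambda>(i, j). if i = j then (e # es) ! i else 0)"
    unfolding FAF by (rule eq_matI) (auto simp: m E_def nth_Cons')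
  moreover have "transpose_mat (W * F) * A * (W * F) = transpose_mat F * A' * F"
    unfolding A'_def using W F A Wt
    by (simp add: transpose_mult[of _ n n _ n] assoc_mult_mat[of _ n n _ n _ n])
  moreover have "transpose_mat (W * F) * (W * F) = 1\<^sub>m n"
  proof -
    have "transpose_mat (W * F) * (W * F) = transpose_mat F * ((?Wt * W) * F)"
      using W F Wt by (simp add: transpose_mult[of _ n n _ n] assoc_mult_mat[of _ n n _ n _ n])
    then show ?thesis unfolding WW using F FF by simp
  qed
  ultimately show ?case using W F by (intro bexI[of _ "W * F"]) auto
qed

section \<open>Fourth moments\<close>

lemma abs_mult4_le: "\<bar>a * b * c * d\<bar> \<le> a ^ 4 + b ^ 4 + c ^ 4 + (d :: real) ^ 4"
proof -
  have 1: "\<bar>x * y\<bar> \<le> (x\<^sup>2 + y\<^sup>2) / 2" for x y :: real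
    using sum_squares_ge_zero[of 0 "\<bar>x\<bar> - \<bar>y\<bar>"]
    by (simp add: power2_eq_square algebra_simps abs_mult)
  have 2: "\<bar>x * y\<bar>\<^sup>2 \<le> (x ^ 4 + y ^ 4) / 2" for x y :: real
    using 1[of "x\<^sup>2" "y\<^sup>2"] by (simp add: power_mult_distrib)
  have "\<bar>a * b * c * d\<bar> \<le> (\<bar>a * b\<bar>\<^sup>2 + \<bar>c * d\<bar>\<^sup>2) / 2"
    using 1[of "a * b" "c * d"] by (simp add: mult.assoc)
  also have "\<dots> \<le> ((a ^ 4 + b ^ 4) / 2 + (c ^ 4 + d ^ 4) / 2) / 2"
    by (intro divide_right_mono add_mono 2) simp
  also have "\<dots> = (a ^ 4 + b ^ 4 + c ^ 4 + d ^ 4) / 4" by (simp add: field_simps)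
  also have "\<dots> \<le> a ^ 4 + b ^ 4 + c ^ 4 + d ^ 4"
    using zero_le_even_power[of 4 a] zero_le_even_power[of 4 b]
      zero_le_even_power[of 4 c] zero_le_even_power[of 4 d] by simp
  finally show ?thesis .
qed

section \<open>Random variables with finite fourth moment\<close>

context prob_space
begin

text \<open>This class takes the place of Hoelder's inequality: it is a vector space, and products
  of at most four members are integrable by \<open>abs_mult4_le\<close>.\<close>

definition L4 :: "('a \<Rightarrow> real) \<Rightarrow> bool" where
  "L4 f \<longleftrightarrow> f \<in> borel_measurable M \<and> integrable M (\<lambda>x. f x ^ 4)"

lemma L4_measurable [measurable_dest]: "L4 f \<Longrightarrow> f \<in> borel_measurable M"
  by (simp add: L4_def)

lemma L4_integrable_mult4:
  assumes "L4 f" "L4 g" "L4 h" "L4 k"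
  shows "integrable M (\<lambda>x. f x * g x * h x * k x)"
proof (rule Bochner_Integration.integrable_bound)
  show "integrable M (\<lambda>x. f x ^ 4 + g x ^ 4 + h x ^ 4 + k x ^ 4)"
    using assms by (auto simp: L4_def)
  show "AE x in M. norm (f x * g x * h x * k x) \<le> norm (f x ^ 4 + g x ^ 4 + h x ^ 4 + k x ^ 4)"
    using abs_mult4_le by (auto intro!: AE_I2 order_trans[OF abs_mult4_le] simp del: abs_mult)
qed (use assms in \<open>auto simp: L4_def\<close>)

lemma L4_const [simp]: "L4 (\<lambda>_. c)"
  by (simp add: L4_def)

lemma L4_cmult: "L4 f \<Longrightarrow> L4 (\<lambda>x. c * f x)"
  by (auto simp: L4_def power_mult_distrib)

lemma L4_add:
  assumes "L4 f" "L4 g"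
  shows "L4 (\<lambda>x. f x + g x)"
proof -
  have "integrable M (\<lambda>x. f x * f x * f x * f x + 4 * (f x * f x * f x * g x) +
      6 * (f x * f x * g x * g x) + 4 * (f x * g x * g x * g x) + g x * g x * g x * g x)"
    using assms by (intro Bochner_Integration.integrable_add integrable_mult_right L4_integrable_mult4)
  also have "(\<lambda>x. f x * f x * f x * f x + 4 * (f x * f x * f x * g x) +
      6 * (f x * f x * g x * g x) + 4 * (f x * g x * g x * g x) + g x * g x * g x * g x) =
      (\<lambda>x. (f x + g x) ^ 4)"
    by (rule ext) (simp add: power4_eq_xxxx algebra_simps)
  finally show ?thesis using assms by (auto simp: L4_def)
qed

lemma L4_sum: "(\<And>i. i \<in> I \<Longrightarrow> L4 (f i)) \<Longrightarrow> L4 (\<lambda>x. \<Sum>i\<in>I. f i x)"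
  by (induction I rule: infinite_finite_induct) (auto intro: L4_add)

lemma L4_integrable:
  assumes "L4 f"
  shows "integrable M f" "integrable M (\<lambda>x. (f x)\<^sup>2)" "integrable M (\<lambda>x. \<bar>f x\<bar>)"
    "integrable M (\<lambda>x. f x ^ 3)" "integrable M (\<lambda>x. f x ^ 4)"
proof -
  note [intro] = assms
  show 1: "integrable M f"
    using L4_integrable_mult4[of f "\<lambda>_. 1" "\<lambda>_. 1" "\<lambda>_. 1"] by auto
  then show "integrable M (\<lambda>x. \<bar>f x\<bar>)" by auto
  show "integrable M (\<lambda>x. (f x)\<^sup>2)"
    using L4_integrable_mult4[of f f "\<lambda>_. 1" "\<lambda>_. 1"] by (auto simp: power2_eq_square)
  show "integrable M (\<lambda>x. f x ^ 3)"
    using L4_integrable_mult4[of f f f "\<lambda>_. 1"] by (auto simp: power3_eq_cube)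
  show "integrable M (\<lambda>x. f x ^ 4)"
    using assms by (simp add: L4_def)
qed

lemma L4_integrable_mult: "L4 f \<Longrightarrow> L4 g \<Longrightarrow> integrable M (\<lambda>x. f x * g x)"
  using L4_integrable_mult4[of f g "\<lambda>_. 1" "\<lambda>_. 1"] by auto

lemma L4_integrable_mult3: "L4 f \<Longrightarrow> L4 g \<Longrightarrow> L4 h \<Longrightarrow> integrable M (\<lambda>x. f x * g x * h x)"
  using L4_integrable_mult4[of f g h "\<lambda>_. 1"] by auto

lemma L4_integrable_square_mult: "L4 f \<Longrightarrow> L4 g \<Longrightarrow> integrable M (\<lambda>x. (f x)\<^sup>2 * (g x)\<^sup>2)"
  using L4_integrable_mult4[of f f g g] by (simp add: power2_eq_square mult.assoc)

lemma integrable_bounded_mult: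
  assumes "integrable M f" "g \<in> borel_measurable M" "\<And>x. \<bar>g x\<bar> \<le> K"
  shows "integrable M (\<lambda>x. (g x :: real) * f x)"
proof (rule Bochner_Integration.integrable_bound)
  show "integrable M (\<lambda>x. K * \<bar>f x\<bar>)" using assms(1) by auto
  show "AE x in M. norm (g x * f x) \<le> norm (K * \<bar>f x\<bar>)"
  proof (intro AE_I2)
    fix x
    have "norm (g x * f x) \<le> K * \<bar>f x\<bar>"
      using assms(3)[of x] by (auto simp: abs_mult intro: mult_right_mono)
    then show "norm (g x * f x) \<le> norm (K * \<bar>f x\<bar>)" by simp
  qed
qed (use assms in auto)

text \<open>A moment inequality of martingale type. Orthogonality removes the one term of the
  binomial expansion that is cubic in the partial sum, which leaves the square of the number of
  summands instead of its fourth power. The induction adds the largest index, and the constant 16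
  closes it because 16 m^2 + 32 m + 3 <= 16 (m + 1)^2.\<close>

lemma fourth_moment_sum_le:
  fixes X :: "'i :: linorder \<Rightarrow> 'a \<Rightarrow> real"
  assumes "finite I"
    and X: "\<And>r. r \<in> I \<Longrightarrow> L4 (X r)"
    and B: "\<And>r. r \<in> I \<Longrightarrow> expectation (\<lambda>\<omega>. X r \<omega> ^ 4) \<le> B"
    and orth: "\<And>r. r \<in> I \<Longrightarrow> expectation (\<lambda>\<omega>. (\<Sum>i\<in>{i \<in> I. i < r}. X i \<omega>) ^ 3 * X r \<omega>) = 0"
  shows "expectation (\<lambda>\<omega>. (\<Sum>i\<in>I. X i \<omega>) ^ 4) \<le> 16 * (real (card I))\<^sup>2 * B"
  using assms
proof (induction I rule: finite_linorder_max_induct)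
  case empty
  then show ?case by simp
next
  case (insert b I)
  let ?m = "card I"
  define S where "S = (\<lambda>\<omega>. \<Sum>i\<in>I. X i \<omega>)"
  have S: "L4 S" unfolding S_def by (intro L4_sum insert.prems(1)) auto
  have Xm: "L4 (X b)" by (rule insert.prems(1)) simp
  have bI: "b \<notin> I" using insert.hyps(2) by auto
  have max_eq: "{i \<in> insert b I. i < b} = I" using insert.hyps(2) by auto
  have sub_eq: "{i \<in> insert b I. i < r} = {i \<in> I. i < r}" if "r \<in> I" for r
    using insert.hyps(2) that by auto
  have B0: "0 \<le> B"
    using order_trans[OF Bochner_Integration.integral_nonneg[of M "\<lambda>\<omega>. X b \<omega> ^ 4"] insert.prems(2)[of b]] by simp
  have IH: "expectation (\<lambda>\<omega>. S \<omega> ^ 4) \<le> 16 * (real ?m)\<^sup>2 * B"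
    unfolding S_def 
  proof (rule insert.IH)
    show "expectation (\<lambda>\<omega>. (\<Sum>i\<in>{i \<in> I. i < r}. X i \<omega>) ^ 3 * X r \<omega>) = 0" if "r \<in> I" for r
      using insert.prems(3)[of r] that unfolding sub_eq[OF that] by blast
  qed (use insert.prems in auto)
  note iS = L4_integrable(5)[OF S] and iX = L4_integrable(5)[OF Xm]
  have i3: "integrable M (\<lambda>\<omega>. S \<omega> ^ 3 * X b \<omega>)"
    using L4_integrable_mult4[OF S S S Xm] by (simp add: power3_eq_cube)
  have i2: "integrable M (\<lambda>\<omega>. (S \<omega>)\<^sup>2 * (X b \<omega>)\<^sup>2)" by (rule L4_integrable_square_mult[OF S Xm])
  have cross: "expectation (\<lambda>\<omega>. (S \<omega>)\<^sup>2 * (X b \<omega>)\<^sup>2) \<le> 4 * real ?m * B"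
  proof (cases "?m = 0")
    case True
    then have "I = {}" using insert.hyps(1) by simp
    then show ?thesis by (simp add: S_def)
  next
    case False
    then have m: "real ?m > 0" by simp
    \<comment> \<open>The weight 4 m balances the two fourth moments, at most 16 m^2 B for
      \<open>S\<close> and B for \<open>X b\<close>: either of them then contributes 4 m B.\<close>
    have "(S \<omega>)\<^sup>2 * (X b \<omega>)\<^sup>2 \<le> (S \<omega> ^ 4 / (4 * real ?m) + 4 * real ?m * X b \<omega> ^ 4) / 2" for \<omega>
    proof -
      have "0 \<le> ((S \<omega>)\<^sup>2 - 4 * real ?m * (X b \<omega>)\<^sup>2)\<^sup>2 / (8 * real ?m)" using m by simp
      also have "\<dots> = (S \<omega> ^ 4 / (4 * real ?m) + 4 * real ?m * X b \<omega> ^ 4) / 2 - (S \<omega>)\<^sup>2 * (X b \<omega>)\<^sup>2"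
        using m by (simp add: power2_eq_square power4_eq_xxxx field_simps)
      finally show ?thesis by simp
    qed
    then have "expectation (\<lambda>\<omega>. (S \<omega>)\<^sup>2 * (X b \<omega>)\<^sup>2) \<le>
        expectation (\<lambda>\<omega>. (S \<omega> ^ 4 / (4 * real ?m) + 4 * real ?m * X b \<omega> ^ 4) / 2)"
      using i2 iS iX by (intro integral_mono) auto
    also have "\<dots> = (expectation (\<lambda>\<omega>. S \<omega> ^ 4) / (4 * real ?m) + 4 * real ?m * expectation (\<lambda>\<omega>. X b \<omega> ^ 4)) / 2"
      using iS iX by simp
    also have "\<dots> \<le> (16 * (real ?m)\<^sup>2 * B / (4 * real ?m) + 4 * real ?m * B) / 2"
      using IH insert.prems(2)[of b] m by (intro divide_right_mono add_mono mult_left_mono) auto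
    also have "\<dots> = 4 * real ?m * B" using m by (simp add: power2_eq_square)
    finally show ?thesis .
  qed
  have orth_b: "expectation (\<lambda>\<omega>. (\<Sum>i\<in>I. X i \<omega>) ^ 3 * X b \<omega>) = 0"
    using insert.prems(3)[OF insertI1] unfolding max_eq .
  \<comment> \<open>The term 4 S X^3 need not vanish on average. It is absorbed by raising the
    coefficient of S^2 X^2 from 6 to 8 and that of X^4 from 1 to 3.\<close>
  have pt: "(S \<omega> + X b \<omega>) ^ 4 \<le> S \<omega> ^ 4 + 4 * (S \<omega> ^ 3 * X b \<omega>) + 8 * ((S \<omega>)\<^sup>2 * (X b \<omega>)\<^sup>2) + 3 * X b \<omega> ^ 4" for \<omega>
  proof -
    have "0 \<le> 2 * (S \<omega> * X b \<omega> - X b \<omega> * X b \<omega>)\<^sup>2" by simp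
    also have "\<dots> = (S \<omega> ^ 4 + 4 * (S \<omega> ^ 3 * X b \<omega>) + 8 * ((S \<omega>)\<^sup>2 * (X b \<omega>)\<^sup>2) + 3 * X b \<omega> ^ 4) -
        (S \<omega> + X b \<omega>) ^ 4"
      by (simp add: power2_eq_square power3_eq_cube power4_eq_xxxx algebra_simps)
    finally show ?thesis by simp
  qed
  have "expectation (\<lambda>\<omega>. (S \<omega> + X b \<omega>) ^ 4) \<le> expectation (\<lambda>\<omega>. S \<omega> ^ 4 + 4 * (S \<omega> ^ 3 * X b \<omega>) +
      8 * ((S \<omega>)\<^sup>2 * (X b \<omega>)\<^sup>2) + 3 * X b \<omega> ^ 4)"
    using pt iS iX i3 i2 L4_integrable(5)[OF L4_add[OF S Xm]] by (intro integral_mono) auto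
  also have "\<dots> = expectation (\<lambda>\<omega>. S \<omega> ^ 4) + 8 * expectation (\<lambda>\<omega>. (S \<omega>)\<^sup>2 * (X b \<omega>)\<^sup>2) +
      3 * expectation (\<lambda>\<omega>. X b \<omega> ^ 4)"
    using iS iX i3 i2 orth_b by (simp add: S_def)
  also have "\<dots> \<le> 16 * (real ?m)\<^sup>2 * B + 8 * (4 * real ?m * B) + 3 * B"
    using IH cross insert.prems(2)[of b] by (intro add_mono mult_left_mono) auto
  also have "\<dots> \<le> 16 * (real (card (insert b I)))\<^sup>2 * B"
    using B0 bI insert.hyps(1) by (simp add: power2_eq_square algebra_simps)
  finally show ?case using bI insert.hyps(1) by (simp add: S_def add.commute)
qed

text \<open>A bound by local dependence: every index is correlated with at most \<open>N\<close>
  indices, and each mixed moment is at most \<open>K\<close> by the inequality between arithmetic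
  and geometric means.\<close>

lemma second_moment_sum_le:
  fixes g :: "'x \<Rightarrow> 'a \<Rightarrow> real"
  assumes fin: "finite B"
    and int: "\<And>x y. x \<in> B \<Longrightarrow> y \<in> B \<Longrightarrow> integrable M (\<lambda>\<omega>. g x \<omega> * g y \<omega>)"
    and K: "\<And>x. x \<in> B \<Longrightarrow> expectation (\<lambda>\<omega>. (g x \<omega>)\<^sup>2) \<le> K"
    and uncor: "\<And>x y. x \<in> B \<Longrightarrow> y \<in> B \<Longrightarrow> y \<notin> D x \<Longrightarrow> expectation (\<lambda>\<omega>. g x \<omega> * g y \<omega>) = 0"
    and D: "\<And>x. x \<in> B \<Longrightarrow> finite (D x) \<and> card (D x) \<le> N"
  shows "integrable M (\<lambda>\<omega>. (\<Sum>x\<in>B. g x \<omega>)\<^sup>2)"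
    "expectation (\<lambda>\<omega>. (\<Sum>x\<in>B. g x \<omega>)\<^sup>2) \<le> real (card B) * real N * K"
proof -
  have sq: "(\<lambda>\<omega>. (\<Sum>x\<in>B. g x \<omega>)\<^sup>2) = (\<lambda>\<omega>. \<Sum>x\<in>B. \<Sum>y\<in>B. g x \<omega> * g y \<omega>)"
    by (simp add: power2_eq_square sum_product)
  show "integrable M (\<lambda>\<omega>. (\<Sum>x\<in>B. g x \<omega>)\<^sup>2)"
    unfolding sq by (intro Bochner_Integration.integrable_sum int)
  have le: "expectation (\<lambda>\<omega>. g x \<omega> * g y \<omega>) \<le> K" if "x \<in> B" "y \<in> B" for x y
  proof -
    have i: "integrable M (\<lambda>\<omega>. (g z \<omega>)\<^sup>2)" if "z \<in> B" for z
      using int[OF that that] by (simp add: power2_eq_square)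
    have "g x \<omega> * g y \<omega> \<le> ((g x \<omega>)\<^sup>2 + (g y \<omega>)\<^sup>2) / 2" for \<omega>
      using sum_squares_ge_zero[of 0 "g x \<omega> - g y \<omega>"] by (simp add: power2_eq_square algebra_simps)
    then have "expectation (\<lambda>\<omega>. g x \<omega> * g y \<omega>) \<le> expectation (\<lambda>\<omega>. ((g x \<omega>)\<^sup>2 + (g y \<omega>)\<^sup>2) / 2)"
      using int that i by (intro integral_mono) auto
    also have "\<dots> = (expectation (\<lambda>\<omega>. (g x \<omega>)\<^sup>2) + expectation (\<lambda>\<omega>. (g y \<omega>)\<^sup>2)) / 2"
      using i that by simp
    also have "\<dots> \<le> K" using add_mono[OF K[OF that(1)] K[OF that(2)]] by simp
    finally show ?thesis .
  qed
  have "expectation (\<lambda>\<omega>. (\<Sum>x\<in>B. g x \<omega>)\<^sup>2) = (\<Sum>x\<in>B. \<Sum>y\<in>B. expectation (\<lambda>\<omega>. g x \<omega> * g y \<omega>))"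
    unfolding sq using int by (simp add: Bochner_Integration.integral_sum Bochner_Integration.integrable_sum)
  also have "\<dots> \<le> (\<Sum>x\<in>B. real N * K)"
  proof (rule sum_mono)
    fix x assume x: "x \<in> B"
    have K0: "0 \<le> K" using order_trans[OF _ K[OF x]] by simp
    have "(\<Sum>y\<in>B. expectation (\<lambda>\<omega>. g x \<omega> * g y \<omega>)) = (\<Sum>y\<in>B \<inter> D x. expectation (\<lambda>\<omega>. g x \<omega> * g y \<omega>))"
      using fin x uncor by (intro sum.mono_neutral_right) auto
    also have "\<dots> \<le> (\<Sum>y\<in>B \<inter> D x. K)" using le x by (intro sum_mono) auto
    also have "\<dots> = real (card (B \<inter> D x)) * K" by simp
    also have "\<dots> \<le> real N * K"
    proof -
      have "card (B \<inter> D x) \<le> card (D x)" using D[OF x] by (intro card_mono) auto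
      then show ?thesis using D[OF x] K0 by (intro mult_right_mono) auto
    qed
    finally show "(\<Sum>y\<in>B. expectation (\<lambda>\<omega>. g x \<omega> * g y \<omega>)) \<le> real N * K" .
  qed
  finally show "expectation (\<lambda>\<omega>. (\<Sum>x\<in>B. g x \<omega>)\<^sup>2) \<le> real (card B) * real N * K" by simp
qed

text \<open>The Cauchy-Schwarz inequality for the first absolute moment, read off pointwise from |f|
  <= (f^2 / s + s) / 2.\<close>

lemma expectation_abs_le:
  assumes "f \<in> borel_measurable M" "integrable M (\<lambda>\<omega>. (f \<omega>)\<^sup>2)" "expectation (\<lambda>\<omega>. (f \<omega>)\<^sup>2) \<le> s\<^sup>2" "s > 0"
  shows "integrable M f" "expectation (\<lambda>\<omega>. \<bar>f \<omega> :: real\<bar>) \<le> s"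
proof -
  have le: "\<bar>f \<omega>\<bar> \<le> ((f \<omega>)\<^sup>2 / s + s) / 2" for \<omega>
  proof -
    have "0 \<le> (\<bar>f \<omega>\<bar> - s)\<^sup>2 / (2 * s)" using assms by simp
    also have "\<dots> = ((f \<omega>)\<^sup>2 / s + s) / 2 - \<bar>f \<omega>\<bar>"
      using assms by (simp add: power2_diff field_simps power2_eq_square)
    finally show ?thesis by simp
  qed
  have iR: "integrable M (\<lambda>\<omega>. ((f \<omega>)\<^sup>2 / s + s) / 2)" using assms by auto
  show i: "integrable M f"
    by (rule Bochner_Integration.integrable_bound[OF iR]) (use assms le in \<open>auto intro!: AE_I2 order_trans[OF le]\<close>)
  have "expectation (\<lambda>\<omega>. \<bar>f \<omega>\<bar>) \<le> expectation (\<lambda>\<omega>. ((f \<omega>)\<^sup>2 / s + s) / 2)"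
    using le i iR by (intro integral_mono) auto
  also have "\<dots> = (expectation (\<lambda>\<omega>. (f \<omega>)\<^sup>2) / s + s) / 2" using assms by (simp add: prob_space)
  also have "\<dots> \<le> (s\<^sup>2 / s + s) / 2" using assms by (intro divide_right_mono add_mono) (auto simp: divide_right_mono)
  also have "\<dots> = s" using assms by (simp add: power2_eq_square)
  finally show "expectation (\<lambda>\<omega>. \<bar>f \<omega>\<bar>) \<le> s" .
qed

end

section \<open>Independent families of sub-sigma-algebras\<close>

text \<open>\<open>F J\<close> is the information carried by the independent sources with indices in \<open>J\<close>.\<close>

locale indep_fields = prob_space P for P :: "'w measure" +
  fixes F :: "'j set \<Rightarrow> 'w measure"
  assumes space_F: "space (F J) = space P"
    and sets_F: "sets (F J) \<subseteq> sets P"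
    and F_mono: "J \<subseteq> K \<Longrightarrow> sets (F J) \<subseteq> sets (F K)"
    and F_indep: "J \<inter> K = {} \<Longrightarrow> indep_set (sets (F J)) (sets (F K))"
begin

lemma F_measurable: "f \<in> measurable (F J) N \<Longrightarrow> f \<in> measurable P N"
  using sets_F[of J] by (auto simp: measurable_def space_F)

lemma F_measurable_mono: "f \<in> measurable (F J) N \<Longrightarrow> J \<subseteq> K \<Longrightarrow> f \<in> measurable (F K) N"
  using F_mono[of J K] by (auto simp: measurable_def space_F)

lemma indep_mult:
  fixes f g :: "'w \<Rightarrow> real"
  assumes f: "f \<in> borel_measurable (F J)" "integrable P f"
    and g: "g \<in> borel_measurable (F K)" "integrable P g" and JK: "J \<inter> K = {}"
  shows "integrable P (\<lambda>\<omega>. f \<omega> * g \<omega>)"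
    "expectation (\<lambda>\<omega>. f \<omega> * g \<omega>) = expectation f * expectation g"
proof -
  have sub: "sigma_sets (space P) {h -` A \<inter> space P |A. A \<in> sets borel} \<subseteq> sets (F L)"
    if "h \<in> borel_measurable (F L)" for h :: "'w \<Rightarrow> real" and L
    using measurable_sets[OF that] sets.sigma_sets_subset[of "{h -` A \<inter> space P |A. A \<in> sets borel}" "F L"]
    by (auto simp: space_F)
  have "indep_set (sigma_sets (space P) {f -` A \<inter> space P |A. A \<in> sets borel})
     (sigma_sets (space P) {g -` A \<inter> space P |A. A \<in> sets borel})"
    using F_indep[OF JK] unfolding indep_set_def
    by (rule indep_sets_mono_sets) (use sub[OF f(1)] sub[OF g(1)] in \<open>auto split: bool.split\<close>)
  then have "indep_var borel f borel g"
    unfolding indep_var_eq using F_measurable[OF f(1)] F_measurable[OF g(1)] by simp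
  then show "integrable P (\<lambda>\<omega>. f \<omega> * g \<omega>)"
    "expectation (\<lambda>\<omega>. f \<omega> * g \<omega>) = expectation f * expectation g"
    using f(2) g(2) by (auto intro: indep_var_integrable indep_var_lebesgue_integral)
qed

lemma L4_indep_mult:
  assumes f: "f \<in> borel_measurable (F J)" "L4 f"
    and g: "g \<in> borel_measurable (F K)" "L4 g" and JK: "J \<inter> K = {}"
  shows "L4 (\<lambda>\<omega>. f \<omega> * g \<omega>)"
    "expectation (\<lambda>\<omega>. (f \<omega> * g \<omega>) ^ 4) = expectation (\<lambda>\<omega>. f \<omega> ^ 4) * expectation (\<lambda>\<omega>. g \<omega> ^ 4)"
proof -
  have "(\<lambda>\<omega>. f \<omega> ^ 4) \<in> borel_measurable (F J)" "(\<lambda>\<omega>. g \<omega> ^ 4) \<in> borel_measurable (F K)"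
    using f g by measurable
  note m = indep_mult[OF this(1) L4_integrable(5)[OF f(2)] this(2) L4_integrable(5)[OF g(2)] JK]
  show "L4 (\<lambda>\<omega>. f \<omega> * g \<omega>)"
    using m(1) f g by (auto simp: L4_def power_mult_distrib)
  show "expectation (\<lambda>\<omega>. (f \<omega> * g \<omega>) ^ 4) = expectation (\<lambda>\<omega>. f \<omega> ^ 4) * expectation (\<lambda>\<omega>. g \<omega> ^ 4)"
    using m(2) by (simp add: power_mult_distrib)
qed

text \<open>The second expression depends on \<open>u\<close> through its covariance alone, which is
  why the second-order terms of Lindeberg's method agree for the noise and its Gaussian substitute.
  The coordinates of \<open>u\<close> are uncorrelated but may depend on each other; only the
  coefficients must come from other sources.\<close>

lemma quadratic_form_expectation:
  fixes f u :: "'i \<Rightarrow> 'w \<Rightarrow> real" and g :: "'w \<Rightarrow> real"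
  assumes A: "finite A"
    and g: "g \<in> borel_measurable (F J)"
    and f: "\<And>a. a \<in> A \<Longrightarrow> f a \<in> borel_measurable (F J)"
    and gf: "\<And>a b. a \<in> A \<Longrightarrow> b \<in> A \<Longrightarrow> integrable P (\<lambda>\<omega>. g \<omega> * (f a \<omega> * f b \<omega>))"
    and u: "\<And>a. a \<in> A \<Longrightarrow> u a \<in> borel_measurable (F K)" "\<And>a. a \<in> A \<Longrightarrow> L4 (u a)"
    and JK: "J \<inter> K = {}"
    and cov: "\<And>a b. a \<in> A \<Longrightarrow> b \<in> A \<Longrightarrow> expectation (\<lambda>\<omega>. u a \<omega> * u b \<omega>) = (if a = b then v a else 0)"
  shows "integrable P (\<lambda>\<omega>. g \<omega> * (\<Sum>a\<in>A. f a \<omega> * u a \<omega>)\<^sup>2)"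
    "expectation (\<lambda>\<omega>. g \<omega> * (\<Sum>a\<in>A. f a \<omega> * u a \<omega>)\<^sup>2) =
     expectation (\<lambda>\<omega>. g \<omega> * (\<Sum>a\<in>A. v a * (f a \<omega>)\<^sup>2))"
proof -
  have eq: "(\<lambda>\<omega>. g \<omega> * (\<Sum>a\<in>A. f a \<omega> * u a \<omega>)\<^sup>2) =
      (\<lambda>\<omega>. \<Sum>a\<in>A. \<Sum>b\<in>A. (g \<omega> * (f a \<omega> * f b \<omega>)) * (u a \<omega> * u b \<omega>))"
    by (rule ext) (simp add: power2_eq_square sum_product sum_distrib_left mult_ac)
  have m: "integrable P (\<lambda>\<omega>. (g \<omega> * (f a \<omega> * f b \<omega>)) * (u a \<omega> * u b \<omega>))"
    "expectation (\<lambda>\<omega>. (g \<omega> * (f a \<omega> * f b \<omega>)) * (u a \<omega> * u b \<omega>)) =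
     expectation (\<lambda>\<omega>. g \<omega> * (f a \<omega> * f b \<omega>)) * (if a = b then v a else 0)" if "a \<in> A" "b \<in> A" for a b
  proof -
    have 1: "(\<lambda>\<omega>. g \<omega> * (f a \<omega> * f b \<omega>)) \<in> borel_measurable (F J)"
      using g f[OF that(1)] f[OF that(2)] by measurable
    have 2: "(\<lambda>\<omega>. u a \<omega> * u b \<omega>) \<in> borel_measurable (F K)"
      using u(1)[OF that(1)] u(1)[OF that(2)] by measurable
    note m = indep_mult[OF 1 gf[OF that] 2 L4_integrable_mult[OF u(2)[OF that(1)] u(2)[OF that(2)]] JK]
    show "integrable P (\<lambda>\<omega>. (g \<omega> * (f a \<omega> * f b \<omega>)) * (u a \<omega> * u b \<omega>))"
    "expectation (\<lambda>\<omega>. (g \<omega> * (f a \<omega> * f b \<omega>)) * (u a \<omega> * u b \<omega>)) =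
     expectation (\<lambda>\<omega>. g \<omega> * (f a \<omega> * f b \<omega>)) * (if a = b then v a else 0)"
      using m cov[OF that] by auto
  qed
  show "integrable P (\<lambda>\<omega>. g \<omega> * (\<Sum>a\<in>A. f a \<omega> * u a \<omega>)\<^sup>2)"
    unfolding eq by (intro Bochner_Integration.integrable_sum m)
  have "expectation (\<lambda>\<omega>. g \<omega> * (\<Sum>a\<in>A. f a \<omega> * u a \<omega>)\<^sup>2) =
      (\<Sum>a\<in>A. \<Sum>b\<in>A. expectation (\<lambda>\<omega>. g \<omega> * (f a \<omega> * f b \<omega>)) * (if a = b then v a else 0))"
    unfolding eq using m by (simp add: Bochner_Integration.integral_sum Bochner_Integration.integrable_sum)
  also have "\<dots> = (\<Sum>a\<in>A. v a * expectation (\<lambda>\<omega>. g \<omega> * (f a \<omega> * f a \<omega>)))"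
  proof (intro sum.cong refl)
    fix a assume a: "a \<in> A"
    have "(\<Sum>b\<in>A. expectation (\<lambda>\<omega>. g \<omega> * (f a \<omega> * f b \<omega>)) * (if a = b then v a else 0)) =
        (\<Sum>b\<in>A. if a = b then v a * expectation (\<lambda>\<omega>. g \<omega> * (f a \<omega> * f a \<omega>)) else 0)"
      by (intro sum.cong) auto
    then show "(\<Sum>b\<in>A. expectation (\<lambda>\<omega>. g \<omega> * (f a \<omega> * f b \<omega>)) * (if a = b then v a else 0)) =
        v a * expectation (\<lambda>\<omega>. g \<omega> * (f a \<omega> * f a \<omega>))"
      using A a by simp
  qed
  also have "\<dots> = expectation (\<lambda>\<omega>. \<Sum>a\<in>A. v a * (g \<omega> * (f a \<omega> * f a \<omega>)))"
    using gf by (subst Bochner_Integration.integral_sum) auto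
  also have "\<dots> = expectation (\<lambda>\<omega>. g \<omega> * (\<Sum>a\<in>A. v a * (f a \<omega>)\<^sup>2))"
    by (simp add: sum_distrib_left power2_eq_square mult_ac)
  finally show "expectation (\<lambda>\<omega>. g \<omega> * (\<Sum>a\<in>A. f a \<omega> * u a \<omega>)\<^sup>2) =
     expectation (\<lambda>\<omega>. g \<omega> * (\<Sum>a\<in>A. v a * (f a \<omega>)\<^sup>2))" .
qed

lemma L4_linear_form:
  fixes f u :: "'i \<Rightarrow> 'w \<Rightarrow> real"
  assumes f: "\<And>a. a \<in> A \<Longrightarrow> f a \<in> borel_measurable (F J)" "\<And>a. a \<in> A \<Longrightarrow> L4 (f a)"
    and u: "\<And>a. a \<in> A \<Longrightarrow> u a \<in> borel_measurable (F K)" "\<And>a. a \<in> A \<Longrightarrow> L4 (u a)"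
    and JK: "J \<inter> K = {}"
  shows "L4 (\<lambda>\<omega>. \<Sum>a\<in>A. f a \<omega> * u a \<omega>)"
  using assms by (intro L4_sum L4_indep_mult(1)) auto

text \<open>The conditional Jensen inequality without conditional expectations. If X is the form and
  Z its conditional variance given \<open>F J\<close>, then E Z^2 = E (Z X^2) <= (E Z^2 + E X^4) /
  2.\<close>

lemma variance_square_le_fourth_moment:
  fixes f u :: "'i \<Rightarrow> 'w \<Rightarrow> real"
  assumes A: "finite A"
    and f: "\<And>a. a \<in> A \<Longrightarrow> f a \<in> borel_measurable (F J)" "\<And>a. a \<in> A \<Longrightarrow> L4 (f a)"
    and u: "\<And>a. a \<in> A \<Longrightarrow> u a \<in> borel_measurable (F K)" "\<And>a. a \<in> A \<Longrightarrow> L4 (u a)"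
    and JK: "J \<inter> K = {}"
    and cov: "\<And>a b. a \<in> A \<Longrightarrow> b \<in> A \<Longrightarrow> expectation (\<lambda>\<omega>. u a \<omega> * u b \<omega>) = (if a = b then v a else 0)"
  shows "expectation (\<lambda>\<omega>. (\<Sum>a\<in>A. v a * (f a \<omega>)\<^sup>2)\<^sup>2) \<le> expectation (\<lambda>\<omega>. (\<Sum>a\<in>A. f a \<omega> * u a \<omega>) ^ 4)"
proof -
  define Z where "Z = (\<lambda>\<omega>. \<Sum>a\<in>A. v a * (f a \<omega>)\<^sup>2)"
  define X where "X = (\<lambda>\<omega>. \<Sum>a\<in>A. f a \<omega> * u a \<omega>)"
  have Zm: "Z \<in> borel_measurable (F J)"
    unfolding Z_def using f(1) by (intro borel_measurable_sum borel_measurable_times borel_measurable_power) auto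
  have X: "L4 X" unfolding X_def by (rule L4_linear_form[OF f u JK])
  have ZF: "integrable P (\<lambda>\<omega>. Z \<omega> * (f a \<omega> * f b \<omega>))" if "a \<in> A" "b \<in> A" for a b
  proof -
    have "integrable P (\<lambda>\<omega>. \<Sum>c\<in>A. v c * (f c \<omega> * f c \<omega> * f a \<omega> * f b \<omega>))"
      using f that by (intro Bochner_Integration.integrable_sum integrable_mult_right L4_integrable_mult4) auto
    then show ?thesis by (simp add: Z_def sum_distrib_right power2_eq_square mult.assoc)
  qed
  have Z2: "integrable P (\<lambda>\<omega>. (Z \<omega>)\<^sup>2)"
  proof -
    have "integrable P (\<lambda>\<omega>. \<Sum>a\<in>A. v a * (Z \<omega> * (f a \<omega> * f a \<omega>)))"
      using ZF by (intro Bochner_Integration.integrable_sum integrable_mult_right) auto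
    also have "(\<lambda>\<omega>. \<Sum>a\<in>A. v a * (Z \<omega> * (f a \<omega> * f a \<omega>))) = (\<lambda>\<omega>. Z \<omega> * (\<Sum>a\<in>A. v a * (f a \<omega>)\<^sup>2))"
      by (simp add: sum_distrib_left power2_eq_square mult_ac)
    finally show ?thesis by (simp add: Z_def power2_eq_square)
  qed
  note q = quadratic_form_expectation[OF A Zm f(1) ZF u JK cov]
  have "expectation (\<lambda>\<omega>. (Z \<omega>)\<^sup>2) = expectation (\<lambda>\<omega>. Z \<omega> * (X \<omega>)\<^sup>2)"
    using q(2) by (simp add: X_def Z_def power2_eq_square)
  also have "\<dots> \<le> expectation (\<lambda>\<omega>. ((Z \<omega>)\<^sup>2 + X \<omega> ^ 4) / 2)"
  proof (rule integral_mono)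
    show "integrable P (\<lambda>\<omega>. Z \<omega> * (X \<omega>)\<^sup>2)" using q(1) by (simp add: X_def)
    show "integrable P (\<lambda>\<omega>. ((Z \<omega>)\<^sup>2 + X \<omega> ^ 4) / 2)" using Z2 L4_integrable(5)[OF X] by auto
    show "Z \<omega> * (X \<omega>)\<^sup>2 \<le> ((Z \<omega>)\<^sup>2 + X \<omega> ^ 4) / 2" for \<omega>
      using sum_squares_ge_zero[of 0 "Z \<omega> - (X \<omega>)\<^sup>2"] by (simp add: power2_eq_square power4_eq_xxxx algebra_simps)
  qed
  also have "\<dots> = (expectation (\<lambda>\<omega>. (Z \<omega>)\<^sup>2) + expectation (\<lambda>\<omega>. X \<omega> ^ 4)) / 2"
    using Z2 L4_integrable(5)[OF X] by simp
  finally show ?thesis by (simp add: X_def Z_def)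
qed

text \<open>Given \<open>F J\<close>, a Gaussian form is centred normal, with the variance that is
  squared on the right, and a centred normal variable has fourth moment three times its squared
  variance. Independence and four moments suffice for the identity: when a variable is added, its
  odd powers average out and the remaining terms complete the square.\<close>

lemma fourth_moment_gaussian_form:
  fixes f u :: "'i \<Rightarrow> 'w \<Rightarrow> real" and \<kappa> :: "'i \<Rightarrow> 'j"
  assumes A: "finite A"
    and f: "\<And>a. a \<in> A \<Longrightarrow> f a \<in> borel_measurable (F J)" "\<And>a. a \<in> A \<Longrightarrow> L4 (f a)"
    and u: "\<And>a. a \<in> A \<Longrightarrow> u a \<in> borel_measurable (F {\<kappa> a})" "\<And>a. a \<in> A \<Longrightarrow> L4 (u a)"
    and \<kappa>: "inj_on \<kappa> A" "\<kappa> ` A \<inter> J = {}"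
    and mom: "\<And>a. a \<in> A \<Longrightarrow> expectation (u a) = 0" "\<And>a. a \<in> A \<Longrightarrow> expectation (\<lambda>\<omega>. (u a \<omega>)\<^sup>2) = v a"
      "\<And>a. a \<in> A \<Longrightarrow> expectation (\<lambda>\<omega>. u a \<omega> ^ 3) = 0"
      "\<And>a. a \<in> A \<Longrightarrow> expectation (\<lambda>\<omega>. u a \<omega> ^ 4) = 3 * (v a)\<^sup>2"
  shows "expectation (\<lambda>\<omega>. (\<Sum>a\<in>A. f a \<omega> * u a \<omega>) ^ 4) =
     3 * expectation (\<lambda>\<omega>. (\<Sum>a\<in>A. v a * (f a \<omega>)\<^sup>2)\<^sup>2)"
  using assms
proof (induction A rule: finite_induct)
  case empty
  then show ?case by simp
next
  case (insert a A)
  note f = insert.prems(1,2) and u = insert.prems(3,4) and \<kappa> = insert.prems(5,6) and mom = insert.prems(7-10)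
  define S where "S = (\<lambda>\<omega>. \<Sum>b\<in>A. f b \<omega> * u b \<omega>)"
  define V where "V = (\<lambda>\<omega>. \<Sum>b\<in>A. v b * (f b \<omega>)\<^sup>2)"
  let ?J = "J \<union> \<kappa> ` A"
  have S_insert: "(\<Sum>b\<in>insert a A. f b \<omega> * u b \<omega>) = f a \<omega> * u a \<omega> + S \<omega>" for \<omega>
    using insert.hyps by (simp add: S_def)
  have V_insert: "(\<Sum>b\<in>insert a A. v b * (f b \<omega>)\<^sup>2) = v a * (f a \<omega>)\<^sup>2 + V \<omega>" for \<omega>
    using insert.hyps by (simp add: V_def)
  have IH: "expectation (\<lambda>\<omega>. S \<omega> ^ 4) = 3 * expectation (\<lambda>\<omega>. (V \<omega>)\<^sup>2)"
    unfolding S_def V_def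
  proof (rule insert.IH)
    show "inj_on \<kappa> A" using \<kappa>(1) by (rule inj_on_subset) auto
    show "\<kappa> ` A \<inter> J = {}" using \<kappa>(2) by auto
  qed (use f u mom in auto)
  have uA: "u b \<in> borel_measurable (F (\<kappa> ` A))" if "b \<in> A" for b
    using u(1)[of b] that by (auto intro: F_measurable_mono)
  have fa: "f a \<in> borel_measurable (F J)" "L4 (f a)" using f by auto
  have S: "L4 S" unfolding S_def
    by (rule L4_linear_form[of A f J u "\<kappa> ` A"]) (use f u uA \<kappa> in auto)
  have Sm: "S \<in> borel_measurable (F ?J)"
    unfolding S_def using f(1) uA
    by (intro borel_measurable_sum borel_measurable_times) (auto intro: F_measurable_mono)
  have fam: "f a \<in> borel_measurable (F ?J)" using fa(1) by (rule F_measurable_mono) auto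
  have ua: "u a \<in> borel_measurable (F {\<kappa> a})" "L4 (u a)" using u by auto
  have disj: "?J \<inter> {\<kappa> a} = {}" using \<kappa> insert.hyps by (auto simp: inj_on_def)
  have split: "integrable P (\<lambda>\<omega>. g \<omega> * u a \<omega> ^ k) \<and>
      expectation (\<lambda>\<omega>. g \<omega> * u a \<omega> ^ k) = expectation g * expectation (\<lambda>\<omega>. u a \<omega> ^ k)"
    if "g \<in> borel_measurable (F ?J)" "integrable P g" "integrable P (\<lambda>\<omega>. u a \<omega> ^ k)" for g k
  proof -
    have "(\<lambda>\<omega>. u a \<omega> ^ k) \<in> borel_measurable (F {\<kappa> a})" using ua(1) by measurable
    then show ?thesis using indep_mult[OF that(1,2) _ that(3) disj] by auto
  qed
  have cov: "expectation (\<lambda>\<omega>. u b \<omega> * u c \<omega>) = (if b = c then v b else 0)" if "b \<in> A" "c \<in> A" for b c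
  proof (cases "b = c")
    case True
    then show ?thesis using mom(2)[of b] that by (simp add: power2_eq_square)
  next
    case False
    then have "{\<kappa> b} \<inter> {\<kappa> c} = {}" using \<kappa>(1) that by (auto simp: inj_on_def)
    then have "expectation (\<lambda>\<omega>. u b \<omega> * u c \<omega>) = expectation (u b) * expectation (u c)"
      using u that by (intro indep_mult(2)[of "u b" "{\<kappa> b}" "u c" "{\<kappa> c}"]) (auto intro: L4_integrable)
    then show ?thesis using False mom(1) that by simp
  qed
  have Sf: "expectation (\<lambda>\<omega>. (f a \<omega>)\<^sup>2 * (S \<omega>)\<^sup>2) = expectation (\<lambda>\<omega>. (f a \<omega>)\<^sup>2 * V \<omega>)"
    unfolding S_def V_def
  proof (rule quadratic_form_expectation(2)[of A _ J f u "\<kappa> ` A"])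
    show "(\<lambda>\<omega>. (f a \<omega>)\<^sup>2) \<in> borel_measurable (F J)" using fa(1) by measurable
    show "integrable P (\<lambda>\<omega>. (f a \<omega>)\<^sup>2 * (f b \<omega> * f c \<omega>))" if "b \<in> A" "c \<in> A" for b c
      using L4_integrable_mult4[OF fa(2) fa(2) f(2)[of b] f(2)[of c]] that
      by (simp add: power2_eq_square mult.assoc)
  qed (use insert.hyps f u uA \<kappa> cov in auto)
  have iV2: "integrable P (\<lambda>\<omega>. (V \<omega>)\<^sup>2)"
  proof -
    have "integrable P (\<lambda>\<omega>. \<Sum>b\<in>A. \<Sum>c\<in>A. (v b * v c) * (f b \<omega> * f b \<omega> * f c \<omega> * f c \<omega>))"
      using f by (intro Bochner_Integration.integrable_sum integrable_mult_right L4_integrable_mult4) auto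
    then show ?thesis
      by (simp add: V_def power2_eq_square sum_product mult_ac)
  qed
  have iVf: "integrable P (\<lambda>\<omega>. (f a \<omega>)\<^sup>2 * V \<omega>)"
  proof -
    have "integrable P (\<lambda>\<omega>. \<Sum>b\<in>A. v b * (f a \<omega> * f a \<omega> * f b \<omega> * f b \<omega>))"
      using f by (intro Bochner_Integration.integrable_sum integrable_mult_right L4_integrable_mult4) auto
    then show ?thesis
      by (simp add: V_def power2_eq_square sum_distrib_left mult_ac)
  qed
  have t1: "integrable P (\<lambda>\<omega>. (S \<omega> ^ 3 * f a \<omega>) * u a \<omega> ^ 1)"
    "expectation (\<lambda>\<omega>. (S \<omega> ^ 3 * f a \<omega>) * u a \<omega> ^ 1) = 0"
    using split[of "\<lambda>\<omega>. S \<omega> ^ 3 * f a \<omega>" 1] Sm fam L4_integrable_mult4[OF S S S fa(2)] mom(1)[of a] L4_integrable(1)[OF ua(2)]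
    by (auto simp: power3_eq_cube)
  have t2: "integrable P (\<lambda>\<omega>. ((f a \<omega>)\<^sup>2 * (S \<omega>)\<^sup>2) * u a \<omega> ^ 2)"
    "expectation (\<lambda>\<omega>. ((f a \<omega>)\<^sup>2 * (S \<omega>)\<^sup>2) * u a \<omega> ^ 2) = expectation (\<lambda>\<omega>. (f a \<omega>)\<^sup>2 * (S \<omega>)\<^sup>2) * v a"
    using split[of "\<lambda>\<omega>. (f a \<omega>)\<^sup>2 * (S \<omega>)\<^sup>2" 2] Sm fam L4_integrable_square_mult[OF fa(2) S] mom(2)[of a] L4_integrable(2)[OF ua(2)]
    by auto
  have t3: "integrable P (\<lambda>\<omega>. (S \<omega> * f a \<omega> ^ 3) * u a \<omega> ^ 3)"
    "expectation (\<lambda>\<omega>. (S \<omega> * f a \<omega> ^ 3) * u a \<omega> ^ 3) = 0"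
    using split[of "\<lambda>\<omega>. S \<omega> * f a \<omega> ^ 3" 3] Sm fam L4_integrable_mult4[OF S fa(2) fa(2) fa(2)] mom(3)[of a] L4_integrable(4)[OF ua(2)]
    by (auto simp: power3_eq_cube mult.assoc)
  have t4: "integrable P (\<lambda>\<omega>. f a \<omega> ^ 4 * u a \<omega> ^ 4)"
    "expectation (\<lambda>\<omega>. f a \<omega> ^ 4 * u a \<omega> ^ 4) = expectation (\<lambda>\<omega>. f a \<omega> ^ 4) * (3 * (v a)\<^sup>2)"
    using split[of "\<lambda>\<omega>. f a \<omega> ^ 4" 4] fam L4_integrable(5)[OF fa(2)] mom(4)[of a] L4_integrable(5)[OF ua(2)]
    by auto
  have "(\<lambda>\<omega>. (\<Sum>b\<in>insert a A. f b \<omega> * u b \<omega>) ^ 4) =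
      (\<lambda>\<omega>. S \<omega> ^ 4 + 4 * ((S \<omega> ^ 3 * f a \<omega>) * u a \<omega> ^ 1) + 6 * (((f a \<omega>)\<^sup>2 * (S \<omega>)\<^sup>2) * u a \<omega> ^ 2) +
        4 * ((S \<omega> * f a \<omega> ^ 3) * u a \<omega> ^ 3) + f a \<omega> ^ 4 * u a \<omega> ^ 4)"
    unfolding S_insert by (intro ext) (simp add: power2_eq_square power3_eq_cube power4_eq_xxxx algebra_simps)
  then have "expectation (\<lambda>\<omega>. (\<Sum>b\<in>insert a A. f b \<omega> * u b \<omega>) ^ 4) =
      expectation (\<lambda>\<omega>. S \<omega> ^ 4) + 6 * (expectation (\<lambda>\<omega>. (f a \<omega>)\<^sup>2 * (S \<omega>)\<^sup>2) * v a) +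
      expectation (\<lambda>\<omega>. f a \<omega> ^ 4) * (3 * (v a)\<^sup>2)"
    using t1 t2 t3 t4 L4_integrable(5)[OF S] by simp
  also have "\<dots> = 3 * (expectation (\<lambda>\<omega>. (V \<omega>)\<^sup>2) + 2 * v a * expectation (\<lambda>\<omega>. (f a \<omega>)\<^sup>2 * V \<omega>) +
      (v a)\<^sup>2 * expectation (\<lambda>\<omega>. f a \<omega> ^ 4))"
    unfolding IH Sf by (simp add: algebra_simps)
  also have "\<dots> = 3 * expectation (\<lambda>\<omega>. (V \<omega>)\<^sup>2 + 2 * v a * ((f a \<omega>)\<^sup>2 * V \<omega>) + (v a)\<^sup>2 * f a \<omega> ^ 4)"
    using iV2 iVf L4_integrable(5)[OF fa(2)] by simp
  also have "(\<lambda>\<omega>. (V \<omega>)\<^sup>2 + 2 * v a * ((f a \<omega>)\<^sup>2 * V \<omega>) + (v a)\<^sup>2 * f a \<omega> ^ 4) =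
      (\<lambda>\<omega>. (\<Sum>b\<in>insert a A. v b * (f b \<omega>)\<^sup>2)\<^sup>2)"
    unfolding V_insert by (intro ext) (simp add: power2_eq_square power4_eq_xxxx algebra_simps)
  finally show ?case .
qed

end

section \<open>The noise and its Gaussian counterpart\<close>

lemma fourth_power_sum_le:
  fixes f :: "'a \<Rightarrow> real"
  shows "(\<Sum>i\<in>I. f i) ^ 4 \<le> real (card I) ^ 3 * (\<Sum>i\<in>I. f i ^ 4)"
proof -
  have "(\<Sum>i\<in>I. f i) ^ 4 = ((\<Sum>i\<in>I. f i)\<^sup>2)\<^sup>2" by simp
  also have "\<dots> \<le> ((\<Sum>i\<in>I. (f i)\<^sup>2) * real (card I))\<^sup>2"
    by (intro power_mono sum_squared_le_sum_of_squares) auto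
  also have "\<dots> = (\<Sum>i\<in>I. (f i)\<^sup>2)\<^sup>2 * (real (card I))\<^sup>2" by (simp add: power_mult_distrib)
  also have "\<dots> \<le> ((\<Sum>i\<in>I. ((f i)\<^sup>2)\<^sup>2) * real (card I)) * (real (card I))\<^sup>2"
    by (intro mult_right_mono sum_squared_le_sum_of_squares) auto
  finally show ?thesis by (simp add: power2_eq_square power3_eq_cube power4_eq_xxxx mult_ac)
qed

text \<open>The source \<open>Inl t\<close> carries the noise vector \<open>w t\<close>, and \<open>Inr (t, a)\<close> the standard Gaussian
  variable \<open>eps t a\<close>, where \<open>a = (\<tau>, i, j)\<close> consists of a lag and two coordinates.\<close>

locale noise = indep_fields P F for P :: "'w measure" and F :: "(int + int \<times> nat \<times> nat \<times> nat) set \<Rightarrow> 'w measure" +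
  fixes p q :: nat and lam :: "nat \<Rightarrow> real" and w :: "int \<Rightarrow> nat \<Rightarrow> 'w \<Rightarrow> real"
    and eps :: "int \<Rightarrow> nat \<times> nat \<times> nat \<Rightarrow> 'w \<Rightarrow> real" and C0 :: real
  assumes w_meas: "i < p \<Longrightarrow> w t i \<in> borel_measurable (F {Inl t})"
    and w_L4: "i < p \<Longrightarrow> L4 (w t i)"
    and w_mean: "i < p \<Longrightarrow> expectation (w t i) = 0"
    and w_cov: "i < p \<Longrightarrow> j < p \<Longrightarrow> expectation (\<lambda>\<omega>. w t i \<omega> * w t j \<omega>) = (if i = j then lam i else 0)"
    and w_inner: "s \<noteq> t \<Longrightarrow> expectation (\<lambda>\<omega>. (\<Sum>i<p. w s i \<omega> * w t i \<omega>) ^ 4) \<le> C0 * (real p)\<^sup>2"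
    and eps_meas: "eps t a \<in> borel_measurable (F {Inr (t, a)})"
    and eps_distr: "distr P borel (eps t a) = std_normal_distribution"
begin

lemma lam_nonneg: "i < p \<Longrightarrow> 0 \<le> lam i"
  using w_cov[of i i 0] Bochner_Integration.integral_nonneg[of P "\<lambda>\<omega>. w 0 i \<omega> * w 0 i \<omega>"] by simp

lemma C0_nonneg:
  assumes "p \<ge> 1" shows "0 \<le> C0"
proof -
  have "0 \<le> C0 * (real p)\<^sup>2"
    using order_trans[OF _ w_inner[of 0 1]] by simp
  then show ?thesis using assms by (simp add: zero_le_mult_iff)
qed

lemma eps_measurable [measurable]: "eps t a \<in> borel_measurable P"
  using eps_meas by (rule F_measurable)

lemma eps_moment:
  "expectation (\<lambda>\<omega>. eps t a \<omega> ^ k) = (LINT x|std_normal_distribution. x ^ k)"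
  "integrable P (\<lambda>\<omega>. eps t a \<omega> ^ k)"
proof -
  show "expectation (\<lambda>\<omega>. eps t a \<omega> ^ k) = (LINT x|std_normal_distribution. x ^ k)"
    unfolding eps_distr[of t a, symmetric] by (subst integral_distr) auto
  have "integrable (distr P borel (eps t a)) (\<lambda>x. x ^ k)"
    unfolding eps_distr by (rule integrable_std_normal_distribution_moment)
  then show "integrable P (\<lambda>\<omega>. eps t a \<omega> ^ k)" by (subst (asm) integrable_distr_eq) auto
qed

lemma eps_L4: "L4 (eps t a)"
  using eps_moment(2)[of t a 4] by (simp add: L4_def)

lemma eps_moments:
  "expectation (eps t a) = 0" "expectation (\<lambda>\<omega>. (eps t a \<omega>)\<^sup>2) = 1"
  "expectation (\<lambda>\<omega>. eps t a \<omega> ^ 3) = 0" "expectation (\<lambda>\<omega>. eps t a \<omega> ^ 4) = 3"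
proof -
  show "expectation (eps t a) = 0"
    using eps_moment(1)[of t a 1] integral_std_normal_distribution_moment_odd[of 1] by simp
  show "expectation (\<lambda>\<omega>. eps t a \<omega> ^ 3) = 0"
    using eps_moment(1)[of t a 3] integral_std_normal_distribution_moment_odd[of 3] by simp
  show "expectation (\<lambda>\<omega>. (eps t a \<omega>)\<^sup>2) = 1"
    using eps_moment(1)[of t a 2] std_normal_distribution_even_moments(1)[of 1] by simp
  show "expectation (\<lambda>\<omega>. eps t a \<omega> ^ 4) = 3"
    using eps_moment(1)[of t a 4] std_normal_distribution_even_moments(1)[of 2]
    by (simp add: fact_numeral)
qed

definition idx :: "(nat \<times> nat \<times> nat) set" where
  "idx = {1..q} \<times> {..<p} \<times> {..<p}"

text \<open>The variance of \<open>U b t a\<close>: the covariance of a tensor product of two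
  independent noise vectors has the products of two eigenvalues of \<Sigma> as eigenvalues, the same
  ones at each lag.\<close>

definition vr :: "nat \<times> nat \<times> nat \<Rightarrow> real" where
  "vr = (\<lambda>(\<tau>, i, j). lam i * lam j)"

text \<open>\<open>U True t\<close> collects the products of the coordinates of \<open>w t\<close> with those of its \<open>q\<close>
  predecessors, \<open>U False t\<close> is a Gaussian vector with the same covariance; \<open>srcs\<close> lists their
  sources, and \<open>core\<close> the sources in which they are linear.\<close>

definition U :: "bool \<Rightarrow> int \<Rightarrow> nat \<times> nat \<times> nat \<Rightarrow> 'w \<Rightarrow> real" where
  "U b t = (\<lambda>(\<tau>, i, j) \<omega>. if b then w t i \<omega> * w (t - int \<tau>) j \<omega>
     else sqrt (lam i * lam j) * eps t (\<tau>, i, j) \<omega>)"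

definition srcs :: "bool \<Rightarrow> int \<Rightarrow> (int + int \<times> nat \<times> nat \<times> nat) set" where
  "srcs b t = (if b then Inl ` {t - int q..t} else Inr ` ({t} \<times> idx))"

definition core :: "bool \<Rightarrow> int \<Rightarrow> (int + int \<times> nat \<times> nat \<times> nat) set" where
  "core b t = (if b then {Inl t} else srcs False t)"

lemma core_subset: "core b t \<subseteq> srcs b t"
  by (auto simp: core_def srcs_def)

lemma finite_idx [simp]: "finite idx"
  by (simp add: idx_def)

lemma srcs_disjoint: "\<bar>s - t\<bar> > int q \<Longrightarrow> srcs b s \<inter> srcs b' t = {}"
  by (auto simp: srcs_def)

lemma vr_nonneg: "a \<in> idx \<Longrightarrow> 0 \<le> vr a"
  using lam_nonneg by (auto simp: idx_def vr_def)

lemma U_meas: "a \<in> idx \<Longrightarrow> U b t a \<in> borel_measurable (F (srcs b t))"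
proof -
  assume a: "a \<in> idx"
  obtain \<tau> i j where [simp]: "a = (\<tau>, i, j)" by (cases a) auto
  from a have ij: "i < p" "j < p" "\<tau> \<in> {1..q}" by (auto simp: idx_def)
  show ?thesis
  proof (cases b)
    case True
    have "w t i \<in> borel_measurable (F (srcs b t))"
      by (rule F_measurable_mono[OF w_meas[OF ij(1)]]) (auto simp: srcs_def True)
    moreover have "w (t - int \<tau>) j \<in> borel_measurable (F (srcs b t))"
      by (rule F_measurable_mono[OF w_meas[OF ij(2)]]) (use ij in \<open>auto simp: srcs_def True\<close>)
    ultimately show ?thesis using True by (simp add: U_def)
  next
    case False
    have "eps t a \<in> borel_measurable (F (srcs b t))"
      by (rule F_measurable_mono[OF eps_meas]) (use a in \<open>auto simp: srcs_def False\<close>)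
    then show ?thesis using False by (simp add: U_def)
  qed
qed

lemma U_L4: "a \<in> idx \<Longrightarrow> L4 (U b t a)"
proof -
  assume a: "a \<in> idx"
  obtain \<tau> i j where [simp]: "a = (\<tau>, i, j)" by (cases a) auto
  from a have ij: "i < p" "j < p" "\<tau> \<in> {1..q}" by (auto simp: idx_def)
  show ?thesis
  proof (cases b)
    case True
    have "L4 (\<lambda>\<omega>. w t i \<omega> * w (t - int \<tau>) j \<omega>)"
      by (rule L4_indep_mult(1)[OF w_meas[OF ij(1)] w_L4[OF ij(1)] w_meas[OF ij(2)] w_L4[OF ij(2)]])
         (use ij in auto)
    then show ?thesis using True by (simp add: U_def)
  next
    case False
    then show ?thesis using L4_cmult[OF eps_L4] by (simp add: U_def)
  qed
qed

lemma eps_cov: "expectation (\<lambda>\<omega>. eps t a \<omega> * eps s b \<omega>) = (if t = s \<and> a = b then 1 else 0)"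
proof (cases "t = s \<and> a = b")
  case True
  then show ?thesis using eps_moments(2) by (simp add: power2_eq_square)
next
  case False
  then have "expectation (\<lambda>\<omega>. eps t a \<omega> * eps s b \<omega>) = expectation (eps t a) * expectation (eps s b)"
    by (intro indep_mult(2)[OF eps_meas _ eps_meas] L4_integrable(1) eps_L4) auto
  then show ?thesis using False eps_moments(1) by simp
qed

lemma w_prod_cov:
  assumes "i < p" "j < p"
  shows "expectation (\<lambda>\<omega>. w s i \<omega> * w t j \<omega>) = (if s = t \<and> i = j then lam i else 0)"
proof (cases "s = t")
  case True
  then show ?thesis using w_cov assms by simp
next
  case False
  then have "expectation (\<lambda>\<omega>. w s i \<omega> * w t j \<omega>) = expectation (w s i) * expectation (w t j)"
    using assms by (intro indep_mult(2)[OF w_meas _ w_meas] L4_integrable(1) w_L4) auto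
  then show ?thesis using False w_mean assms by simp
qed

text \<open>The coordinates of \<open>U True t\<close> are dependent, since they share noise
  vectors, but uncorrelated: the factors at time \<open>t\<close> split off, and different lags
  refer to independent centred vectors. So the noise has the diagonal covariance of the Gaussian
  substitute.\<close>

lemma U_cov:
  assumes ab: "a \<in> idx" "a' \<in> idx"
  shows "expectation (\<lambda>\<omega>. U b t a \<omega> * U b t a' \<omega>) = (if a = a' then vr a else 0)"
proof -
  obtain \<tau> i j where a [simp]: "a = (\<tau>, i, j)" by (cases a) auto
  obtain \<tau>' i' j' where a' [simp]: "a' = (\<tau>', i', j')" by (cases a') auto
  from ab have ij: "i < p" "j < p" "\<tau> \<in> {1..q}" "i' < p" "j' < p" "\<tau>' \<in> {1..q}" by (auto simp: idx_def)
  show ?thesis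
  proof (cases b)
    case True
    let ?K = "Inl ` {t - int q..t - 1} :: (int + int \<times> nat \<times> nat \<times> nat) set"
    have 1: "(\<lambda>\<omega>. w t i \<omega> * w t i' \<omega>) \<in> borel_measurable (F {Inl t})"
      using w_meas[OF ij(1)] w_meas[OF ij(4)] by measurable
    have "w (t - int \<tau>) j \<in> borel_measurable (F ?K)"
      by (rule F_measurable_mono[OF w_meas[OF ij(2)]]) (use ij in auto)
    moreover have "w (t - int \<tau>') j' \<in> borel_measurable (F ?K)"
      by (rule F_measurable_mono[OF w_meas[OF ij(5)]]) (use ij in auto)
    ultimately have 2: "(\<lambda>\<omega>. w (t - int \<tau>) j \<omega> * w (t - int \<tau>') j' \<omega>) \<in> borel_measurable (F ?K)"
      by measurable
    have "expectation (\<lambda>\<omega>. (w t i \<omega> * w t i' \<omega>) * (w (t - int \<tau>) j \<omega> * w (t - int \<tau>') j' \<omega>)) =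
        expectation (\<lambda>\<omega>. w t i \<omega> * w t i' \<omega>) * expectation (\<lambda>\<omega>. w (t - int \<tau>) j \<omega> * w (t - int \<tau>') j' \<omega>)"
      by (rule indep_mult(2)[OF 1 _ 2]) (use ij in \<open>auto intro!: L4_integrable_mult w_L4\<close>)
    also have "\<dots> = (if i = i' then lam i else 0) * (if \<tau> = \<tau>' \<and> j = j' then lam j else 0)"
      using ij by (simp add: w_prod_cov)
    also have "\<dots> = (if a = a' then vr a else 0)" by (auto simp: vr_def)
    finally show ?thesis using True by (simp add: U_def mult_ac)
  next
    case False
    have "expectation (\<lambda>\<omega>. U b t a \<omega> * U b t a' \<omega>) =
        expectation (\<lambda>\<omega>. (sqrt (lam i * lam j) * sqrt (lam i' * lam j')) * (eps t a \<omega> * eps t a' \<omega>))"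
      using False by (simp add: U_def mult_ac)
    also have "\<dots> = (sqrt (lam i * lam j) * sqrt (lam i' * lam j')) * (if a = a' then 1 else 0)"
      by (simp add: eps_cov del: a a')
    also have "\<dots> = (if a = a' then vr a else 0)"
      using lam_nonneg ij by (auto simp: vr_def)
    finally show ?thesis .
  qed
qed

text \<open>The vanishing of first-order terms. The factor \<open>g\<close> may involve the past
  noise vectors that enter \<open>U True k\<close>, as only the sources in \<open>core b k\<close>
  have to be new to it. The coefficients \<open>h\<close> avoid all sources of \<open>U b k\<close>,
  so that the products stay in \<open>L4\<close>. The integrability condition on \<open>g\<close>
  covers bounded functions as well as cubes of members of \<open>L4\<close>.\<close>

lemma form_mean_zero:
  assumes g: "g \<in> borel_measurable (F J)" and gi: "\<And>m. L4 m \<Longrightarrow> integrable P (\<lambda>\<omega>. g \<omega> * m \<omega>)"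
    and h: "\<And>a. a \<in> idx \<Longrightarrow> h a \<in> borel_measurable (F H)" "\<And>a. a \<in> idx \<Longrightarrow> L4 (h a)"
    and HJ: "H \<subseteq> J" and H: "H \<inter> srcs b k = {}" and J: "J \<inter> core b k = {}"
  shows "expectation (\<lambda>\<omega>. g \<omega> * (\<Sum>a\<in>idx. h a \<omega> * U b k a \<omega>)) = 0"
proof -
  have summand: "integrable P (\<lambda>\<omega>. g \<omega> * (h a \<omega> * U b k a \<omega>)) \<and>
      expectation (\<lambda>\<omega>. g \<omega> * (h a \<omega> * U b k a \<omega>)) = 0" if a: "a \<in> idx" for a
  proof -
    have ha: "h a \<in> borel_measurable (F H)" "L4 (h a)" using h a by auto
    note Ua = U_meas[OF a, of b k] U_L4[OF a, of b k]
    have int: "integrable P (\<lambda>\<omega>. g \<omega> * (h a \<omega> * U b k a \<omega>))"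
      by (rule gi[OF L4_indep_mult(1)[OF ha Ua H]])
    obtain \<tau> i j where at: "a = (\<tau>, i, j)" by (cases a) auto
    from a have ij: "i < p" "j < p" "\<tau> \<in> {1..q}" by (auto simp: at idx_def)
    have "expectation (\<lambda>\<omega>. g \<omega> * (h a \<omega> * U b k a \<omega>)) = 0"
    proof (cases b)
      case True
      let ?J = "J \<union> {Inl (k - int \<tau>)}"
      have wj: "w (k - int \<tau>) j \<in> borel_measurable (F {Inl (k - int \<tau>)})" by (rule w_meas[OF ij(2)])
      have m: "g \<in> borel_measurable (F ?J)" "h a \<in> borel_measurable (F ?J)"
        "w (k - int \<tau>) j \<in> borel_measurable (F ?J)"
        using F_measurable_mono[OF g, of ?J] F_measurable_mono[OF ha(1), of ?J] F_measurable_mono[OF wj, of ?J] HJ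
        by auto
      have L: "L4 (\<lambda>\<omega>. h a \<omega> * w (k - int \<tau>) j \<omega>)"
        by (rule L4_indep_mult(1)[OF ha wj w_L4[OF ij(2)]]) (use H ij in \<open>auto simp: srcs_def True\<close>)
      have "expectation (\<lambda>\<omega>. (g \<omega> * (h a \<omega> * w (k - int \<tau>) j \<omega>)) * w k i \<omega>) =
          expectation (\<lambda>\<omega>. g \<omega> * (h a \<omega> * w (k - int \<tau>) j \<omega>)) * expectation (w k i)"
      proof (rule indep_mult(2)[of _ ?J _ "{Inl k}"])
        show "(\<lambda>\<omega>. g \<omega> * (h a \<omega> * w (k - int \<tau>) j \<omega>)) \<in> borel_measurable (F ?J)"
          using m by measurable
      qed (use gi[OF L] w_meas[OF ij(1)] L4_integrable(1)[OF w_L4[OF ij(1)]] J ij in \<open>auto simp: core_def True\<close>)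
      then show ?thesis using w_mean[OF ij(1)] True by (simp add: at U_def mult_ac)
    next
      case False
      have m: "(\<lambda>\<omega>. g \<omega> * h a \<omega>) \<in> borel_measurable (F J)"
        using F_measurable_mono[OF ha(1) HJ] g by measurable
      have "expectation (\<lambda>\<omega>. (g \<omega> * h a \<omega>) * U b k a \<omega>) = expectation (\<lambda>\<omega>. g \<omega> * h a \<omega>) * expectation (U b k a)"
        by (rule indep_mult(2)[OF m gi[OF ha(2)] Ua(1) L4_integrable(1)[OF Ua(2)]])
           (use J in \<open>auto simp: core_def False\<close>)
      moreover have "expectation (U b k a) = 0"
        using False eps_moments(1) by (simp add: at U_def)
      ultimately show ?thesis by (simp add: mult.assoc)
    qed
    with int show ?thesis by simp
  qed
  have "expectation (\<lambda>\<omega>. g \<omega> * (\<Sum>a\<in>idx. h a \<omega> * U b k a \<omega>)) =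
      (\<Sum>a\<in>idx. expectation (\<lambda>\<omega>. g \<omega> * (h a \<omega> * U b k a \<omega>)))"
    using summand by (simp add: sum_distrib_left Bochner_Integration.integral_sum)
  then show ?thesis using summand by simp
qed

section \<open>Scalar products of noise vectors and forms in their tensor products\<close>

definition ip :: "int \<Rightarrow> int \<Rightarrow> 'w \<Rightarrow> real" where
  "ip s t \<omega> = (\<Sum>i<p. w s i \<omega> * w t i \<omega>)"

lemma ip_commute: "ip s t = ip t s"
  by (rule ext) (simp add: ip_def mult.commute)

lemma ip_meas: "ip s t \<in> borel_measurable (F {Inl s, Inl t})"
  unfolding ip_def
  by (intro borel_measurable_sum borel_measurable_times F_measurable_mono[OF w_meas]) auto

lemma ip_L4: "s \<noteq> t \<Longrightarrow> L4 (ip s t)"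
  unfolding ip_def
  by (rule L4_linear_form[of _ _ "{Inl s}" _ "{Inl t}"]) (auto intro: w_meas w_L4)

lemma ip_fourth: "s \<noteq> t \<Longrightarrow> expectation (\<lambda>\<omega>. ip s t \<omega> ^ 4) \<le> C0 * (real p)\<^sup>2"
  using w_inner by (simp add: ip_def)

definition form :: "(nat \<Rightarrow> real) \<Rightarrow> bool \<Rightarrow> int \<Rightarrow> bool \<Rightarrow> int \<Rightarrow> 'w \<Rightarrow> real" where
  "form \<gamma> b s b' t \<omega> = (\<Sum>a\<in>idx. \<gamma> (fst a) * U b s a \<omega> * U b' t a \<omega>)"

lemma form_commute: "form \<gamma> b s b' t = form \<gamma> b' t b s"
  by (rule ext) (simp add: form_def mult_ac)

lemma form_weight_meas: "a \<in> idx \<Longrightarrow> (\<lambda>\<omega>. \<gamma> (fst a) * U b s a \<omega>) \<in> borel_measurable (F (srcs b s))"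
  by (intro borel_measurable_times U_meas) auto

lemma form_meas: "form \<gamma> b s b' t \<in> borel_measurable (F (srcs b s \<union> srcs b' t))"
  unfolding form_def
  by (intro borel_measurable_sum borel_measurable_times F_measurable_mono[OF U_meas]) auto

lemma form_L4: "\<bar>s - t\<bar> > int q \<Longrightarrow> L4 (form \<gamma> b s b' t)"
  unfolding form_def
  by (rule L4_linear_form[OF form_weight_meas _ U_meas U_L4 srcs_disjoint]) (auto intro: L4_cmult U_L4)

text \<open>The scalar product of two tensor products factorizes, which turns the form into the
  products of scalar products that \<open>G_stat\<close> is made of.\<close>

lemma form_noise:
  "form \<gamma> True s True t \<omega> = (\<Sum>\<tau>=1..q. \<gamma> \<tau> * (ip s t \<omega> * ip (s - int \<tau>) (t - int \<tau>) \<omega>))"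
proof -
  have ip_mult: "ip s t \<omega> * ip s' t' \<omega> = (\<Sum>i<p. \<Sum>j<p. (w s i \<omega> * w t i \<omega>) * (w s' j \<omega> * w t' j \<omega>))" for s' t'
    by (simp only: ip_def sum_product)
  have "form \<gamma> True s True t \<omega> = (\<Sum>\<tau>=1..q. \<Sum>i<p. \<Sum>j<p.
      \<gamma> \<tau> * (w s i \<omega> * w (s - int \<tau>) j \<omega>) * (w t i \<omega> * w (t - int \<tau>) j \<omega>))"
    unfolding form_def idx_def U_def by (simp add: sum.cartesian_product case_prod_beta)
  also have "\<dots> = (\<Sum>\<tau>=1..q. \<gamma> \<tau> * (ip s t \<omega> * ip (s - int \<tau>) (t - int \<tau>) \<omega>))"
    unfolding ip_mult by (simp add: sum_distrib_left mult_ac)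
  finally show ?thesis .
qed

text \<open>For s and t more than \<open>q\<close> apart, the times s, t, s - \<tau> and t - \<tau>
  are distinct. So the two scalar products are independent, their fourth moments multiply, and the
  square of C0 p^2 appears. Summing \<open>q\<close> lags by convexity costs q^4 in total.\<close>

lemma form_noise_fourth:
  assumes st: "\<bar>s - t\<bar> > int q" and \<gamma>: "\<And>\<tau>. \<tau> \<in> {1..q} \<Longrightarrow> \<bar>\<gamma> \<tau>\<bar> \<le> \<kappa>"
  shows "expectation (\<lambda>\<omega>. form \<gamma> True s True t \<omega> ^ 4) \<le> (real q * \<kappa>) ^ 4 * (C0 * (real p)\<^sup>2)\<^sup>2"
proof -
  let ?X = "\<lambda>\<tau> \<omega>. \<gamma> \<tau> * (ip s t \<omega> * ip (s - int \<tau>) (t - int \<tau>) \<omega>)"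
  have X: "L4 (?X \<tau>)" "expectation (\<lambda>\<omega>. ?X \<tau> \<omega> ^ 4) \<le> \<kappa> ^ 4 * (C0 * (real p)\<^sup>2)\<^sup>2" if \<tau>: "\<tau> \<in> {1..q}" for \<tau>
  proof -
    have ne: "s \<noteq> t" "s - int \<tau> \<noteq> t - int \<tau>" using st by auto
    have disj: "{Inl s, Inl t} \<inter> {Inl (s - int \<tau>), Inl (t - int \<tau>)} = ({} :: (int + int \<times> nat \<times> nat \<times> nat) set)"
      using st \<tau> by auto
    note m = L4_indep_mult[OF ip_meas ip_L4[OF ne(1)] ip_meas ip_L4[OF ne(2)] disj]
    show "L4 (?X \<tau>)" by (rule L4_cmult[OF m(1)])
    have "expectation (\<lambda>\<omega>. ?X \<tau> \<omega> ^ 4) = \<gamma> \<tau> ^ 4 * (expectation (\<lambda>\<omega>. ip s t \<omega> ^ 4) *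
        expectation (\<lambda>\<omega>. ip (s - int \<tau>) (t - int \<tau>) \<omega> ^ 4))"
      unfolding m(2)[symmetric] by (simp add: power_mult_distrib)
    also have "\<dots> \<le> \<kappa> ^ 4 * ((C0 * (real p)\<^sup>2) * (C0 * (real p)\<^sup>2))"
    proof (intro mult_mono ip_fourth ne)
      show "\<gamma> \<tau> ^ 4 \<le> \<kappa> ^ 4" using power_mono[OF \<gamma>[OF \<tau>], of 4] by simp
      show "0 \<le> C0 * (real p)\<^sup>2" using order_trans[OF _ ip_fourth[OF ne(1)]] by simp
    qed auto
    finally show "expectation (\<lambda>\<omega>. ?X \<tau> \<omega> ^ 4) \<le> \<kappa> ^ 4 * (C0 * (real p)\<^sup>2)\<^sup>2"
      by (simp add: power2_eq_square)
  qed
  have i: "integrable P (\<lambda>\<omega>. ?X \<tau> \<omega> ^ 4)" if "\<tau> \<in> {1..q}" for \<tau>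
    using X(1)[OF that] by (rule L4_integrable)
  have "expectation (\<lambda>\<omega>. form \<gamma> True s True t \<omega> ^ 4) \<le> expectation (\<lambda>\<omega>. real q ^ 3 * (\<Sum>\<tau>=1..q. ?X \<tau> \<omega> ^ 4))"
  proof (rule integral_mono)
    show "integrable P (\<lambda>\<omega>. form \<gamma> True s True t \<omega> ^ 4)"
      by (rule L4_integrable(5)[OF form_L4[OF st]])
    show "integrable P (\<lambda>\<omega>. real q ^ 3 * (\<Sum>\<tau>=1..q. ?X \<tau> \<omega> ^ 4))"
      by (intro integrable_mult_right Bochner_Integration.integrable_sum i)
    show "form \<gamma> True s True t \<omega> ^ 4 \<le> real q ^ 3 * (\<Sum>\<tau>=1..q. ?X \<tau> \<omega> ^ 4)" for \<omega>
      unfolding form_noise using fourth_power_sum_le[of "\<lambda>\<tau>. ?X \<tau> \<omega>" "{1..q}"] by simp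
  qed
  also have "\<dots> = real q ^ 3 * (\<Sum>\<tau>=1..q. expectation (\<lambda>\<omega>. ?X \<tau> \<omega> ^ 4))"
    using i by (simp add: Bochner_Integration.integral_sum del: mult_cancel_left mult_eq_0_iff)
  also have "\<dots> \<le> real q ^ 3 * (\<Sum>\<tau>=1..q. \<kappa> ^ 4 * (C0 * (real p)\<^sup>2)\<^sup>2)"
    using X(2) by (intro mult_left_mono sum_mono) auto
  also have "\<dots> = (real q * \<kappa>) ^ 4 * (C0 * (real p)\<^sup>2)\<^sup>2"
    by (simp add: power_mult_distrib power3_eq_cube power4_eq_xxxx)
  finally show ?thesis .
qed

text \<open>Given \<open>U b s\<close>, a Gaussian form has fourth moment three times its squared variance; the form
  with the noise has the same variance, and Jensen's inequality applies to it.\<close>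

lemma form_gauss_fourth:
  assumes "\<bar>s - t\<bar> > int q" "\<bar>s - t'\<bar> > int q"
  shows "expectation (\<lambda>\<omega>. form \<gamma> b s False t \<omega> ^ 4) \<le> 3 * expectation (\<lambda>\<omega>. form \<gamma> b s True t' \<omega> ^ 4)"
proof -
  let ?f = "\<lambda>a \<omega>. \<gamma> (fst a) * U b s a \<omega>"
  have f: "\<And>a. a \<in> idx \<Longrightarrow> ?f a \<in> borel_measurable (F (srcs b s))" "\<And>a. a \<in> idx \<Longrightarrow> L4 (?f a)"
    by (auto intro: form_weight_meas L4_cmult U_L4)
  have gm: "U False t a \<in> borel_measurable (F {Inr (t, a)})" for a
    unfolding U_def using eps_meas[of t a] by (cases a) auto
  have mom: "expectation (U False t a) = 0" "expectation (\<lambda>\<omega>. (U False t a \<omega>)\<^sup>2) = vr a"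
      "expectation (\<lambda>\<omega>. U False t a \<omega> ^ 3) = 0" "expectation (\<lambda>\<omega>. U False t a \<omega> ^ 4) = 3 * (vr a)\<^sup>2"
    if a: "a \<in> idx" for a
  proof -
    obtain \<tau> i j where at: "a = (\<tau>, i, j)" by (cases a) auto
    have nn: "0 \<le> lam i * lam j" using vr_nonneg[OF a] by (simp add: at vr_def)
    have s4: "sqrt (lam i * lam j) ^ 4 = (lam i * lam j)\<^sup>2"
      using nn power_mult[of "sqrt (lam i * lam j)" 2 2] by simp
    show "expectation (U False t a) = 0" "expectation (\<lambda>\<omega>. U False t a \<omega> ^ 3) = 0"
      using eps_moments by (auto simp: U_def at power_mult_distrib)
    show "expectation (\<lambda>\<omega>. (U False t a \<omega>)\<^sup>2) = vr a"
      using U_cov[OF a a, of False t] by (simp add: power2_eq_square)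
    show "expectation (\<lambda>\<omega>. U False t a \<omega> ^ 4) = 3 * (vr a)\<^sup>2"
      using eps_moments(4) s4 by (simp add: U_def at vr_def power_mult_distrib)
  qed
  have "expectation (\<lambda>\<omega>. form \<gamma> b s False t \<omega> ^ 4) = 3 * expectation (\<lambda>\<omega>. (\<Sum>a\<in>idx. vr a * (?f a \<omega>)\<^sup>2)\<^sup>2)"
    unfolding form_def
    by (rule fourth_moment_gaussian_form[OF finite_idx f gm U_L4, of "\<lambda>x. x"])
       (use mom srcs_disjoint[OF assms(1), of b False] in \<open>auto simp: inj_on_def srcs_def\<close>)
  also have "\<dots> \<le> 3 * expectation (\<lambda>\<omega>. form \<gamma> b s True t' \<omega> ^ 4)"
    unfolding form_def
    using variance_square_le_fourth_moment[OF finite_idx f U_meas U_L4 srcs_disjoint[OF assms(2), of b True] U_cov]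
    by simp
  finally show ?thesis .
qed

text \<open>Every Gaussian argument costs a factor 3 in comparison with the noise, hence 9 in the
  worst case.\<close>

lemma form_fourth:
  assumes st: "\<bar>s - t\<bar> > int q" and \<gamma>: "\<And>\<tau>. \<tau> \<in> {1..q} \<Longrightarrow> \<bar>\<gamma> \<tau>\<bar> \<le> \<kappa>"
  shows "expectation (\<lambda>\<omega>. form \<gamma> b s b' t \<omega> ^ 4) \<le> 9 * ((real q * \<kappa>) ^ 4 * (C0 * (real p)\<^sup>2)\<^sup>2)"
proof -
  let ?B = "(real q * \<kappa>) ^ 4 * (C0 * (real p)\<^sup>2)\<^sup>2"
  have B: "0 \<le> ?B" by simp
  have B9: "?B \<le> 9 * ?B" and B3: "3 * ?B \<le> 9 * ?B" using B by linarith+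
  have vv: "expectation (\<lambda>\<omega>. form \<gamma> True s True t \<omega> ^ 4) \<le> ?B" if "\<bar>s - t\<bar> > int q" for s t
    using form_noise_fourth[OF that] \<gamma> by blast
  have vY: "expectation (\<lambda>\<omega>. form \<gamma> True s False t \<omega> ^ 4) \<le> 3 * ?B" if "\<bar>s - t\<bar> > int q" for s t
    using form_gauss_fourth[OF that, of t \<gamma> True] vv[of s t] that by (simp add: mult_ac)
  have YY: "expectation (\<lambda>\<omega>. form \<gamma> False s False t \<omega> ^ 4) \<le> 9 * ?B"
  proof -
    \<comment> \<open>Any time further than \<open>q\<close> from \<open>s\<close> could serve as
      the noise partner, because the bound for two noise arguments does not depend on the
      times.\<close>
    have far: "\<bar>s - (s + int q + 1)\<bar> > int q" "\<bar>(s + int q + 1) - s\<bar> > int q" by auto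
    have "expectation (\<lambda>\<omega>. form \<gamma> False s True (s + int q + 1) \<omega> ^ 4) \<le> 3 * ?B"
      using vY[OF far(2)] by (simp add: form_commute[of \<gamma> False])
    then show ?thesis using form_gauss_fourth[OF st far(1), of \<gamma> False] by simp
  qed
  consider "b \<and> b'" | "b \<and> \<not> b'" | "\<not> b \<and> b'" | "\<not> b \<and> \<not> b'" by blast
  then show ?thesis
  proof cases
    case 1 then show ?thesis using order_trans[OF vv[OF st] B9] by simp
  next
    case 2 then show ?thesis using order_trans[OF vY[OF st] B3] by simp
  next
    case 3
    have "\<bar>t - s\<bar> > int q" using st by simp
    with 3 show ?thesis using order_trans[OF vY[of t s] B3] by (simp add: form_commute[of \<gamma> False])
  next
    case 4 then show ?thesis using YY by simp
  qed
qed

end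

section \<open>Replacing the noise by Gaussian vectors\<close>

text \<open>This is the real part of the second-order expansion of exp (i x), multiplied by exp (i
  r); the complex remainder is at most |x|^3 / 6.\<close>

lemma cos_taylor2:
  fixes r x :: real
  shows "\<bar>cos (r + x) - (cos r - x * sin r - x\<^sup>2 / 2 * cos r)\<bar> \<le> \<bar>x\<bar> ^ 3 / 6"
proof -
  have e: "(\<Sum>k\<le>2. (\<i> * complex_of_real x) ^ k / fact k) = Complex (1 - x\<^sup>2 / 2) x"
    by (simp add: numeral_2_eq_2 complex_eq_iff power2_eq_square field_simps)
  have b: "cmod (iexp x - Complex (1 - x\<^sup>2 / 2) x) \<le> \<bar>x\<bar> ^ 3 / 6"
    using iexp_approx1[of x 2] unfolding e by (simp add: fact_numeral numeral_3_eq_3)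
  have "cos (r + x) - (cos r - x * sin r - x\<^sup>2 / 2 * cos r) =
      Re (iexp r * (iexp x - Complex (1 - x\<^sup>2 / 2) x))"
    by (simp add: Re_exp Im_exp cos_add algebra_simps)
  also have "\<bar>\<dots>\<bar> \<le> cmod (iexp r * (iexp x - Complex (1 - x\<^sup>2 / 2) x))"
    by (rule abs_Re_le_cmod)
  also have "\<dots> \<le> \<bar>x\<bar> ^ 3 / 6" using b by (simp add: norm_mult)
  finally show ?thesis .
qed

lemma abs_cos_diff_le: "\<bar>cos x - cos y\<bar> \<le> \<bar>x - y :: real\<bar>"
proof -
  have "\<bar>cos x - cos y\<bar> \<le> \<bar>2 * sin ((x + y) / 2)\<bar> * \<bar>sin ((y - x) / 2)\<bar>"
    by (simp add: cos_diff_cos abs_mult)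
  also have "\<dots> \<le> 2 * \<bar>(y - x) / 2\<bar>"
    by (intro mult_mono abs_sin_x_le_abs_x) (auto simp: abs_mult)
  finally show ?thesis by simp
qed

text \<open>Here \<open>x\<close> is the part of the form that is replaced and \<open>e\<close> the
  part that shares sources with it. The quadratic coefficient is taken at \<open>r\<close> without
  \<open>e\<close>, in order to be independent of the replaced vector; the price is x^2 |e| / 2. The
  free length \<open>d\<close> converts these cubic errors into fourth powers, for which moment
  bounds are available.\<close>

lemma cos_perturbed_taylor2:
  fixes r e x \<phi> d :: real
  assumes d: "d > 0"
  shows "\<bar>cos (r + e + x + \<phi>) - (cos (r + e + \<phi>) - sin (r + e + \<phi>) * x - cos (r + \<phi>) * x\<^sup>2 / 2)\<bar> \<le>
    (2 * x ^ 4 + e ^ 4 + d ^ 4) / d"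
proof -
  have t: "\<bar>cos (r + e + x + \<phi>) - (cos (r + e + \<phi>) - x * sin (r + e + \<phi>) - x\<^sup>2 / 2 * cos (r + e + \<phi>))\<bar> \<le> \<bar>x\<bar> ^ 3 / 6"
    using cos_taylor2[of "r + e + \<phi>" x] by (simp add: add_ac)
  have c: "\<bar>cos (r + e + \<phi>) - cos (r + \<phi>)\<bar> \<le> \<bar>e\<bar>"
    using abs_cos_diff_le[of "r + e + \<phi>" "r + \<phi>"] by simp
  have c2: "\<bar>x\<^sup>2 / 2 * cos (r + e + \<phi>) - x\<^sup>2 / 2 * cos (r + \<phi>)\<bar> \<le> x\<^sup>2 / 2 * \<bar>e\<bar>"
    using mult_left_mono[OF c, of "x\<^sup>2 / 2"]
    unfolding right_diff_distrib[symmetric] abs_mult by simp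
  have "\<bar>cos (r + e + x + \<phi>) - (cos (r + e + \<phi>) - sin (r + e + \<phi>) * x - cos (r + \<phi>) * x\<^sup>2 / 2)\<bar> \<le>
      \<bar>x\<bar> ^ 3 / 6 + x\<^sup>2 / 2 * \<bar>e\<bar>"
  proof -
    have "\<bar>u - v\<bar> \<le> a + b" if "\<bar>u\<bar> \<le> a" "\<bar>v\<bar> \<le> b" for u v a b :: real
      using that by linarith
    from this[OF t c2] show ?thesis by (simp add: algebra_simps)
  qed
  also have "\<dots> \<le> (2 * x ^ 4 + e ^ 4 + d ^ 4) / d"
  proof -
    have "\<bar>x\<bar> ^ 3 * d \<le> 3 * x ^ 4 + d ^ 4"
      using abs_mult4_le[of x x x d] d by (simp add: abs_mult power3_eq_cube)
    moreover have "x\<^sup>2 * \<bar>e\<bar> * d \<le> 2 * x ^ 4 + e ^ 4 + d ^ 4"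
      using abs_mult4_le[of x x e d] d by (simp add: abs_mult power2_eq_square)
    moreover have "0 \<le> e ^ 4" "0 \<le> x ^ 4" "0 \<le> d ^ 4" by simp_all
    ultimately have "(\<bar>x\<bar> ^ 3 / 6 + x\<^sup>2 / 2 * \<bar>e\<bar>) * d \<le> 2 * x ^ 4 + e ^ 4 + d ^ 4"
      unfolding distrib_right times_divide_eq_left by linarith
    then show ?thesis using d by (simp add: field_simps)
  qed
  finally show ?thesis .
qed

text \<open>Two times of \<open>W\<close> differ by at most \<open>m\<close>, so that no pair of the
  sum lies in \<open>W\<close> altogether. A pair that meets \<open>W\<close> is listed by its only
  member there; symmetry of \<open>B\<close> makes it irrelevant whether that is the earlier or the
  later one.\<close>

lemma sum_pairs_window:
  fixes B :: "int \<Rightarrow> int \<Rightarrow> real"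
  assumes T: "finite T" and sym: "\<And>s t. B s t = B t s"
    and W: "\<And>s t. s \<in> W \<Longrightarrow> t \<in> W \<Longrightarrow> t \<le> s + m"
  shows "(\<Sum>(s, t)\<in>{(s, t) \<in> T \<times> T. s + m < t}. B s t) =
    (\<Sum>(s, t)\<in>{(s, t) \<in> (T - W) \<times> (T - W). s + m < t}. B s t) +
    (\<Sum>s\<in>T \<inter> W. \<Sum>t\<in>{t \<in> T - W. s + m < t \<or> t + m < s}. B s t)"
proof -
  let ?P0 = "{(s, t) \<in> (T - W) \<times> (T - W). s + m < t}"
  let ?P1 = "{(s, t) \<in> (T \<inter> W) \<times> (T - W). s + m < t}"
  let ?P2 = "{(s, t) \<in> (T - W) \<times> (T \<inter> W). s + m < t}"
  let ?P3 = "{(s, t) \<in> (T \<inter> W) \<times> (T - W). t + m < s}"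
  have fin: "finite ?P0" "finite ?P1" "finite ?P2" "finite ?P3"
    by (rule finite_subset[of _ "T \<times> T"], use T in auto)+
  have disj: "?P0 \<inter> (?P1 \<union> ?P2) = {}" "?P1 \<inter> ?P2 = {}" by auto
  have split: "{(s, t) \<in> T \<times> T. s + m < t} = ?P0 \<union> (?P1 \<union> ?P2)"
    using W by force
  have "(\<Sum>(s, t)\<in>{(s, t) \<in> T \<times> T. s + m < t}. B s t) =
      (\<Sum>(s, t)\<in>?P0. B s t) + ((\<Sum>(s, t)\<in>?P1. B s t) + (\<Sum>(s, t)\<in>?P2. B s t))"
    by (simp only: split sum.union_disjoint[OF fin(1) finite_UnI[OF fin(2,3)] disj(1)]
        sum.union_disjoint[OF fin(2,3) disj(2)])
  also have "(\<Sum>(s, t)\<in>?P2. B s t) = (\<Sum>(s, t)\<in>?P3. B s t)"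
    by (rule sum.reindex_bij_witness[of _ prod.swap prod.swap]) (auto simp: sym)
  also have "(\<Sum>(s, t)\<in>?P1. B s t) + (\<Sum>(s, t)\<in>?P3. B s t) = (\<Sum>(s, t)\<in>?P1 \<union> ?P3. B s t)"
  proof (rule sum.union_disjoint[symmetric])
    show "?P1 \<inter> ?P3 = {}"
    proof -
      have False if "s \<in> W" "s + m < t" "t + m < s" for s t :: int
        using W[OF that(1) that(1)] that by linarith
      then show ?thesis by auto
    qed
  qed (fact fin)+
  also have "?P1 \<union> ?P3 = Sigma (T \<inter> W) (\<lambda>s. {t \<in> T - W. s + m < t \<or> t + m < s})" by auto
  also have "(\<Sum>(s, t)\<in>Sigma (T \<inter> W) (\<lambda>s. {t \<in> T - W. s + m < t \<or> t + m < s}). B s t) =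
      (\<Sum>s\<in>T \<inter> W. \<Sum>t\<in>{t \<in> T - W. s + m < t \<or> t + m < s}. B s t)"
    using T by (subst sum.Sigma) auto
  finally show ?thesis .
qed

section \<open>Hybrid forms and the replacement of one vector\<close>

context noise
begin

text \<open>With \<open>q + 1\<close> as the first time, t - \<tau> is at least 1 for every lag, and
  the circular convention does not interfere.\<close>

definition times :: "nat \<Rightarrow> int set" where
  "times n = {int q + 1..int n}"

text \<open>The noise occupies the times before \<open>k\<close>: the value \<open>int q + 1\<close>
  of \<open>k\<close> gives the purely Gaussian form, \<open>int n + 1\<close> the noise form. Pairs
  at most \<open>q\<close> apart are left out so that the two arguments of a form never share
  sources.\<close>

definition hybrid :: "nat \<Rightarrow> (nat \<Rightarrow> real) \<Rightarrow> int \<Rightarrow> 'w \<Rightarrow> real" where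
  "hybrid n \<gamma> k \<omega> = (\<Sum>(s, t)\<in>{(s, t) \<in> times n \<times> times n. s + int q < t}. form \<gamma> (s < k) s (t < k) t \<omega>)"

text \<open>In increasing order of t every summand brings in new \<open>core\<close> sources, and
  \<open>form_mean_zero\<close> yields the orthogonality of martingale differences. This holds on
  whichever side of the times in \<open>I\<close> the fixed time \<open>s\<close> lies.\<close>

lemma form_row:
  assumes I: "finite I" "\<And>t. t \<in> I \<Longrightarrow> \<bar>s - t\<bar> > int q"
    and B: "\<And>t. t \<in> I \<Longrightarrow> expectation (\<lambda>\<omega>. form \<gamma> b s (t < k) t \<omega> ^ 4) \<le> B"
  shows "L4 (\<lambda>\<omega>. \<Sum>t\<in>I. form \<gamma> b s (t < k) t \<omega>)"
    "expectation (\<lambda>\<omega>. (\<Sum>t\<in>I. form \<gamma> b s (t < k) t \<omega>) ^ 4) \<le> 16 * (real (card I))\<^sup>2 * B"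
proof -
  show "L4 (\<lambda>\<omega>. \<Sum>t\<in>I. form \<gamma> b s (t < k) t \<omega>)" by (intro L4_sum form_L4 I)
  show "expectation (\<lambda>\<omega>. (\<Sum>t\<in>I. form \<gamma> b s (t < k) t \<omega>) ^ 4) \<le> 16 * (real (card I))\<^sup>2 * B"
  proof (rule fourth_moment_sum_le[OF I(1) form_L4[OF I(2)] B])
    fix r assume r: "r \<in> I"
    define S where "S = (\<lambda>\<omega>. \<Sum>t\<in>{t \<in> I. t < r}. form \<gamma> b s (t < k) t \<omega>)"
    define J where "J = srcs b s \<union> (\<Union>t\<in>{t \<in> I. t < r}. srcs (t < k) t)"
    have S: "L4 S" unfolding S_def by (intro L4_sum form_L4 I) auto
    have Sm: "S \<in> borel_measurable (F J)"
      unfolding S_def J_def by (intro borel_measurable_sum F_measurable_mono[OF form_meas]) auto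
    have "expectation (\<lambda>\<omega>. S \<omega> ^ 3 * (\<Sum>a\<in>idx. (\<gamma> (fst a) * U b s a \<omega>) * U (r < k) r a \<omega>)) = 0"
    proof (rule form_mean_zero[of _ J _ "srcs b s"])
      show "(\<lambda>\<omega>. S \<omega> ^ 3) \<in> borel_measurable (F J)" using Sm by measurable
      show "integrable P (\<lambda>\<omega>. S \<omega> ^ 3 * m \<omega>)" if "L4 m" for m
        using L4_integrable_mult4[OF S S S that] by (simp add: power3_eq_cube)
      show "srcs b s \<inter> srcs (r < k) r = {}" by (rule srcs_disjoint[OF I(2)[OF r]])
      have "srcs (t < k) t \<inter> core (r < k) r = {}" if "t < r" for t
        using that by (auto simp: srcs_def core_def)
      moreover have "srcs b s \<inter> core (r < k) r = {}"
        using core_subset[of "r < k" r] srcs_disjoint[OF I(2)[OF r], of b "r < k"] by auto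
      ultimately show "J \<inter> core (r < k) r = {}" unfolding J_def by auto
    qed (auto simp: J_def intro: form_weight_meas L4_cmult U_L4)
    then show "expectation (\<lambda>\<omega>. (\<Sum>t\<in>{t \<in> I. t < r}. form \<gamma> b s (t < k) t \<omega>) ^ 3 * form \<gamma> b s (r < k) r \<omega>) = 0"
      by (simp add: S_def form_def)
  qed
qed

text \<open>The window reaches only backwards: after \<open>k\<close> both hybrids are Gaussian and
  share nothing with the vectors at \<open>k\<close>, while the \<open>q\<close> times before carry
  noise that overlaps with \<open>U True k\<close>. Each hybrid is within 4 d^3 of a common value
  \<open>M0\<close>.\<close>

lemma lindeberg_step:
  assumes k: "k \<in> times n"
    and B: "\<And>b s b' t. \<bar>s - t\<bar> > int q \<Longrightarrow> expectation (\<lambda>\<omega>. form \<gamma> b s b' t \<omega> ^ 4) \<le> B"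
    and d: "d > 0" "16 * (real n)\<^sup>2 * B \<le> d ^ 4" "real q ^ 4 * (16 * (real n)\<^sup>2 * B) \<le> d ^ 4"
  shows "\<bar>expectation (\<lambda>\<omega>. cos (hybrid n \<gamma> (k + 1) \<omega> + \<phi>)) - expectation (\<lambda>\<omega>. cos (hybrid n \<gamma> k \<omega> + \<phi>))\<bar> \<le> 8 * d ^ 3"
proof -
  \<comment> \<open>\<open>R\<close> involves no time in the window \<open>W\<close>, hence none of the noise vectors in \<open>U True k\<close>; \<open>D\<close> is
    what else in the quadratic form does not involve time \<open>k\<close>.\<close>
  define W where "W = {k - int q..k}"
  define T where "T = times n - W"
  define I where "I = (\<lambda>s. {t \<in> T. s + int q < t \<or> t + int q < s})"
  define R where "R = (\<lambda>\<omega>. \<Sum>(s, t)\<in>{(s, t) \<in> T \<times> T. s + int q < t}. form \<gamma> (s < k) s (t < k) t \<omega>)"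
  define L where "L = (\<lambda>b s \<omega>. \<Sum>t\<in>I s. form \<gamma> b s (t < k) t \<omega>)"
  define D where "D = (\<lambda>\<omega>. \<Sum>s\<in>times n \<inter> W - {k}. L True s \<omega>)"
  define J where "J = (\<Union>t\<in>T. srcs (t < k) t)"
  define JD where "JD = J \<union> (\<Union>s\<in>times n \<inter> W - {k}. srcs True s)"
  have finT: "finite (times n)" "finite T" by (auto simp: times_def T_def)
  have finI: "finite (I s)" for s using finT by (auto simp: I_def)
  have kW: "k \<in> times n \<inter> W" using k by (auto simp: W_def)
  have kT: "t \<in> T \<Longrightarrow> t \<noteq> k" for t by (auto simp: T_def W_def)
  have Ifar: "\<bar>s - t\<bar> > int q" if "t \<in> I s" for s t using that by (auto simp: I_def)
  have B0: "0 \<le> B"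
    using order_trans[OF _ B[of 0 "int q + 1" True True]] by simp
  have cardI: "16 * (real (card (I s)))\<^sup>2 * B \<le> 16 * (real n)\<^sup>2 * B" for s
  proof -
    have "card (I s) \<le> card (times n)" using finT by (intro card_mono) (auto simp: I_def T_def)
    then have "card (I s) \<le> n" by (simp add: times_def)
    then show ?thesis using B0 by (intro mult_right_mono mult_left_mono power_mono) auto
  qed
  have L4L: "L4 (L b s)" and EL: "expectation (\<lambda>\<omega>. L b s \<omega> ^ 4) \<le> 16 * (real n)\<^sup>2 * B" for b s
    using form_row[where s = s and \<gamma> = \<gamma> and b = b and k = k and I = "I s", OF finI Ifar B[OF Ifar]] cardI[of s] by (auto simp: L_def)
  \<comment> \<open>A hybrid whose flags agree with those of \<open>hybrid n \<gamma> k\<close> away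
    from \<open>k\<close> can differ from it only in the row \<open>L\<close> of time
    \<open>k\<close>.\<close>
  have hyb: "hybrid n \<gamma> k' \<omega> = R \<omega> + D \<omega> + L (k < k') k \<omega>"
    if k': "\<And>s. s \<noteq> k \<Longrightarrow> (s < k') = (s < k)" for k' \<omega>
  proof -
    have "hybrid n \<gamma> k' \<omega> = (\<Sum>(s, t)\<in>{(s, t) \<in> T \<times> T. s + int q < t}. form \<gamma> (s < k') s (t < k') t \<omega>) +
      (\<Sum>s\<in>times n \<inter> W. \<Sum>t\<in>I s. form \<gamma> (s < k') s (t < k') t \<omega>)"
      unfolding hybrid_def T_def I_def
      by (rule sum_pairs_window) (auto simp: finT W_def form_commute)
    also have "(\<Sum>(s, t)\<in>{(s, t) \<in> T \<times> T. s + int q < t}. form \<gamma> (s < k') s (t < k') t \<omega>) = R \<omega>"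
      unfolding R_def by (intro sum.cong refl) (use k' kT in auto)
    also have "(\<Sum>s\<in>times n \<inter> W. \<Sum>t\<in>I s. form \<gamma> (s < k') s (t < k') t \<omega>) = (\<Sum>s\<in>times n \<inter> W. L (s < k') s \<omega>)"
      unfolding L_def using k' kT by (intro sum.cong refl) (auto simp: I_def)
    also have "\<dots> = L (k < k') k \<omega> + (\<Sum>s\<in>times n \<inter> W - {k}. L (s < k') s \<omega>)"
      using kW finT by (subst sum.remove[of _ k]) auto
    also have "(\<Sum>s\<in>times n \<inter> W - {k}. L (s < k') s \<omega>) = D \<omega>"
      unfolding D_def
    proof (rule sum.cong[OF refl])
      fix s assume s: "s \<in> times n \<inter> W - {k}"
      then have "s < k" by (auto simp: W_def)
      then have "(s < k') = True" using k'[of s] s by simp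
      then show "L (s < k') s \<omega> = L True s \<omega>" by (simp only:)
    qed
    finally show ?thesis by simp
  qed
  have hyb_True: "hybrid n \<gamma> (k + 1) \<omega> = R \<omega> + D \<omega> + L True k \<omega>" for \<omega>
    using hyb[of "k + 1" \<omega>] by force
  have hyb_False: "hybrid n \<gamma> k \<omega> = R \<omega> + D \<omega> + L False k \<omega>" for \<omega>
    using hyb[of k \<omega>] by simp
  have JJD: "J \<subseteq> JD" by (auto simp: JD_def)
  have Ik: "I k \<subseteq> T" "\<And>s. I s \<subseteq> T" by (auto simp: I_def)
  have Jk: "J \<inter> srcs b k = {}" for b
  proof -
    have "srcs (t < k) t \<inter> srcs b k = {}" if "t \<in> T" for t
      using that by (auto simp: T_def W_def srcs_def)
    then show ?thesis by (auto simp: J_def)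
  qed
  have JDk: "JD \<inter> core b k = {}" for b
  proof -
    have "srcs True s \<inter> core b k = {}" if "s \<in> times n \<inter> W - {k}" for s
      using that by (auto simp: W_def srcs_def core_def)
    then show ?thesis using Jk[of b] core_subset[of b k] by (auto simp: JD_def)
  qed
  have Rm: "R \<in> borel_measurable (F J)"
  proof -
    have "form \<gamma> (s < k) s (t < k) t \<in> borel_measurable (F J)" if "s \<in> T" "t \<in> T" for s t
      by (rule F_measurable_mono[OF form_meas]) (use that in \<open>auto simp: J_def\<close>)
    then show ?thesis unfolding R_def by (intro borel_measurable_sum) auto
  qed
  have Dm: "D \<in> borel_measurable (F JD)"
  proof -
    have "form \<gamma> True s (t < k) t \<in> borel_measurable (F JD)" if "s \<in> times n \<inter> W - {k}" "t \<in> T" for s t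
      by (rule F_measurable_mono[OF form_meas]) (use that in \<open>auto simp: J_def JD_def\<close>)
    then show ?thesis unfolding D_def L_def using Ik(2)
      by (intro borel_measurable_sum) blast
  qed
  have L4D: "L4 D" unfolding D_def by (intro L4_sum L4L)
  \<comment> \<open>\<open>D\<close> consists of at most \<open>q\<close> rows, which is the reason
    for the factor q^4 in the second condition on \<open>d\<close>.\<close>
  have ED: "expectation (\<lambda>\<omega>. D \<omega> ^ 4) \<le> d ^ 4"
  proof -
    let ?S = "times n \<inter> W - {k}"
    have "?S \<subseteq> {k - int q..k - 1}" by (auto simp: W_def)
    from card_mono[OF _ this] have card: "card ?S \<le> q" by simp
    have i: "integrable P (\<lambda>\<omega>. L True s \<omega> ^ 4)" for s by (rule L4_integrable(5)[OF L4L])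
    have "expectation (\<lambda>\<omega>. D \<omega> ^ 4) \<le> expectation (\<lambda>\<omega>. real (card ?S) ^ 3 * (\<Sum>s\<in>?S. L True s \<omega> ^ 4))"
      using L4_integrable(5)[OF L4D] i unfolding D_def
      by (intro integral_mono fourth_power_sum_le) auto
    also have "\<dots> = real (card ?S) ^ 3 * (\<Sum>s\<in>?S. expectation (\<lambda>\<omega>. L True s \<omega> ^ 4))"
      using i by (simp add: Bochner_Integration.integral_sum)
    also have "\<dots> \<le> real (card ?S) ^ 3 * (\<Sum>s\<in>?S. 16 * (real n)\<^sup>2 * B)"
      by (intro mult_left_mono sum_mono EL) auto
    also have "\<dots> = real (card ?S) ^ 4 * (16 * (real n)\<^sup>2 * B)"
      by (simp add: power3_eq_cube power4_eq_xxxx)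
    also have "\<dots> \<le> real q ^ 4 * (16 * (real n)\<^sup>2 * B)"
      using card B0 by (intro mult_right_mono power_mono) auto
    finally show ?thesis using d(3) by linarith
  qed
  \<comment> \<open>The row of time \<open>k\<close> is linear in \<open>U b k\<close>; its
    coefficients involve the sources in \<open>J\<close> alone, because the partners of
    \<open>k\<close> lie outside the window.\<close>
  define h where "h = (\<lambda>a \<omega>. \<gamma> (fst a) * (\<Sum>t\<in>I k. U (t < k) t a \<omega>))"
  have hm: "h a \<in> borel_measurable (F J)" if "a \<in> idx" for a
  proof -
    have "U (t < k) t a \<in> borel_measurable (F J)" if "t \<in> I k" for t
      by (rule F_measurable_mono[OF U_meas[OF \<open>a \<in> idx\<close>]]) (use that Ik in \<open>auto simp: J_def\<close>)
    then show ?thesis unfolding h_def by (intro borel_measurable_times borel_measurable_sum) auto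
  qed
  have L4h: "L4 (h a)" if "a \<in> idx" for a
    unfolding h_def using that by (intro L4_cmult L4_sum U_L4)
  have Lk: "L b k \<omega> = (\<Sum>a\<in>idx. h a \<omega> * U b k a \<omega>)" for b \<omega>
    unfolding L_def form_def h_def
    by (subst sum.swap) (simp add: sum_distrib_left sum_distrib_right mult_ac)
  \<comment> \<open>In the first-order term \<open>D\<close> may be retained: it avoids the
    \<open>core\<close> sources of time \<open>k\<close>, and no more is required.\<close>
  have first: "expectation (\<lambda>\<omega>. sin (R \<omega> + D \<omega> + \<phi>) * L b k \<omega>) = 0" for b
    unfolding Lk
  proof (rule form_mean_zero[OF _ _ hm L4h JJD Jk JDk])
    show g: "(\<lambda>\<omega>. sin (R \<omega> + D \<omega> + \<phi>)) \<in> borel_measurable (F JD)"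
      using F_measurable_mono[OF Rm JJD] Dm by measurable
    show "integrable P (\<lambda>\<omega>. sin (R \<omega> + D \<omega> + \<phi>) * m \<omega>)" if "L4 m" for m
      by (rule integrable_bounded_mult[OF L4_integrable(1)[OF that] F_measurable[OF g], of 1]) simp
  qed
  have cm: "(\<lambda>\<omega>. cos (R \<omega> + \<phi>)) \<in> borel_measurable (F J)" using Rm by measurable
  \<comment> \<open>Here \<open>D\<close> had to be dropped, since the covariance identity needs a
    factor independent of all sources of \<open>U b k\<close>. The result no longer depends on
    \<open>b\<close>.\<close>
  have second: "expectation (\<lambda>\<omega>. cos (R \<omega> + \<phi>) * (L b k \<omega>)\<^sup>2) =
      expectation (\<lambda>\<omega>. cos (R \<omega> + \<phi>) * (\<Sum>a\<in>idx. vr a * (h a \<omega>)\<^sup>2))" for b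
    unfolding Lk
  proof (rule quadratic_form_expectation(2)[OF finite_idx cm hm _ U_meas U_L4 Jk U_cov])
    show "integrable P (\<lambda>\<omega>. cos (R \<omega> + \<phi>) * (h a \<omega> * h b \<omega>))" if "a \<in> idx" "b \<in> idx" for a b
      by (rule integrable_bounded_mult[OF L4_integrable_mult[OF L4h[OF that(1)] L4h[OF that(2)]] F_measurable[OF cm], of 1]) simp
  qed
  have [measurable]: "R \<in> borel_measurable P" "D \<in> borel_measurable P" "L b k \<in> borel_measurable P" for b
    using F_measurable[OF Rm] F_measurable[OF Dm] L4_measurable[OF L4L] by auto
  define M0 where "M0 = expectation (\<lambda>\<omega>. cos (R \<omega> + D \<omega> + \<phi>)) -
     expectation (\<lambda>\<omega>. cos (R \<omega> + \<phi>) * (\<Sum>a\<in>idx. vr a * (h a \<omega>)\<^sup>2)) / 2"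
  have close: "\<bar>expectation (\<lambda>\<omega>. cos (R \<omega> + D \<omega> + L b k \<omega> + \<phi>)) - M0\<bar> \<le> 4 * d ^ 3" for b
  proof -
    let ?T = "\<lambda>\<omega>. cos (R \<omega> + D \<omega> + \<phi>) - sin (R \<omega> + D \<omega> + \<phi>) * L b k \<omega> - cos (R \<omega> + \<phi>) * (L b k \<omega>)\<^sup>2 / 2"
    have i0: "integrable P (\<lambda>\<omega>. cos (R \<omega> + D \<omega> + L b k \<omega> + \<phi>))" "integrable P (\<lambda>\<omega>. cos (R \<omega> + D \<omega> + \<phi>))"
      by (auto intro!: integrable_const_bound[of _ 1])
    have i1: "integrable P (\<lambda>\<omega>. sin (R \<omega> + D \<omega> + \<phi>) * L b k \<omega>)"
      by (rule integrable_bounded_mult[OF L4_integrable(1)[OF L4L], of _ 1]) auto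
    have i2: "integrable P (\<lambda>\<omega>. cos (R \<omega> + \<phi>) * (L b k \<omega>)\<^sup>2)"
      by (rule integrable_bounded_mult[OF L4_integrable(2)[OF L4L], of _ 1]) auto
    have iT: "integrable P ?T" using i0(2) i1 i2 by auto
    have ET: "expectation ?T = M0"
      using i0(2) i1 i2 first[of b] second[of b] by (simp add: M0_def)
    have i4: "integrable P (\<lambda>\<omega>. (2 * L b k \<omega> ^ 4 + D \<omega> ^ 4 + d ^ 4) / d)"
      using L4_integrable(5)[OF L4L[of b k]] L4_integrable(5)[OF L4D] by auto
    have "\<bar>expectation (\<lambda>\<omega>. cos (R \<omega> + D \<omega> + L b k \<omega> + \<phi>)) - M0\<bar> =
        \<bar>expectation (\<lambda>\<omega>. cos (R \<omega> + D \<omega> + L b k \<omega> + \<phi>) - ?T \<omega>)\<bar>"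
      unfolding ET[symmetric] by (subst Bochner_Integration.integral_diff[OF i0(1) iT]) simp
    also have "\<dots> \<le> expectation (\<lambda>\<omega>. \<bar>cos (R \<omega> + D \<omega> + L b k \<omega> + \<phi>) - ?T \<omega>\<bar>)"
      by (rule integral_abs_bound)
    also have "\<dots> \<le> expectation (\<lambda>\<omega>. (2 * L b k \<omega> ^ 4 + D \<omega> ^ 4 + d ^ 4) / d)"
      using i0(1) iT i4 cos_perturbed_taylor2[OF d(1)] by (intro integral_mono) auto
    also have "\<dots> = (2 * expectation (\<lambda>\<omega>. L b k \<omega> ^ 4) + expectation (\<lambda>\<omega>. D \<omega> ^ 4) + d ^ 4) / d"
      using L4_integrable(5)[OF L4L[of b k]] L4_integrable(5)[OF L4D] by (simp add: prob_space)
    also have "\<dots> \<le> (2 * d ^ 4 + d ^ 4 + d ^ 4) / d"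
      using d(1) ED order_trans[OF EL d(2)] by (intro divide_right_mono add_mono mult_left_mono) auto
    also have "\<dots> = 4 * d ^ 3" using d(1) by (simp add: field_simps power3_eq_cube power4_eq_xxxx)
    finally show ?thesis .
  qed
  show ?thesis
    unfolding hyb_True hyb_False using close[of True] close[of False] by linarith
qed

text \<open>Telescoping over the \<open>n - q\<close> elements of \<open>times n\<close>; for n < q
  the forms are empty sums.\<close>

lemma lindeberg:
  assumes B: "\<And>b s b' t. \<bar>s - t\<bar> > int q \<Longrightarrow> expectation (\<lambda>\<omega>. form \<gamma> b s b' t \<omega> ^ 4) \<le> B"
    and d: "d > 0" "16 * (real n)\<^sup>2 * B \<le> d ^ 4" "real q ^ 4 * (16 * (real n)\<^sup>2 * B) \<le> d ^ 4"
  shows "\<bar>expectation (\<lambda>\<omega>. cos (hybrid n \<gamma> (int n + 1) \<omega> + \<phi>)) - expectation (\<lambda>\<omega>. cos (hybrid n \<gamma> (int q + 1) \<omega> + \<phi>))\<bar> \<le>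
    8 * real n * d ^ 3"
proof (cases "q \<le> n")
  case False
  then have "hybrid n \<gamma> k = (\<lambda>_. 0)" for k
    by (auto simp: hybrid_def times_def fun_eq_iff intro!: sum.neutral)
  then show ?thesis using d(1) by simp
next
  case True
  have "\<bar>expectation (\<lambda>\<omega>. cos (hybrid n \<gamma> (int q + 1 + int m) \<omega> + \<phi>)) - expectation (\<lambda>\<omega>. cos (hybrid n \<gamma> (int q + 1) \<omega> + \<phi>))\<bar> \<le>
      real m * (8 * d ^ 3)" if "m \<le> n - q" for m
    using that
  proof (induction m)
    case 0
    then show ?case by simp
  next
    case (Suc m)
    have "int q + 1 + int m \<in> times n" using Suc.prems True by (auto simp: times_def)
    from lindeberg_step[OF this B d, of \<phi>]
    have "\<bar>expectation (\<lambda>\<omega>. cos (hybrid n \<gamma> (int q + 1 + int (Suc m)) \<omega> + \<phi>)) -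
        expectation (\<lambda>\<omega>. cos (hybrid n \<gamma> (int q + 1 + int m) \<omega> + \<phi>))\<bar> \<le> 8 * d ^ 3"
      by (simp add: add_ac)
    with Suc show ?case by (simp add: distrib_right)
  qed
  from this[of "n - q"] True
  have "\<bar>expectation (\<lambda>\<omega>. cos (hybrid n \<gamma> (int n + 1) \<omega> + \<phi>)) - expectation (\<lambda>\<omega>. cos (hybrid n \<gamma> (int q + 1) \<omega> + \<phi>))\<bar> \<le>
      real (n - q) * (8 * d ^ 3)"
    by (simp add: algebra_simps of_nat_diff)
  also have "\<dots> \<le> real n * (8 * d ^ 3)" using d(1) by (intro mult_right_mono) auto
  finally show ?thesis by (simp add: mult_ac)
qed

end

section \<open>The Gaussian quadratic form\<close>

text \<open>Counting each unordered pair once puts the weight 1/2 on the diagonal. For Gaussian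
  \<open>f\<close> the resulting terms are centred and uncorrelated; those with s + q < t belong to
  the Gaussian form, the others to a narrow band along the diagonal.\<close>

lemma half_square_sum:
  fixes f :: "int \<Rightarrow> real"
  assumes "finite T"
  shows "((\<Sum>t\<in>T. f t)\<^sup>2 - real (card T)) / 2 =
    (\<Sum>(s, t)\<in>{(s, t) \<in> T \<times> T. s \<le> t}. (if s = t then 1 / 2 else 1) * (f s * f t - (if s = t then 1 else 0)))"
proof -
  let ?L = "{(s, t) \<in> T \<times> T. s < t}" and ?G = "{(s, t) \<in> T \<times> T. t < s}" and ?E = "(\<lambda>t. (t, t)) ` T"
  have fin: "finite ?L" "finite ?G" "finite ?E"
    by (rule finite_subset[of _ "T \<times> T"], use assms in auto)+
  have split: "T \<times> T = ?E \<union> (?L \<union> ?G)" "{(s, t) \<in> T \<times> T. s \<le> t} = ?E \<union> ?L"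
    by auto
  have disj: "?E \<inter> (?L \<union> ?G) = {}" "?L \<inter> ?G = {}" "?E \<inter> ?L = {}" by auto
  have E: "(\<Sum>(s, t)\<in>?E. h s t) = (\<Sum>t\<in>T. h t t)" for h :: "int \<Rightarrow> int \<Rightarrow> real"
    by (subst sum.reindex) (auto simp: inj_on_def)
  have G: "(\<Sum>(s, t)\<in>?G. f s * f t) = (\<Sum>(s, t)\<in>?L. f s * f t)"
    by (rule sum.reindex_bij_witness[of _ prod.swap prod.swap]) auto
  have "(\<Sum>t\<in>T. f t)\<^sup>2 = (\<Sum>(s, t)\<in>T \<times> T. f s * f t)"
    by (simp add: power2_eq_square sum_product sum.cartesian_product)
  also have "\<dots> = (\<Sum>(s, t)\<in>?E \<union> (?L \<union> ?G). f s * f t)"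
    by (rule sum.cong[OF split(1) refl])
  also have "\<dots> = (\<Sum>t\<in>T. f t * f t) + 2 * (\<Sum>(s, t)\<in>?L. f s * f t)"
    unfolding sum.union_disjoint[OF fin(3) finite_UnI[OF fin(1,2)] disj(1)]
      sum.union_disjoint[OF fin(1,2) disj(2)] E G by simp
  finally have sq: "(\<Sum>t\<in>T. f t)\<^sup>2 = (\<Sum>t\<in>T. f t * f t) + 2 * (\<Sum>(s, t)\<in>?L. f s * f t)" .
  have L: "(\<Sum>(s, t)\<in>?L. (if s = t then 1 / 2 else 1) * (f s * f t - (if s = t then 1 else 0))) =
      (\<Sum>(s, t)\<in>?L. f s * f t)"
    by (intro sum.cong) auto
  show ?thesis
    unfolding split(2) sum.union_disjoint[OF fin(3,1) disj(3)] E L sq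
    by (simp add: sum_subtractf sum_divide_distrib[symmetric] diff_divide_distrib add_divide_distrib)
qed

text \<open>The characteristic function of a centred chi-squared variable with one degree of
  freedom. Its continuity, its bound by 1 and its expansion at 0 replace the closed form exp (- i x)
  (1 - 2 i x)^(-1/2).\<close>

definition chi_cf :: "real \<Rightarrow> complex" where
  "chi_cf x = (CLINT g|std_normal_distribution. iexp (x * (g\<^sup>2 - 1)))"

lemma (in prob_space) cos_shift_char:
  assumes [measurable]: "Z \<in> borel_measurable M"
  shows "expectation (\<lambda>\<omega>. cos (Z \<omega> + \<phi>)) = Re (iexp \<phi> * char (distr M borel Z) 1)"
proof -
  have i: "integrable M (\<lambda>\<omega>. iexp (Z \<omega>))" by (rule integrable_iexp) auto
  have "char (distr M borel Z) 1 = (CLINT \<omega>|M. iexp (Z \<omega>))"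
    unfolding char_def by (subst integral_distr) auto
  then have "Re (iexp \<phi> * char (distr M borel Z) 1) = Re (CLINT \<omega>|M. iexp \<phi> * iexp (Z \<omega>))"
    using i by simp
  also have "\<dots> = expectation (\<lambda>\<omega>. Re (iexp \<phi> * iexp (Z \<omega>)))"
    using i by (subst integral_Re) auto
  also have "(\<lambda>\<omega>. Re (iexp \<phi> * iexp (Z \<omega>))) = (\<lambda>\<omega>. cos (Z \<omega> + \<phi>))"
    by (simp add: exp_add[symmetric] Re_exp distrib_left[symmetric] add.commute)
  finally show ?thesis by simp
qed

text \<open>Independence is postulated for two disjoint source sets at a time. Joint independence
  follows by splitting off one index after the other, because the remaining events belong to the
  field of the union of their source sets.\<close>

lemma (in indep_fields) indep_vars_fields:
  fixes X :: "'i \<Rightarrow> 'w \<Rightarrow> real"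
  assumes X: "\<And>i. i \<in> I \<Longrightarrow> X i \<in> borel_measurable (F (K i))"
    and K: "disjoint_family_on K I"
  shows "indep_vars (\<lambda>_. borel) X I"
  unfolding indep_vars_def2
proof (intro conjI ballI)
  show "X i \<in> borel_measurable P" if "i \<in> I" for i using X[OF that] by (rule F_measurable)
  show "indep_sets (\<lambda>i. {X i -` A \<inter> space P |A. A \<in> sets borel}) I"
  proof (rule indep_setsI)
    show "{X i -` A \<inter> space P |A. A \<in> sets borel} \<subseteq> events" if "i \<in> I" for i
      using F_measurable[OF X[OF that]] by auto
    fix A J assume J: "J \<noteq> {}" "J \<subseteq> I" "finite J" and A: "\<forall>j\<in>J. A j \<in> {X j -` A \<inter> space P |A. A \<in> sets borel}"
    have A': "A j \<in> sets (F (K j))" if "j \<in> J" for j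
    proof -
      have "A j \<in> {X j -` A \<inter> space P |A. A \<in> sets borel}" using A that by (rule bspec)
      then obtain B where "A j = X j -` B \<inter> space P" "B \<in> sets borel" by auto
      then show ?thesis using measurable_sets[OF X[of j], of B] that J by (auto simp: space_F)
    qed
    from J(3,1,2) A' have "prob (\<Inter>j\<in>J. A j) = (\<Prod>j\<in>J. prob (A j)) \<and> (\<Inter>j\<in>J. A j) \<in> sets (F (\<Union>j\<in>J. K j))"
    proof (induction J rule: finite_ne_induct)
      case (singleton i)
      then show ?case by simp
    next
      case (insert i J)
      have IH: "prob (\<Inter>j\<in>J. A j) = (\<Prod>j\<in>J. prob (A j))" "(\<Inter>j\<in>J. A j) \<in> sets (F (\<Union>j\<in>J. K j))"
        using insert by auto
      have disj: "K i \<inter> (\<Union>j\<in>J. K j) = {}"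
        using K insert.prems(1) insert.hyps(3) by (force simp: disjoint_family_on_def)
      have Ai: "A i \<in> sets (F (K i))" using insert.prems(2) by auto
      have "prob (A i \<inter> (\<Inter>j\<in>J. A j)) = prob (A i) * prob (\<Inter>j\<in>J. A j)"
        by (rule indep_setD[OF F_indep[OF disj] Ai IH(2)])
      moreover have "A i \<in> sets (F (\<Union>j\<in>insert i J. K j))" "(\<Inter>j\<in>J. A j) \<in> sets (F (\<Union>j\<in>insert i J. K j))"
        using F_mono[of "K i" "\<Union>j\<in>insert i J. K j"] F_mono[of "\<Union>j\<in>J. K j" "\<Union>j\<in>insert i J. K j"] Ai IH(2)
        by auto
      ultimately show ?case using insert.hyps IH(1) by auto
    qed
    then show "prob (\<Inter>j\<in>J. A j) = (\<Prod>j\<in>J. prob (A j))" by simp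
  qed
qed

section \<open>Normalized Gaussian sums and the band along the diagonal\<close>

context noise
begin

definition gsum :: "nat \<Rightarrow> nat \<times> nat \<times> nat \<Rightarrow> 'w \<Rightarrow> real" where
  "gsum n a \<omega> = (\<Sum>t\<in>times n. eps t a \<omega>) / sqrt (real (n - q))"

lemma finite_times [simp]: "finite (times n)"
  by (simp add: times_def)

lemma card_times: "card (times n) = n - q"
  by (simp add: times_def)

lemma gsum_measurable: "gsum n a \<in> borel_measurable (F (range (\<lambda>t. Inr (t, a))))"
  unfolding gsum_def
  by (intro borel_measurable_divide borel_measurable_sum F_measurable_mono[OF eps_meas]) auto

lemma gsum_distr:
  assumes "q < n"
  shows "distr P borel (gsum n a) = std_normal_distribution"
proof (rule Levy_uniqueness)
  have [measurable]: "gsum n a \<in> borel_measurable P" by (rule F_measurable[OF gsum_measurable])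
  show "real_distribution (distr P borel (gsum n a))" by (rule real_distribution_distr) simp
  show "real_distribution std_normal_distribution" by (rule real_dist_normal_dist)
  show "char (distr P borel (gsum n a)) = char std_normal_distribution"
  proof
    fix x :: real
    define c where "c = x / sqrt (real (n - q))"
    have "indep_vars (\<lambda>_. borel) (\<lambda>t. eps t a) (times n)"
      by (rule indep_vars_fields[of _ _ "\<lambda>t. {Inr (t, a)}"]) (auto simp: eps_meas disjoint_family_on_def)
    from char_distr_sum[OF this, of c]
    have "char (distr P borel (\<lambda>\<omega>. \<Sum>t\<in>times n. eps t a \<omega>)) c = complex_of_real (exp (- (real (n - q) * (c\<^sup>2 / 2))))"
      unfolding eps_distr char_std_normal_distribution
      by (simp add: card_times of_real_power[symmetric] exp_of_nat_mult[symmetric] del: of_real_power of_real_exp)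
    moreover have "char (distr P borel (gsum n a)) x = char (distr P borel (\<lambda>\<omega>. \<Sum>t\<in>times n. eps t a \<omega>)) c"
      unfolding char_def by (simp add: integral_distr gsum_def c_def)
    moreover have "real (n - q) * (c\<^sup>2 / 2) = x\<^sup>2 / 2"
    proof -
      obtain m where "real (n - q) = m" "m > 0" using assms by simp
      then show ?thesis by (simp add: c_def power_divide)
    qed
    ultimately show "char (distr P borel (gsum n a)) x = char std_normal_distribution x"
      by (simp add: char_std_normal_distribution)
  qed
qed

lemma gaussian_form_cf:
  assumes "q < n"
  shows "expectation (\<lambda>\<omega>. cos ((\<Sum>a\<in>idx. x a * ((gsum n a \<omega>)\<^sup>2 - 1)) + \<phi>)) =
    Re (iexp \<phi> * (\<Prod>a\<in>idx. chi_cf (x a)))"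
proof -
  have [measurable]: "gsum n a \<in> borel_measurable P" for a by (rule F_measurable[OF gsum_measurable])
  have "indep_vars (\<lambda>_. borel) (\<lambda>a \<omega>. x a * ((gsum n a \<omega>)\<^sup>2 - 1)) idx"
  proof (rule indep_vars_fields)
    show "(\<lambda>\<omega>. x a * ((gsum n a \<omega>)\<^sup>2 - 1)) \<in> borel_measurable (F (range (\<lambda>t. Inr (t, a))))" for a
      using gsum_measurable[of n a] by measurable
    show "disjoint_family_on (\<lambda>a. range (\<lambda>t :: int. Inr (t, a)) :: (int + int \<times> nat \<times> nat \<times> nat) set) idx"
      by (auto simp: disjoint_family_on_def)
  qed
  from char_distr_sum[OF this, of 1]
  have "char (distr P borel (\<lambda>\<omega>. \<Sum>a\<in>idx. x a * ((gsum n a \<omega>)\<^sup>2 - 1))) 1 =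
      (\<Prod>a\<in>idx. char (distr P borel (\<lambda>\<omega>. x a * ((gsum n a \<omega>)\<^sup>2 - 1))) 1)" .
  also have "\<dots> = (\<Prod>a\<in>idx. chi_cf (x a))"
  proof (intro prod.cong refl)
    fix a
    have "char (distr P borel (\<lambda>\<omega>. x a * ((gsum n a \<omega>)\<^sup>2 - 1))) 1 = (CLINT \<omega>|P. iexp (x a * ((gsum n a \<omega>)\<^sup>2 - 1)))"
      unfolding char_def by (subst integral_distr) auto
    also have "\<dots> = (CLINT g|distr P borel (gsum n a). iexp (x a * (g\<^sup>2 - 1)))"
      by (subst integral_distr) auto
    finally show "char (distr P borel (\<lambda>\<omega>. x a * ((gsum n a \<omega>)\<^sup>2 - 1))) 1 = chi_cf (x a)"
      unfolding gsum_distr[OF assms] chi_cf_def .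
  qed
  finally show ?thesis by (subst cos_shift_char) auto
qed

text \<open>The order within each pair makes different triples different as unordered pairs. Unless
  both products are squares, some variable then occurs exactly once and the mean vanishes; two
  squares belong to different variables and are independent with mean 1.\<close>

lemma eps_pair_cov:
  assumes "s \<le> t" "s' \<le> t'" "(s, t, a) \<noteq> (s', t', a')"
  shows "expectation (\<lambda>\<omega>. (eps s a \<omega> * eps t a \<omega>) * (eps s' a' \<omega> * eps t' a' \<omega>)) =
    (if s = t \<and> s' = t' then 1 else 0)"
proof -
  have isolated: "expectation (\<lambda>\<omega>. eps r a \<omega> * (eps u a \<omega> * (eps v b \<omega> * eps z b \<omega>))) = 0"
    if "r \<noteq> u" "(r, a) \<noteq> (v, b)" "(r, a) \<noteq> (z, b)" for r u v z a b
  proof -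
    let ?K = "{Inr (u, a), Inr (v, b), Inr (z, b)}"
    have "eps u a \<in> borel_measurable (F ?K)" "eps v b \<in> borel_measurable (F ?K)" "eps z b \<in> borel_measurable (F ?K)"
      by (auto intro: F_measurable_mono[OF eps_meas])
    then have m: "(\<lambda>\<omega>. eps u a \<omega> * (eps v b \<omega> * eps z b \<omega>)) \<in> borel_measurable (F ?K)" by measurable
    have i: "integrable P (\<lambda>\<omega>. eps u a \<omega> * (eps v b \<omega> * eps z b \<omega>))"
      using L4_integrable_mult3[OF eps_L4 eps_L4 eps_L4, of u a v b z b] by (simp add: mult.assoc)
    have "expectation (\<lambda>\<omega>. eps r a \<omega> * (eps u a \<omega> * (eps v b \<omega> * eps z b \<omega>))) =
        expectation (eps r a) * expectation (\<lambda>\<omega>. eps u a \<omega> * (eps v b \<omega> * eps z b \<omega>))"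
      by (rule indep_mult(2)[OF eps_meas L4_integrable(1)[OF eps_L4] m i]) (use that in auto)
    then show ?thesis by (simp add: eps_moments)
  qed
  show ?thesis
  proof (cases "s = t")
    case True
    show ?thesis
    proof (cases "s' = t'")
      case s': True
      have m: "(\<lambda>\<omega>. eps s a \<omega> * eps t a \<omega>) \<in> borel_measurable (F {Inr (s, a)})"
        "(\<lambda>\<omega>. eps s' a' \<omega> * eps t' a' \<omega>) \<in> borel_measurable (F {Inr (s', a')})"
        using eps_meas[of s a] eps_meas[of s' a'] True s' by auto
      have "expectation (\<lambda>\<omega>. (eps s a \<omega> * eps t a \<omega>) * (eps s' a' \<omega> * eps t' a' \<omega>)) =
          expectation (\<lambda>\<omega>. eps s a \<omega> * eps t a \<omega>) * expectation (\<lambda>\<omega>. eps s' a' \<omega> * eps t' a' \<omega>)"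
        by (rule indep_mult(2)[OF m(1) _ m(2)])
           (use assms True s' in \<open>auto intro: L4_integrable_mult eps_L4\<close>)
      then show ?thesis using True s' by (simp add: eps_cov)
    next
      case False
      then have "s' < t'" using assms by simp
      then consider "(s', a') \<noteq> (s, a)" | "(t', a') \<noteq> (s, a)" by auto
      then show ?thesis
      proof cases
        case 1
        then show ?thesis using isolated[of s' t' a' s a t] False True by (simp add: mult_ac)
      next
        case 2
        then show ?thesis using isolated[of t' s' a' s a t] False True by (simp add: mult_ac)
      qed
    qed
  next
    case False
    consider "(s, a) \<noteq> (s', a') \<and> (s, a) \<noteq> (t', a')" | "(t, a) \<noteq> (s', a') \<and> (t, a) \<noteq> (t', a')"
      using assms False by fastforce
    then show ?thesis
    proof cases
      case 1
      then show ?thesis using isolated[of s t a s' a' t'] False by (simp add: mult_ac)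
    next
      case 2
      then show ?thesis using isolated[of t s a s' a' t'] False by (simp add: mult_ac)
    qed
  qed
qed

lemma eps_pair_second: "expectation (\<lambda>\<omega>. (eps s a \<omega> * eps t a \<omega>)\<^sup>2) = (if s = t then 3 else 1)"
proof (cases "s = t")
  case True
  then show ?thesis using eps_moments(4)[of t a] by (simp add: power_mult_distrib power2_eq_square power4_eq_xxxx mult_ac)
next
  case False
  have m: "(\<lambda>\<omega>. (eps r a \<omega>)\<^sup>2) \<in> borel_measurable (F {Inr (r, a)})" for r using eps_meas[of r a] by measurable
  have "expectation (\<lambda>\<omega>. (eps s a \<omega>)\<^sup>2 * (eps t a \<omega>)\<^sup>2) = expectation (\<lambda>\<omega>. (eps s a \<omega>)\<^sup>2) * expectation (\<lambda>\<omega>. (eps t a \<omega>)\<^sup>2)"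
    by (rule indep_mult(2)[OF m L4_integrable(2)[OF eps_L4] m L4_integrable(2)[OF eps_L4]]) (use False in auto)
  then show ?thesis using False by (simp add: power_mult_distrib eps_moments)
qed

text \<open>The Gaussian form differs from a weighted sum of centred squares by the terms with t <=
  s + q. There are at most n (q + 1) q p^2 of these, uncorrelated and with second moment at most
  (\<kappa> V)^2. For \<kappa> of order 1/(n p) the total is of order 1/n.\<close>

lemma gaussian_end:
  assumes n: "q < n" and \<gamma>: "\<And>\<tau>. \<tau> \<in> {1..q} \<Longrightarrow> \<bar>\<gamma> \<tau>\<bar> \<le> \<kappa>"
    and V: "\<And>a. a \<in> idx \<Longrightarrow> vr a \<le> V"
    and s: "s > 0" "real (n * (q + 1) * (q * p * p)) * (\<kappa> * V)\<^sup>2 \<le> s\<^sup>2"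
  shows "\<bar>expectation (\<lambda>\<omega>. cos (hybrid n \<gamma> (int q + 1) \<omega> + \<phi>)) -
    Re (iexp \<phi> * (\<Prod>a\<in>idx. chi_cf (\<gamma> (fst a) * vr a * real (n - q) / 2)))\<bar> \<le> s"
proof -
  \<comment> \<open>The factor n - q undoes the normalization of \<open>gsum\<close>; the 1/2 is
    that of \<open>half_square_sum\<close>.\<close>
  define x where "x = (\<lambda>a. \<gamma> (fst a) * vr a * real (n - q) / 2)"
  define Z where "Z = (\<lambda>\<omega>. \<Sum>a\<in>idx. x a * ((gsum n a \<omega>)\<^sup>2 - 1))"
  define h where "h = (\<lambda>s t a \<omega>. (if s = t then 1 / 2 else 1) * (eps s a \<omega> * eps t a \<omega> - (if s = t then 1 else 0)))"
  define B where "B = {(s, t) \<in> times n \<times> times n. s \<le> t \<and> t \<le> s + int q}"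
  define g where "g = (\<lambda>(z, a) \<omega>. \<gamma> (fst a) * vr a * h (fst z) (snd z) a \<omega>)"
  have [measurable]: "gsum n a \<in> borel_measurable P" for a by (rule F_measurable[OF gsum_measurable])
  have finB: "finite B" by (rule finite_subset[of _ "times n \<times> times n"]) (auto simp: B_def)
  have hyb: "hybrid n \<gamma> (int q + 1) \<omega> =
      (\<Sum>a\<in>idx. \<gamma> (fst a) * vr a * (\<Sum>(s, t)\<in>{(s, t) \<in> times n \<times> times n. s + int q < t}. h s t a \<omega>))" for \<omega>
  proof -
    have "form \<gamma> (s < int q + 1) s (t < int q + 1) t \<omega> = (\<Sum>a\<in>idx. \<gamma> (fst a) * vr a * h s t a \<omega>)"
      if "s \<in> times n" "t \<in> times n" "s + int q < t" for s t
    proof -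
      have "form \<gamma> (s < int q + 1) s (t < int q + 1) t \<omega> = form \<gamma> False s False t \<omega>"
        using that by (simp add: times_def)
      also have "\<dots> = (\<Sum>a\<in>idx. \<gamma> (fst a) * vr a * h s t a \<omega>)"
        unfolding form_def
      proof (intro sum.cong refl)
        fix a assume a: "a \<in> idx"
        obtain \<tau> i j where at: "a = (\<tau>, i, j)" by (cases a) auto
        have "sqrt (lam i * lam j) * sqrt (lam i * lam j) = lam i * lam j"
          using vr_nonneg[OF a] by (simp add: at vr_def)
        then show "\<gamma> (fst a) * U False s a \<omega> * U False t a \<omega> = \<gamma> (fst a) * vr a * h s t a \<omega>"
          using that by (simp add: at U_def vr_def h_def mult_ac)
      qed
      finally show ?thesis .
    qed
    then have "hybrid n \<gamma> (int q + 1) \<omega> =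
        (\<Sum>(s, t)\<in>{(s, t) \<in> times n \<times> times n. s + int q < t}. \<Sum>a\<in>idx. \<gamma> (fst a) * vr a * h s t a \<omega>)"
      unfolding hybrid_def by (intro sum.cong refl) auto
    then show ?thesis
      by (simp add: case_prod_beta sum_distrib_left) (rule sum.swap)
  qed
  have Zeq: "Z \<omega> = (\<Sum>a\<in>idx. \<gamma> (fst a) * vr a * (\<Sum>(s, t)\<in>{(s, t) \<in> times n \<times> times n. s \<le> t}. h s t a \<omega>))" for \<omega>
    unfolding Z_def
  proof (intro sum.cong refl)
    fix a
    have "real (n - q) * ((gsum n a \<omega>)\<^sup>2 - 1) = (\<Sum>t\<in>times n. eps t a \<omega>)\<^sup>2 - real (card (times n))"
      using n by (simp add: gsum_def power_divide card_times field_simps)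
    moreover have "x a * ((gsum n a \<omega>)\<^sup>2 - 1) = \<gamma> (fst a) * vr a * (real (n - q) * ((gsum n a \<omega>)\<^sup>2 - 1) / 2)"
      by (simp only: x_def times_divide_eq_left times_divide_eq_right mult.assoc)
    ultimately have "x a * ((gsum n a \<omega>)\<^sup>2 - 1) = \<gamma> (fst a) * vr a * (((\<Sum>t\<in>times n. eps t a \<omega>)\<^sup>2 - real (card (times n))) / 2)"
      by (simp only:)
    then show "x a * ((gsum n a \<omega>)\<^sup>2 - 1) = \<gamma> (fst a) * vr a * (\<Sum>(s, t)\<in>{(s, t) \<in> times n \<times> times n. s \<le> t}. h s t a \<omega>)"
      unfolding half_square_sum[OF finite_times] h_def .
  qed
  have diff: "Z \<omega> - hybrid n \<gamma> (int q + 1) \<omega> = (\<Sum>z\<in>B \<times> idx. g z \<omega>)" for \<omega>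
  proof -
    have split: "{(s, t) \<in> times n \<times> times n. s \<le> t} = {(s, t) \<in> times n \<times> times n. s + int q < t} \<union> B"
      by (auto simp: B_def)
    have fin: "finite {(s, t) \<in> times n \<times> times n. s + int q < t}"
      by (rule finite_subset[of _ "times n \<times> times n"]) auto
    have "Z \<omega> - hybrid n \<gamma> (int q + 1) \<omega> = (\<Sum>a\<in>idx. \<gamma> (fst a) * vr a * (\<Sum>(s, t)\<in>B. h s t a \<omega>))"
      unfolding Zeq hyb split
      by (subst sum.union_disjoint[OF fin finB]) (auto simp: B_def sum_subtractf[symmetric] algebra_simps)
    also have "\<dots> = (\<Sum>a\<in>idx. \<Sum>z\<in>B. g (z, a) \<omega>)"
      by (simp add: sum_distrib_left g_def case_prod_beta)
    also have "\<dots> = (\<Sum>z\<in>B. \<Sum>a\<in>idx. g (z, a) \<omega>)" by (rule sum.swap)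
    also have "\<dots> = (\<Sum>z\<in>B \<times> idx. g z \<omega>)" by (simp add: sum.cartesian_product)
    finally show ?thesis .
  qed
  have i4: "integrable P (\<lambda>\<omega>. (eps s a \<omega> * eps t a \<omega>) * (eps s' a' \<omega> * eps t' a' \<omega>))" for s a t s' a' t'
    using L4_integrable_mult4[OF eps_L4 eps_L4 eps_L4 eps_L4, of s a t a s' a' t' a'] by (simp add: mult_ac)
  have i2: "integrable P (\<lambda>\<omega>. eps s a \<omega> * eps t a \<omega>)" for s a t
    by (rule L4_integrable_mult[OF eps_L4 eps_L4])
  have hh: "integrable P (\<lambda>\<omega>. h s t a \<omega> * h s' t' a' \<omega>)"
    "expectation (\<lambda>\<omega>. h s t a \<omega> * h s' t' a' \<omega>) = (if s = t then 1 / 2 else 1) * (if s' = t' then 1 / 2 else 1) *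
      (expectation (\<lambda>\<omega>. (eps s a \<omega> * eps t a \<omega>) * (eps s' a' \<omega> * eps t' a' \<omega>)) - (if s = t \<and> s' = t' then 1 else 0))"
    for s t a s' t' a'
  proof -
    let ?c = "(if s = t then 1 / 2 else 1) * (if s' = t' then 1 / 2 else (1 :: real))"
    let ?d = "if s = t then 1 else (0 :: real)" and ?d' = "if s' = t' then 1 else (0 :: real)"
    have eq: "(\<lambda>\<omega>. h s t a \<omega> * h s' t' a' \<omega>) = (\<lambda>\<omega>. ?c * ((eps s a \<omega> * eps t a \<omega>) * (eps s' a' \<omega> * eps t' a' \<omega>) -
        ?d' * (eps s a \<omega> * eps t a \<omega>) - ?d * (eps s' a' \<omega> * eps t' a' \<omega>) + ?d * ?d'))"
      unfolding h_def by (rule ext) (simp only: algebra_simps)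
    show "integrable P (\<lambda>\<omega>. h s t a \<omega> * h s' t' a' \<omega>)"
      unfolding eq by (intro integrable_mult_right Bochner_Integration.integrable_add Bochner_Integration.integrable_diff i4 i2) simp
    have "expectation (\<lambda>\<omega>. h s t a \<omega> * h s' t' a' \<omega>) =
       ?c * (expectation (\<lambda>\<omega>. (eps s a \<omega> * eps t a \<omega>) * (eps s' a' \<omega> * eps t' a' \<omega>)) -
        ?d' * expectation (\<lambda>\<omega>. eps s a \<omega> * eps t a \<omega>) - ?d * expectation (\<lambda>\<omega>. eps s' a' \<omega> * eps t' a' \<omega>) + ?d * ?d')"
      unfolding eq using i4 i2 by (simp add: prob_space del: eps_cov)
    then show "expectation (\<lambda>\<omega>. h s t a \<omega> * h s' t' a' \<omega>) = ?c *
      (expectation (\<lambda>\<omega>. (eps s a \<omega> * eps t a \<omega>) * (eps s' a' \<omega> * eps t' a' \<omega>)) - (if s = t \<and> s' = t' then 1 else 0))"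
      by (simp add: eps_cov)
  qed
  have cov_gg: "(\<lambda>\<omega>. g ((s, t), a) \<omega> * g ((s', t'), a') \<omega>) =
      (\<lambda>\<omega>. (\<gamma> (fst a) * vr a * (\<gamma> (fst a') * vr a')) * (h s t a \<omega> * h s' t' a' \<omega>))" for s t a s' t' a'
    by (rule ext) (simp add: g_def mult_ac)
  have gi: "integrable P (\<lambda>\<omega>. g z \<omega> * g z' \<omega>)" for z z'
  proof -
    obtain s t a s' t' a' where z: "z = ((s, t), a)" "z' = ((s', t'), a')" by (metis prod.exhaust)
    show ?thesis unfolding z cov_gg by (rule integrable_mult_right) (rule hh(1))
  qed
  have V0: "0 \<le> V" if "a \<in> idx" for a using vr_nonneg[OF that] V[OF that] by linarith
  have K: "expectation (\<lambda>\<omega>. (g z \<omega>)\<^sup>2) \<le> (\<kappa> * V)\<^sup>2" if "z \<in> B \<times> idx" for z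
  proof -
    obtain s t a where z: "z = ((s, t), a)" by (metis prod.exhaust)
    have a: "a \<in> idx" using that z by auto
    \<comment> \<open>The value is (3 - 1) / 4 on the diagonal and 1 off it.\<close>
    have hs: "expectation (\<lambda>\<omega>. h s t a \<omega> * h s t a \<omega>) \<le> 1"
      using eps_pair_second[of s a t] by (simp add: hh(2) power2_eq_square)
    have h0: "0 \<le> expectation (\<lambda>\<omega>. h s t a \<omega> * h s t a \<omega>)" by (rule Bochner_Integration.integral_nonneg) simp
    have "\<bar>\<gamma> (fst a) * vr a\<bar> \<le> \<kappa> * V"
      unfolding abs_mult using a \<gamma>[of "fst a"] V[OF a] vr_nonneg[OF a]
      by (intro mult_mono) (auto simp: idx_def)
    then have c: "(\<gamma> (fst a) * vr a)\<^sup>2 \<le> (\<kappa> * V)\<^sup>2"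
      by (metis abs_ge_zero power2_abs power_mono)
    have "expectation (\<lambda>\<omega>. (g z \<omega>)\<^sup>2) = (\<gamma> (fst a) * vr a)\<^sup>2 * expectation (\<lambda>\<omega>. h s t a \<omega> * h s t a \<omega>)"
      unfolding z power2_eq_square cov_gg by simp
    also have "\<dots> \<le> (\<kappa> * V)\<^sup>2 * 1" by (intro mult_mono c hs h0) auto
    finally show ?thesis by simp
  qed
  have uncor: "expectation (\<lambda>\<omega>. g z \<omega> * g z' \<omega>) = 0"
    if "z \<in> B \<times> idx" "z' \<in> B \<times> idx" "z' \<notin> {z}" for z z'
  proof -
    obtain s t a where z: "z = ((s, t), a)" by (metis prod.exhaust)
    obtain s' t' a' where z': "z' = ((s', t'), a')" by (metis prod.exhaust)
    have "expectation (\<lambda>\<omega>. (eps s a \<omega> * eps t a \<omega>) * (eps s' a' \<omega> * eps t' a' \<omega>)) = (if s = t \<and> s' = t' then 1 else 0)"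
      by (rule eps_pair_cov) (use that in \<open>auto simp: z z' B_def\<close>)
    then show ?thesis unfolding z z' cov_gg by (simp add: hh(2))
  qed
  have card: "card (B \<times> idx) \<le> n * (q + 1) * (q * p * p)"
  proof -
    have "B \<subseteq> (\<lambda>(s, j). (s, s + j)) ` (times n \<times> {0..int q})"
    proof
      fix z assume "z \<in> B"
      then show "z \<in> (\<lambda>(s, j). (s, s + j)) ` (times n \<times> {0..int q})"
        by (intro image_eqI[of _ _ "(fst z, snd z - fst z)"]) (auto simp: B_def)
    qed
    then have "card B \<le> card (times n \<times> {0..int q})"
      by (rule surj_card_le[rotated]) simp
    also have "\<dots> = (n - q) * (q + 1)" by (simp add: card_cartesian_product card_times nat_add_distrib)
    also have "\<dots> \<le> n * (q + 1)" by (intro mult_le_mono1) simp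
    finally have "card B \<le> n * (q + 1)" .
    moreover have "card idx = q * p * p" by (simp add: idx_def card_cartesian_product)
    ultimately have "card B * card idx \<le> n * (q + 1) * (q * p * p)" by (simp only: mult_le_mono1)
    then show ?thesis by (simp add: card_cartesian_product)
  qed
  note sm = second_moment_sum_le[of "B \<times> idx" g "(\<kappa> * V)\<^sup>2" "\<lambda>z. {z}" 1, OF _ gi K uncor]
  have sq: "integrable P (\<lambda>\<omega>. (\<Sum>z\<in>B \<times> idx. g z \<omega>)\<^sup>2)"
    "expectation (\<lambda>\<omega>. (\<Sum>z\<in>B \<times> idx. g z \<omega>)\<^sup>2) \<le> s\<^sup>2"
  proof -
    show "integrable P (\<lambda>\<omega>. (\<Sum>z\<in>B \<times> idx. g z \<omega>)\<^sup>2)" by (rule sm(1)) (use finB in auto)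
    have "expectation (\<lambda>\<omega>. (\<Sum>z\<in>B \<times> idx. g z \<omega>)\<^sup>2) \<le> real (card (B \<times> idx)) * real 1 * (\<kappa> * V)\<^sup>2"
      by (rule sm(2)) (use finB in auto)
    moreover have "real (card (B \<times> idx)) * real 1 * (\<kappa> * V)\<^sup>2 \<le> real (n * (q + 1) * (q * p * p)) * (\<kappa> * V)\<^sup>2"
      unfolding of_nat_1 mult_1_right by (rule mult_right_mono[OF of_nat_mono[OF card]]) (rule zero_le_power2)
    ultimately show "expectation (\<lambda>\<omega>. (\<Sum>z\<in>B \<times> idx. g z \<omega>)\<^sup>2) \<le> s\<^sup>2"
      using s(2) by (rule order_trans[OF order_trans])
  qed
  have gm: "(\<lambda>\<omega>. \<Sum>z\<in>B \<times> idx. g z \<omega>) \<in> borel_measurable P"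
    unfolding g_def h_def by (auto simp: case_prod_beta)
  have Zm [measurable]: "Z \<in> borel_measurable P" unfolding Z_def by measurable
  have Hm [measurable]: "hybrid n \<gamma> (int q + 1) \<in> borel_measurable P"
  proof -
    have "hybrid n \<gamma> (int q + 1) = (\<lambda>\<omega>. Z \<omega> - (\<Sum>z\<in>B \<times> idx. g z \<omega>))"
      using diff by (auto simp: fun_eq_iff algebra_simps)
    then show ?thesis using gm by simp
  qed
  note ab = expectation_abs_le[OF gm sq s(1)]
  have ic: "integrable P (\<lambda>\<omega>. cos (X \<omega> + \<phi>))" if [measurable]: "X \<in> borel_measurable P" for X
    by (rule integrable_const_bound[of _ 1]) auto
  have "\<bar>expectation (\<lambda>\<omega>. cos (hybrid n \<gamma> (int q + 1) \<omega> + \<phi>)) - expectation (\<lambda>\<omega>. cos (Z \<omega> + \<phi>))\<bar> =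
      \<bar>expectation (\<lambda>\<omega>. cos (hybrid n \<gamma> (int q + 1) \<omega> + \<phi>) - cos (Z \<omega> + \<phi>))\<bar>"
    using ic[OF Hm] ic[OF Zm] by simp
  also have "\<dots> \<le> expectation (\<lambda>\<omega>. \<bar>cos (hybrid n \<gamma> (int q + 1) \<omega> + \<phi>) - cos (Z \<omega> + \<phi>)\<bar>)"
    by (rule integral_abs_bound)
  also have "\<dots> \<le> expectation (\<lambda>\<omega>. \<bar>\<Sum>z\<in>B \<times> idx. g z \<omega>\<bar>)"
  proof (rule integral_mono)
    show "integrable P (\<lambda>\<omega>. \<bar>cos (hybrid n \<gamma> (int q + 1) \<omega> + \<phi>) - cos (Z \<omega> + \<phi>)\<bar>)"
      using ic[OF Hm] ic[OF Zm] by auto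
    show "integrable P (\<lambda>\<omega>. \<bar>\<Sum>z\<in>B \<times> idx. g z \<omega>\<bar>)" using ab(1) by auto
    show "\<bar>cos (hybrid n \<gamma> (int q + 1) \<omega> + \<phi>) - cos (Z \<omega> + \<phi>)\<bar> \<le> \<bar>\<Sum>z\<in>B \<times> idx. g z \<omega>\<bar>" for \<omega>
      using abs_cos_diff_le[of "hybrid n \<gamma> (int q + 1) \<omega> + \<phi>" "Z \<omega> + \<phi>"] diff[of \<omega>] by (simp add: abs_minus_commute)
  qed
  also have "\<dots> \<le> s" by (rule ab(2))
  finally show ?thesis unfolding Z_def gaussian_form_cf[OF n] x_def .
qed

end

section \<open>The statistics under the null hypothesis\<close>

text \<open>For 2 \<tau> < n neither one nor two circular shifts lead back to the starting time; two
  shifts would if n = 2 \<tau>.\<close>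

lemma circ_shift:
  assumes "1 \<le> \<tau>" "2 * \<tau> < n" "t \<in> {1..int n}"
  shows "circ n (t + int \<tau>) \<in> {1..int n}" "circ n (t + int \<tau>) \<noteq> t"
    "circ n (circ n (t + int \<tau>) + int \<tau>) \<noteq> t"
  using assms by (auto simp: circ_def)

lemma circ_shift_inj: "inj_on (\<lambda>t. circ n (t + int \<tau>)) {1..int n}"
  by (auto simp: inj_on_def circ_def split: if_splits)

section \<open>Second moments of sums of lagged products\<close>

context noise
begin

lemma ip_measurable [measurable]: "ip s t \<in> borel_measurable P"
  using ip_meas by (rule F_measurable)

text \<open>The centred vector \<open>w r\<close> occurs once and linearly, so the mean vanishes
  whatever the dependence among the other factors.\<close>

lemma ip_isolated:
  assumes "r \<noteq> u" "Inl u \<in> K" "Inl r \<notin> K"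
    and a: "a \<in> borel_measurable (F K)" "L4 a" and b: "b \<in> borel_measurable (F K)" "L4 b"
    and c: "c \<in> borel_measurable (F K)" "L4 c"
  shows "expectation (\<lambda>\<omega>. ip r u \<omega> * (a \<omega> * b \<omega> * c \<omega>)) = 0"
proof -
  have summand: "integrable P (\<lambda>\<omega>. w r i \<omega> * (w u i \<omega> * a \<omega> * b \<omega> * c \<omega>)) \<and>
      expectation (\<lambda>\<omega>. w r i \<omega> * (w u i \<omega> * a \<omega> * b \<omega> * c \<omega>)) = 0" if i: "i < p" for i
  proof -
    have "w u i \<in> borel_measurable (F K)"
      using F_measurable_mono[OF w_meas[OF i]] assms(2) by auto
    then have m: "(\<lambda>\<omega>. w u i \<omega> * a \<omega> * b \<omega> * c \<omega>) \<in> borel_measurable (F K)"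
      using a(1) b(1) c(1) by measurable
    have disj: "{Inl r} \<inter> K = {}" using assms(3) by auto
    note im = indep_mult[OF w_meas[OF i] L4_integrable(1)[OF w_L4[OF i]] m
        L4_integrable_mult4[OF w_L4[OF i] a(2) b(2) c(2)] disj]
    then show ?thesis using w_mean[OF i, of r] by simp
  qed
  have "expectation (\<lambda>\<omega>. ip r u \<omega> * (a \<omega> * b \<omega> * c \<omega>)) =
      expectation (\<lambda>\<omega>. \<Sum>i<p. w r i \<omega> * (w u i \<omega> * a \<omega> * b \<omega> * c \<omega>))"
    by (simp add: ip_def sum_distrib_left sum_distrib_right mult_ac)
  also have "\<dots> = (\<Sum>i<p. expectation (\<lambda>\<omega>. w r i \<omega> * (w u i \<omega> * a \<omega> * b \<omega> * c \<omega>)))"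
    using summand by (intro Bochner_Integration.integral_sum) auto
  also have "\<dots> = 0" using summand by simp
  finally show ?thesis .
qed

definition lagged :: "nat \<Rightarrow> nat \<Rightarrow> int \<times> int \<Rightarrow> 'w \<Rightarrow> real" where
  "lagged n \<tau> = (\<lambda>(t, s) \<omega>. ip t s \<omega> * ip (circ n (t + int \<tau>)) (circ n (s + int \<tau>)) \<omega>)"

lemma finite_offdiag [simp]: "finite (offdiag n)"
  by (rule finite_subset[of _ "{1..int n} \<times> {1..int n}"]) (auto simp: offdiag_def)

lemma card_offdiag: "card (offdiag n) = n * (n - 1)"
proof -
  have "offdiag n = {1..int n} \<times> {1..int n} - (\<lambda>t. (t, t)) ` {1..int n}"
    by (auto simp: offdiag_def)
  moreover have "card ((\<lambda>t :: int. (t, t)) ` {1..int n}) = n"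
    by (subst card_image) (auto simp: inj_on_def)
  ultimately have "card (offdiag n) = n * n - n"
    by (simp add: card_Diff_subset card_cartesian_product image_subset_iff)
  then show ?thesis by (simp add: diff_mult_distrib2)
qed

text \<open>The product of two lagged terms has mean zero as soon as one of the eight time indices
  involved occurs in only one scalar product.\<close>

lemma lagged_second_moment:
  assumes \<tau>: "1 \<le> \<tau>" "2 * \<tau> < n" and B: "B \<subseteq> offdiag n"
  shows "integrable P (\<lambda>\<omega>. (\<Sum>z\<in>B. lagged n \<tau> z \<omega>)\<^sup>2)"
    "expectation (\<lambda>\<omega>. (\<Sum>z\<in>B. lagged n \<tau> z \<omega>)\<^sup>2) \<le> real (card B) * 64 * (C0 * (real p)\<^sup>2)"
proof -
  let ?V = "{1..int n}"
  define \<sigma> where "\<sigma> = (\<lambda>t. circ n (t + int \<tau>))"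
  have \<sigma>: "\<sigma> t \<in> ?V" "\<sigma> t \<noteq> t" "\<sigma> (\<sigma> t) \<noteq> t" if "t \<in> ?V" for t
    using circ_shift[OF \<tau> that] by (auto simp: \<sigma>_def)
  have inj: "inj_on \<sigma> ?V" unfolding \<sigma>_def by (rule circ_shift_inj)
  have finB: "finite B" by (rule finite_subset[OF B]) simp
  have BD: "t \<in> ?V" "s \<in> ?V" "t \<noteq> s" "\<sigma> t \<noteq> \<sigma> s" if "(t, s) \<in> B" for t s
    using B that inj_onD[OF inj, of t s] by (auto simp: offdiag_def)
  have lag: "lagged n \<tau> (t, s) \<omega> = ip t s \<omega> * ip (\<sigma> t) (\<sigma> s) \<omega>" for t s \<omega>
    by (simp add: lagged_def \<sigma>_def)
  \<comment> \<open>\<open>S z\<close> contains the four times that \<open>lagged\<close> involves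
    at \<open>z\<close>, and \<open>N z\<close> the times that lie in it or are shifted into it.
    These are at most 4 + 4 = 8, whence the 64 pairs that may be correlated with
    \<open>z\<close>.\<close>
  define S where "S = (\<lambda>z. {fst z, snd z, \<sigma> (fst z), \<sigma> (snd z)})"
  define N where "N = (\<lambda>z. {r \<in> ?V. r \<in> S z \<or> \<sigma> r \<in> S z})"
  have cardS: "card (S z) \<le> 4" for z unfolding S_def by (rule order_trans[OF card_insert_le_m1]) (auto intro!: card_insert_le_m1)
  have cardN: "finite (N z) \<and> card (N z) \<le> 8" for z
  proof
    have fin: "finite {r \<in> ?V. Q r}" for Q by (rule finite_subset[of _ ?V]) auto
    show "finite (N z)" unfolding N_def by (rule fin)
    have "card (N z) \<le> card ({r \<in> ?V. r \<in> S z} \<union> {r \<in> ?V. \<sigma> r \<in> S z})"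
      by (rule card_mono[OF finite_UnI[OF fin fin]]) (auto simp: N_def)
    also have "\<dots> \<le> card {r \<in> ?V. r \<in> S z} + card {r \<in> ?V. \<sigma> r \<in> S z}" by (rule card_Un_le)
    also have "\<dots> \<le> card (S z) + card (S z)"
    proof (rule add_mono)
      show "card {r \<in> ?V. r \<in> S z} \<le> card (S z)" by (intro card_mono) (auto simp: S_def)
      show "card {r \<in> ?V. \<sigma> r \<in> S z} \<le> card (S z)"
        by (rule card_inj_on_le[of \<sigma>]) (auto intro: inj_on_subset[OF inj] simp: S_def)
    qed
    finally show "card (N z) \<le> 8" using cardS[of z] by simp
  qed
  have int: "integrable P (\<lambda>\<omega>. lagged n \<tau> z \<omega> * lagged n \<tau> z' \<omega>)" if "z \<in> B" "z' \<in> B" for z z'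
  proof -
    obtain t s t' s' where z: "z = (t, s)" "z' = (t', s')" by (metis prod.exhaust)
    show ?thesis
      using L4_integrable_mult4[of "ip t s" "ip (\<sigma> t) (\<sigma> s)" "ip t' s'" "ip (\<sigma> t') (\<sigma> s')"]
        BD[of t s] BD[of t' s'] that
      by (simp add: z lag mult.assoc ip_L4)
  qed
  have K: "expectation (\<lambda>\<omega>. (lagged n \<tau> z \<omega>)\<^sup>2) \<le> C0 * (real p)\<^sup>2" if "z \<in> B" for z
  proof -
    obtain t s where z: "z = (t, s)" by (metis prod.exhaust)
    note bd = BD[of t s, folded z, OF that]
    have i: "integrable P (\<lambda>\<omega>. ip t s \<omega> ^ 4)" "integrable P (\<lambda>\<omega>. ip (\<sigma> t) (\<sigma> s) \<omega> ^ 4)"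
      using bd by (auto intro: L4_integrable ip_L4)
    have "expectation (\<lambda>\<omega>. (lagged n \<tau> z \<omega>)\<^sup>2) \<le> expectation (\<lambda>\<omega>. (ip t s \<omega> ^ 4 + ip (\<sigma> t) (\<sigma> s) \<omega> ^ 4) / 2)"
    proof (rule integral_mono)
      show "integrable P (\<lambda>\<omega>. (lagged n \<tau> z \<omega>)\<^sup>2)" using int[OF that that] by (simp add: power2_eq_square)
      show "integrable P (\<lambda>\<omega>. (ip t s \<omega> ^ 4 + ip (\<sigma> t) (\<sigma> s) \<omega> ^ 4) / 2)" using i by auto
      show "(lagged n \<tau> z \<omega>)\<^sup>2 \<le> (ip t s \<omega> ^ 4 + ip (\<sigma> t) (\<sigma> s) \<omega> ^ 4) / 2" for \<omega>
        using sum_squares_ge_zero[of 0 "(ip t s \<omega>)\<^sup>2 - (ip (\<sigma> t) (\<sigma> s) \<omega>)\<^sup>2"]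
        by (simp add: z lag power2_eq_square power4_eq_xxxx algebra_simps)
    qed
    also have "\<dots> = (expectation (\<lambda>\<omega>. ip t s \<omega> ^ 4) + expectation (\<lambda>\<omega>. ip (\<sigma> t) (\<sigma> s) \<omega> ^ 4)) / 2"
      using i by simp
    also have "\<dots> \<le> (C0 * (real p)\<^sup>2 + C0 * (real p)\<^sup>2) / 2"
      using bd by (intro divide_right_mono add_mono ip_fourth) auto
    finally show ?thesis by simp
  qed
  have zero: "expectation (\<lambda>\<omega>. lagged n \<tau> (t, s) \<omega> * (ip t' s' \<omega> * ip (\<sigma> t') (\<sigma> s') \<omega>)) = 0"
    if ts: "t \<noteq> s" "\<sigma> t \<noteq> \<sigma> s" and ts': "t' \<in> ?V" "s' \<in> ?V" "t' \<noteq> s'" "\<sigma> t' \<noteq> \<sigma> s'"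
      and nt: "t' \<notin> N (t, s)" for t s t' s'
  proof (cases "t' = \<sigma> s'")
    case False
    let ?K = "{Inl t, Inl s, Inl (\<sigma> t), Inl (\<sigma> s), Inl s', Inl (\<sigma> t'), Inl (\<sigma> s')}"
    have "expectation (\<lambda>\<omega>. ip t' s' \<omega> * (ip t s \<omega> * ip (\<sigma> t) (\<sigma> s) \<omega> * ip (\<sigma> t') (\<sigma> s') \<omega>)) = 0"
    proof (rule ip_isolated[of _ _ ?K])
      show "Inl t' \<notin> ?K" using nt ts' \<sigma>(2)[OF ts'(1)] False by (auto simp: N_def S_def)
    qed (use ts ts' in \<open>auto intro!: ip_L4 F_measurable_mono[OF ip_meas]\<close>)
    then show ?thesis by (simp add: lag mult_ac)
  next
    \<comment> \<open>Now \<open>t'\<close> occurs in both scalar products of its term, and its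
      shift takes over the isolated role: \<open>\<sigma> t'\<close> differs from \<open>s'\<close>
      because a double shift has no fixed point.\<close>
    case True
    let ?K = "{Inl t, Inl s, Inl (\<sigma> t), Inl (\<sigma> s), Inl s', Inl t', Inl (\<sigma> s')}"
    have "expectation (\<lambda>\<omega>. ip (\<sigma> t') (\<sigma> s') \<omega> * (ip t s \<omega> * ip (\<sigma> t) (\<sigma> s) \<omega> * ip t' s' \<omega>)) = 0"
    proof (rule ip_isolated[of _ _ ?K])
      show "Inl (\<sigma> t') \<notin> ?K"
        using nt ts' \<sigma>(2)[OF ts'(1)] \<sigma>(3)[OF ts'(2)] True by (auto simp: N_def S_def)
    qed (use ts ts' in \<open>auto intro!: ip_L4 F_measurable_mono[OF ip_meas]\<close>)
    then show ?thesis by (simp add: lag mult_ac)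
  qed
  have uncor: "expectation (\<lambda>\<omega>. lagged n \<tau> z \<omega> * lagged n \<tau> z' \<omega>) = 0"
    if zB: "z \<in> B" "z' \<in> B" "z' \<notin> N z \<times> N z" for z z'
  proof -
    obtain t s t' s' where z: "z = (t, s)" "z' = (t', s')" by (metis prod.exhaust)
    note bd = BD[of t s, folded z, OF zB(1)] and bd' = BD[of t' s', folded z, OF zB(2)]
    have "t' \<notin> N (t, s) \<or> s' \<notin> N (t, s)" using zB(3) z by auto
    then show ?thesis
    proof
      assume "t' \<notin> N (t, s)"
      from zero[OF bd(3,4) bd'(1,2,3,4) this] show ?thesis unfolding z by (simp add: lag)
    next
      assume "s' \<notin> N (t, s)"
      from zero[OF bd(3,4) bd'(2,1) bd'(3,4)[symmetric] this] show ?thesis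
        unfolding z by (simp add: lag ip_commute[of s' t'] ip_commute[of "\<sigma> s'" "\<sigma> t'"])
    qed
  qed
  have D: "finite (N z \<times> N z) \<and> card (N z \<times> N z) \<le> 64" for z
    using cardN[of z] mult_le_mono[of "card (N z)" 8 "card (N z)" 8] by (simp add: card_cartesian_product)
  note sm = second_moment_sum_le[OF finB int K uncor D]
  show "integrable P (\<lambda>\<omega>. (\<Sum>z\<in>B. lagged n \<tau> z \<omega>)\<^sup>2)" by (rule sm(1))
  show "expectation (\<lambda>\<omega>. (\<Sum>z\<in>B. lagged n \<tau> z \<omega>)\<^sup>2) \<le> real (card B) * 64 * (C0 * (real p)\<^sup>2)"
    using sm(2) by simp
qed

text \<open>The statistic looks forward by \<tau>, the forms look back. Shifted by \<tau>, a pair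
  outside this set consists of two elements of \<open>times n\<close> that are more than
  \<open>q\<close> apart, with no wrap-around.\<close>

definition near :: "nat \<Rightarrow> nat \<Rightarrow> (int \<times> int) set" where
  "near n \<tau> = offdiag n - {(t, s). t \<in> {int q + 1 - int \<tau>..int n - int \<tau>} \<and>
     s \<in> {int q + 1 - int \<tau>..int n - int \<tau>} \<and> \<bar>t - s\<bar> > int q}"

text \<open>There are q - \<tau> edge times at the start and \<tau> at the end, so at most
  \<open>q\<close>. Two edge strips of q n pairs and a band of n (2 q + 1) pairs give the bound, as
  q >= 1.\<close>

lemma card_near:
  assumes "\<tau> \<in> {1..q}"
  shows "card (near n \<tau>) \<le> 5 * q * n"
proof -
  let ?V = "{1..int n}" and ?E = "{1..int q - int \<tau>} \<union> {int n - int \<tau> + 1..int n}"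
  have cE: "card ?E \<le> q"
  proof -
    have "card ?E \<le> card {1..int q - int \<tau>} + card {int n - int \<tau> + 1..int n}" by (rule card_Un_le)
    also have "\<dots> = q" using assms by (simp add: nat_diff_distrib)
    finally show ?thesis .
  qed
  have "near n \<tau> \<subseteq> ?E \<times> ?V \<union> ?V \<times> ?E \<union> (\<lambda>(t, j). (t, t + j)) ` (?V \<times> {- int q..int q})"
  proof
    fix z assume z: "z \<in> near n \<tau>"
    obtain t s where ts: "z = (t, s)" by (metis prod.exhaust)
    have V: "t \<in> ?V" "s \<in> ?V" using z by (auto simp: ts near_def offdiag_def)
    consider "t \<in> ?E" | "s \<in> ?E" | "\<bar>t - s\<bar> \<le> int q"
      using z by (auto simp: ts near_def offdiag_def)
    then show "z \<in> ?E \<times> ?V \<union> ?V \<times> ?E \<union> (\<lambda>(t, j). (t, t + j)) ` (?V \<times> {- int q..int q})"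
    proof cases
      case 3
      then have "z \<in> (\<lambda>(t, j). (t, t + j)) ` (?V \<times> {- int q..int q})"
        using V by (intro image_eqI[of _ _ "(t, s - t)"]) (auto simp: ts)
      then show ?thesis by blast
    qed (use V in \<open>auto simp: ts\<close>)
  qed
  then have "card (near n \<tau>) \<le> card (?E \<times> ?V \<union> ?V \<times> ?E \<union> (\<lambda>(t, j). (t, t + j)) ` (?V \<times> {- int q..int q}))"
    by (intro card_mono) auto
  also have "\<dots> \<le> card (?E \<times> ?V) + card (?V \<times> ?E) + card ((\<lambda>(t, j). (t, t + j)) ` (?V \<times> {- int q..int q}))"
    by (intro order_trans[OF card_Un_le] add_mono card_Un_le order_refl)
  also have "\<dots> \<le> q * n + n * q + n * (2 * q + 1)"
  proof (intro add_mono)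
    show "card (?E \<times> ?V) \<le> q * n" "card (?V \<times> ?E) \<le> n * q"
      unfolding card_cartesian_product using cE by (auto intro: mult_le_mono)
    have "card ((\<lambda>(t, j). (t, t + j)) ` (?V \<times> {- int q..int q})) \<le> card (?V \<times> {- int q..int q})"
      by (rule card_image_le) simp
    also have "\<dots> = n * nat (2 * int q + 1)" by (simp add: card_cartesian_product)
    also have "nat (2 * int q + 1) = 2 * q + 1" by simp
    finally show "card ((\<lambda>(t, j). (t, t + j)) ` (?V \<times> {- int q..int q})) \<le> n * (2 * q + 1)" .
  qed
  also have "\<dots> \<le> 5 * q * n" using assms by (cases q) (auto simp: algebra_simps)
  finally show ?thesis .
qed

text \<open>The shift by \<tau> matches the forward lags of the statistic with the backward lags of
  the forms; the factor 2 arises because the statistic runs over ordered pairs.\<close>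

lemma offdiag_sum_split:
  assumes \<tau>: "\<tau> \<in> {1..q}" and n: "2 * q < n"
  shows "(\<Sum>z\<in>offdiag n. lagged n \<tau> z \<omega>) = (\<Sum>z\<in>near n \<tau>. lagged n \<tau> z \<omega>) +
    2 * (\<Sum>(s, t)\<in>{(s, t) \<in> times n \<times> times n. s + int q < t}. ip s t \<omega> * ip (s - int \<tau>) (t - int \<tau>) \<omega>)"
proof -
  let ?P = "{(s, t) \<in> times n \<times> times n. s + int q < t}" and ?P' = "{(s, t) \<in> times n \<times> times n. t + int q < s}"
  let ?M = "{(t, s). t \<in> {int q + 1 - int \<tau>..int n - int \<tau>} \<and>
     s \<in> {int q + 1 - int \<tau>..int n - int \<tau>} \<and> \<bar>t - s\<bar> > int q}"
  let ?f = "\<lambda>(s, t). ip s t \<omega> * ip (s - int \<tau>) (t - int \<tau>) \<omega>"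
  have fin: "finite ?P" "finite ?P'"
    by (rule finite_subset[of _ "times n \<times> times n"], auto)+
  have M: "?M \<subseteq> offdiag n" using \<tau> by (auto simp: offdiag_def)
  have "(\<Sum>z\<in>offdiag n. lagged n \<tau> z \<omega>) = (\<Sum>z\<in>near n \<tau>. lagged n \<tau> z \<omega>) + (\<Sum>z\<in>?M. lagged n \<tau> z \<omega>)"
    unfolding near_def using M by (intro sum.subset_diff) auto
  also have "(\<Sum>z\<in>?M. lagged n \<tau> z \<omega>) = (\<Sum>z\<in>?P \<union> ?P'. ?f z)"
    by (rule sum.reindex_bij_witness[of _ "\<lambda>(s, t). (s - int \<tau>, t - int \<tau>)" "\<lambda>(s, t). (s + int \<tau>, t + int \<tau>)"])
       (use \<tau> in \<open>auto simp: times_def lagged_def circ_def\<close>)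
  also have "\<dots> = (\<Sum>z\<in>?P. ?f z) + (\<Sum>z\<in>?P'. ?f z)"
    by (rule sum.union_disjoint[OF fin]) auto
  also have "(\<Sum>z\<in>?P'. ?f z) = (\<Sum>z\<in>?P. ?f z)"
    by (rule sum.reindex_bij_witness[of _ prod.swap prod.swap]) (auto simp: ip_commute)
  finally show ?thesis by simp
qed

lemma hybrid_noise:
  "hybrid n \<gamma> (int n + 1) \<omega> =
    (\<Sum>\<tau>=1..q. \<gamma> \<tau> * (\<Sum>(s, t)\<in>{(s, t) \<in> times n \<times> times n. s + int q < t}. ip s t \<omega> * ip (s - int \<tau>) (t - int \<tau>) \<omega>))"
proof -
  have "hybrid n \<gamma> (int n + 1) \<omega> = (\<Sum>(s, t)\<in>{(s, t) \<in> times n \<times> times n. s + int q < t}.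
      \<Sum>\<tau>=1..q. \<gamma> \<tau> * (ip s t \<omega> * ip (s - int \<tau>) (t - int \<tau>) \<omega>))"
    unfolding hybrid_def form_noise[symmetric]
    by (intro sum.cong refl) (auto simp: times_def)
  then show ?thesis
    by (simp add: case_prod_beta sum_distrib_left) (rule sum.swap)
qed

end

text \<open>Slutsky's theorem in quantitative form. For |d| <= 1/2 the difference is at most 2 |x
  d|, which \<open>r\<close> splits into squares. Otherwise the denominator may be close to 0, but
  then the trivial bound 2 is at most 8 d^2.\<close>

lemma cos_ratio_le:
  fixes x d r :: real
  assumes r: "r > 0"
  shows "\<bar>cos (x / (1 + d) + \<phi>) - cos (x + \<phi>)\<bar> \<le> r * x\<^sup>2 + d\<^sup>2 / r + 8 * d\<^sup>2"
proof (cases "\<bar>d\<bar> \<le> 1 / 2")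
  case True
  then have d: "1 + d \<ge> 1 / 2" by linarith
  have "\<bar>cos (x / (1 + d) + \<phi>) - cos (x + \<phi>)\<bar> \<le> \<bar>x / (1 + d) - x\<bar>"
    using abs_cos_diff_le[of "x / (1 + d) + \<phi>" "x + \<phi>"] by simp
  also have "x / (1 + d) - x = - (x * d) / (1 + d)" using d by (simp add: field_simps)
  also have "\<bar>- (x * d) / (1 + d)\<bar> = \<bar>x * d\<bar> / (1 + d)" using d by (simp add: abs_divide)
  also have "\<dots> \<le> \<bar>x * d\<bar> / (1 / 2)" using d by (intro divide_left_mono) auto
  also have "\<dots> \<le> r * x\<^sup>2 + d\<^sup>2 / r"
  proof -
    have "0 \<le> (r * \<bar>x\<bar> - \<bar>d\<bar>)\<^sup>2 / r" using r by simp
    also have "\<dots> = r * x\<^sup>2 + d\<^sup>2 / r - \<bar>x * d\<bar> / (1 / 2)"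
      using r by (simp add: power2_diff power_mult_distrib abs_mult field_simps power2_eq_square)
    finally show ?thesis by simp
  qed
  finally show ?thesis using zero_le_power2[of d] by linarith
next
  case False
  then have "(1 / 2)\<^sup>2 \<le> \<bar>d\<bar>\<^sup>2" by (intro power_mono) auto
  then have "2 \<le> 8 * d\<^sup>2" by (simp add: power_divide)
  moreover have "\<bar>cos (x / (1 + d) + \<phi>) - cos (x + \<phi>)\<bar> \<le> 2"
    using abs_cos_le_one[of "x / (1 + d) + \<phi>"] abs_cos_le_one[of "x + \<phi>"] by linarith
  moreover have "0 \<le> r * x\<^sup>2 + d\<^sup>2 / r" using r by simp
  ultimately show ?thesis by linarith
qed

section \<open>Replacing the estimated variance by its mean\<close>

context noise
begin

definition trS2 :: real where
  "trS2 = (\<Sum>i<p. (lam i)\<^sup>2)"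

lemma ip_second:
  assumes "s \<noteq> t"
  shows "expectation (\<lambda>\<omega>. (ip s t \<omega>)\<^sup>2) = trS2"
proof -
  have i: "integrable P (\<lambda>\<omega>. w s i \<omega> * w s i \<omega>)" if "i < p" for i
    by (rule L4_integrable_mult[OF w_L4[OF that] w_L4[OF that]])
  have "expectation (\<lambda>\<omega>. 1 * (\<Sum>i\<in>{..<p}. w s i \<omega> * w t i \<omega>)\<^sup>2) =
      expectation (\<lambda>\<omega>. 1 * (\<Sum>i\<in>{..<p}. lam i * (w s i \<omega>)\<^sup>2))"
    by (rule quadratic_form_expectation(2)[of _ _ "{Inl s}" _ _ "{Inl t}"])
       (use assms in \<open>auto intro: w_meas w_L4 L4_integrable_mult simp: w_cov\<close>)
  then have "expectation (\<lambda>\<omega>. (ip s t \<omega>)\<^sup>2) = expectation (\<lambda>\<omega>. \<Sum>i<p. lam i * (w s i \<omega> * w s i \<omega>))"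
    by (simp add: ip_def power2_eq_square)
  also have "\<dots> = (\<Sum>i<p. lam i * expectation (\<lambda>\<omega>. w s i \<omega> * w s i \<omega>))"
    using i by (simp add: Bochner_Integration.integral_sum)
  also have "\<dots> = trS2" unfolding trS2_def by (intro sum.cong) (auto simp: w_cov power2_eq_square)
  finally show ?thesis .
qed

text \<open>The relative error of \<open>sigma_hat\<close> as an estimator of sqrt 2 * trS2 /
  p.\<close>

definition dev :: "nat \<Rightarrow> 'w \<Rightarrow> real" where
  "dev n \<omega> = (\<Sum>(t, s)\<in>offdiag n. (ip t s \<omega>)\<^sup>2 - trS2) / (real n * (real n - 1) * trS2)"

text \<open>Terms at disjoint pairs are independent, and at most 4 n pairs meet a given one. So the
  sum over n (n - 1) pairs has second moment O(n^3 p^2), against the square of n (n - 1) trS2; the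
  lower bound c p for \<open>trS2\<close> cancels \<open>p\<close>. The constant is 4 * 2, from 1/(n
  - 1) <= 2/n.\<close>

lemma dev_second_moment:
  assumes n: "n \<ge> 2" and p: "p \<ge> 1" and c: "c > 0" "c * real p \<le> trS2"
  shows "integrable P (\<lambda>\<omega>. (dev n \<omega>)\<^sup>2)" "expectation (\<lambda>\<omega>. (dev n \<omega>)\<^sup>2) \<le> 8 * C0 / c\<^sup>2 / real n"
proof -
  define g where "g = (\<lambda>(t, s) \<omega>. (ip t s \<omega>)\<^sup>2 - trS2)"
  define N where "N = (\<lambda>(t, s). {t, s} \<times> {1..int n} \<union> {1..int n} \<times> {t, s})"
  have od: "t \<noteq> s" if "(t, s) \<in> offdiag n" for t s using that by (auto simp: offdiag_def)
  have i2: "integrable P (\<lambda>\<omega>. (ip t s \<omega>)\<^sup>2)" if "t \<noteq> s" for t s by (rule L4_integrable(2)[OF ip_L4[OF that]])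
  have int: "integrable P (\<lambda>\<omega>. g z \<omega> * g z' \<omega>)" if "z \<in> offdiag n" "z' \<in> offdiag n" for z z'
  proof -
    obtain t s t' s' where z: "z = (t, s)" "z' = (t', s')" by (metis prod.exhaust)
    have ne: "t \<noteq> s" "t' \<noteq> s'" using od that z by auto
    have "integrable P (\<lambda>\<omega>. (ip t s \<omega>)\<^sup>2 * (ip t' s' \<omega>)\<^sup>2 - trS2 * (ip t s \<omega>)\<^sup>2 - trS2 * (ip t' s' \<omega>)\<^sup>2 + trS2 * trS2)"
      using L4_integrable_square_mult[OF ip_L4[OF ne(1)] ip_L4[OF ne(2)]] i2[OF ne(1)] i2[OF ne(2)] by auto
    also have "(\<lambda>\<omega>. (ip t s \<omega>)\<^sup>2 * (ip t' s' \<omega>)\<^sup>2 - trS2 * (ip t s \<omega>)\<^sup>2 - trS2 * (ip t' s' \<omega>)\<^sup>2 + trS2 * trS2) =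
        (\<lambda>\<omega>. g z \<omega> * g z' \<omega>)"
      by (rule ext) (simp add: g_def z algebra_simps)
    finally show ?thesis .
  qed
  have K: "expectation (\<lambda>\<omega>. (g z \<omega>)\<^sup>2) \<le> C0 * (real p)\<^sup>2" if "z \<in> offdiag n" for z
  proof -
    obtain t s where z: "z = (t, s)" by (metis prod.exhaust)
    have ne: "t \<noteq> s" using od that z by auto
    have "expectation (\<lambda>\<omega>. (g z \<omega>)\<^sup>2) = expectation (\<lambda>\<omega>. ip t s \<omega> ^ 4 - 2 * trS2 * (ip t s \<omega>)\<^sup>2 + trS2\<^sup>2)"
      by (rule Bochner_Integration.integral_cong) (auto simp: g_def z power2_eq_square power4_eq_xxxx algebra_simps)
    also have "\<dots> = expectation (\<lambda>\<omega>. ip t s \<omega> ^ 4) - 2 * trS2 * trS2 + trS2\<^sup>2"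
      using L4_integrable(5)[OF ip_L4[OF ne]] i2[OF ne] ip_second[OF ne] by (simp add: prob_space)
    also have "\<dots> \<le> expectation (\<lambda>\<omega>. ip t s \<omega> ^ 4)" by (simp add: power2_eq_square)
    finally show ?thesis using ip_fourth[OF ne] by linarith
  qed
  have uncor: "expectation (\<lambda>\<omega>. g z \<omega> * g z' \<omega>) = 0"
    if "z \<in> offdiag n" "z' \<in> offdiag n" "z' \<notin> N z" for z z'
  proof -
    obtain t s t' s' where z: "z = (t, s)" "z' = (t', s')" by (metis prod.exhaust)
    have ne: "t \<noteq> s" "t' \<noteq> s'" using od that z by auto
    have m: "g (a, b) \<in> borel_measurable (F {Inl a, Inl b})" for a b
      unfolding g_def using ip_meas[of a b] by simp
    have i: "integrable P (g (a, b)) \<and> expectation (g (a, b)) = 0" if "a \<noteq> b" for a b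
      using i2[OF that] ip_second[OF that] by (simp add: g_def prob_space)
    have disj: "{Inl t, Inl s} \<inter> {Inl t', Inl s'} = ({} :: (int + int \<times> nat \<times> nat \<times> nat) set)"
      using that(2,3) unfolding z N_def by (auto simp: offdiag_def)
    have "expectation (\<lambda>\<omega>. g z \<omega> * g z' \<omega>) = expectation (g z) * expectation (g z')"
      unfolding z by (rule indep_mult(2)[OF m _ m _ disj]) (use i ne in auto)
    then show ?thesis using i ne z by simp
  qed
  have D: "finite (N z) \<and> card (N z) \<le> 4 * n" for z
  proof -
    obtain t s where z: "z = (t, s)" by (metis prod.exhaust)
    have "card (N z) \<le> card ({t, s} \<times> {1..int n}) + card ({1..int n} \<times> {t, s})"
      unfolding N_def z prod.case by (rule card_Un_le)
    also have "\<dots> \<le> 2 * n + n * 2"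
      unfolding card_cartesian_product by (intro add_mono mult_le_mono) (auto simp: card_insert_if)
    finally show ?thesis by (simp add: N_def z)
  qed
  have sm1: "integrable P (\<lambda>\<omega>. (\<Sum>z\<in>offdiag n. g z \<omega>)\<^sup>2)"
    by (rule second_moment_sum_le(1)[where D = N and N = "4 * n" and K = "C0 * (real p)\<^sup>2", OF finite_offdiag])
       (use int K uncor D in auto)
  have sm2: "expectation (\<lambda>\<omega>. (\<Sum>z\<in>offdiag n. g z \<omega>)\<^sup>2) \<le> real (card (offdiag n)) * real (4 * n) * (C0 * (real p)\<^sup>2)"
    by (rule second_moment_sum_le(2)[where D = N and N = "4 * n" and K = "C0 * (real p)\<^sup>2", OF finite_offdiag])
       (use int K uncor D in auto)
  have S: "trS2 > 0" using c p by (smt (verit) mult_pos_pos of_nat_0_less_iff not_one_le_zero zero_less_iff_neq_zero)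
  have n1: "real n - 1 > 0" "real n > 0" using n by auto
  have deq: "(\<lambda>\<omega>. (dev n \<omega>)\<^sup>2) = (\<lambda>\<omega>. (\<Sum>z\<in>offdiag n. g z \<omega>)\<^sup>2 / (real n * (real n - 1) * trS2)\<^sup>2)"
    by (rule ext) (simp add: dev_def g_def power_divide case_prod_beta)
  show "integrable P (\<lambda>\<omega>. (dev n \<omega>)\<^sup>2)" unfolding deq using sm1 by simp
  have "expectation (\<lambda>\<omega>. (dev n \<omega>)\<^sup>2) = expectation (\<lambda>\<omega>. (\<Sum>z\<in>offdiag n. g z \<omega>)\<^sup>2) / (real n * (real n - 1) * trS2)\<^sup>2"
    unfolding deq by simp
  also have "\<dots> \<le> (real (card (offdiag n)) * real (4 * n) * (C0 * (real p)\<^sup>2)) / (real n * (real n - 1) * trS2)\<^sup>2"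
    by (intro divide_right_mono sm2) (rule zero_le_power2)
  also have "real (card (offdiag n)) = real n * (real n - 1)"
    using n by (simp add: card_offdiag of_nat_diff)
  also have "(real n * (real n - 1) * real (4 * n) * (C0 * (real p)\<^sup>2)) / (real n * (real n - 1) * trS2)\<^sup>2 =
      4 * C0 * ((real p)\<^sup>2 / trS2\<^sup>2) * (1 / (real n - 1))"
  proof -
    have "(x * m * (4 * x) * (a * b)) / (x * m * S)\<^sup>2 = 4 * a * (b / S\<^sup>2) * (1 / m)"
      if "x > 0" "m > 0" "S > 0" for x m S a b :: real
      using that by (simp add: field_simps power2_eq_square)
    from this[OF n1(2,1) S] show ?thesis by simp
  qed
  also have "\<dots> \<le> 4 * C0 * (1 / c\<^sup>2) * (2 / real n)"
  proof (intro mult_mono)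
    show "(real p)\<^sup>2 / trS2\<^sup>2 \<le> 1 / c\<^sup>2"
    proof -
      have "(c * real p)\<^sup>2 \<le> trS2\<^sup>2" using c by (intro power_mono) auto
      then show ?thesis using c S by (simp add: field_simps power_mult_distrib)
    qed
    show "1 / (real n - 1) \<le> 2 / real n" using n1 n by (simp add: field_simps)
  qed (use C0_nonneg[OF p] n1 in auto)
  finally show "expectation (\<lambda>\<omega>. (dev n \<omega>)\<^sup>2) \<le> 8 * C0 / c\<^sup>2 / real n" by simp
qed

definition combo :: "nat \<Rightarrow> (nat \<Rightarrow> real) \<Rightarrow> 'w \<Rightarrow> real" where
  "combo n \<gamma> \<omega> = (\<Sum>\<tau>=1..q. \<gamma> \<tau> / 2 * (\<Sum>z\<in>offdiag n. lagged n \<tau> z \<omega>))"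

text \<open>The dimension cancels between \<open>G_stat\<close> and \<open>sigma_hat\<close>, and
  \<theta> / (sqrt 2 n trS2) is \<gamma> / 2. The half stands in \<open>combo\<close>, which counts
  each unordered pair twice, so that \<gamma> itself is the weight in \<open>hybrid\<close>.\<close>

lemma H_stat_combination:
  assumes n: "n \<ge> 2" and S: "trS2 > 0"
    and \<gamma>: "\<And>\<tau>. \<gamma> \<tau> = sqrt 2 * \<theta> \<tau> / (real n * trS2)"
  shows "(\<Sum>\<tau>=1..q. \<theta> \<tau> * H_stat p n \<tau> (\<lambda>t i. w t i \<omega>)) = combo n \<gamma> \<omega> / (1 + dev n \<omega>)"
proof (cases "p = 0")
  case True
  have "trS2 = 0" unfolding trS2_def using True by simp
  with S show ?thesis by simp
next
  case False
  have n1: "real n - 1 > 0" "real n > 0" using n by auto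
  have od: "(\<Sum>z\<in>offdiag n. trS2) = real n * (real n - 1) * trS2"
    using n by (simp add: card_offdiag of_nat_diff)
  have "(\<Sum>(t, s)\<in>offdiag n. (ip t s \<omega>)\<^sup>2 - trS2) = (\<Sum>(t, s)\<in>offdiag n. (ip t s \<omega>)\<^sup>2) - real n * (real n - 1) * trS2"
    unfolding od[symmetric] by (simp add: sum_subtractf case_prod_beta)
  then have "(\<Sum>(t, s)\<in>offdiag n. (ip t s \<omega>)\<^sup>2) = real n * (real n - 1) * trS2 * (1 + dev n \<omega>)"
    unfolding dev_def using n1 S by (simp add: field_simps)
  then have sh: "sigma_hat p n (\<lambda>t i. w t i \<omega>) = sqrt 2 * trS2 / real p * (1 + dev n \<omega>)"
    using n1 by (simp add: sigma_hat_def dotp_def ip_def[symmetric])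
  have G: "G_stat p n \<tau> (\<lambda>t i. w t i \<omega>) = 1 / (real n * real p) * (\<Sum>z\<in>offdiag n. lagged n \<tau> z \<omega>)" for \<tau>
    by (simp add: G_stat_def dotp_def ip_def[symmetric] lagged_def case_prod_beta)
  have "\<theta> \<tau> * H_stat p n \<tau> (\<lambda>t i. w t i \<omega>) = \<gamma> \<tau> / 2 * (\<Sum>z\<in>offdiag n. lagged n \<tau> z \<omega>) / (1 + dev n \<omega>)" for \<tau>
  proof -
    define L where "L = (\<Sum>z\<in>offdiag n. lagged n \<tau> z \<omega>)"
    define e where "e = 1 + dev n \<omega>"
    have "\<theta> \<tau> * (1 / (real n * real p) * L / (sqrt 2 * trS2 / real p * e)) =
        (\<theta> \<tau> * (1 / (real n * real p)) / (sqrt 2 * trS2 / real p)) * L / e"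
      by (simp add: divide_divide_eq_left mult_ac)
    also have "\<theta> \<tau> * (1 / (real n * real p)) / (sqrt 2 * trS2 / real p) = \<gamma> \<tau> / 2"
      unfolding \<gamma> using n1 S False by (simp add: field_simps)
    finally show ?thesis by (simp add: H_stat_def sh G L_def e_def)
  qed
  then show ?thesis by (simp add: combo_def sum_divide_distrib)
qed

lemma combo_measurable [measurable]: "combo n \<gamma> \<in> borel_measurable P"
  unfolding combo_def lagged_def by (simp add: case_prod_beta)

lemma dev_measurable [measurable]: "dev n \<in> borel_measurable P"
  unfolding dev_def by (simp add: case_prod_beta)

lemma hybrid_noise_measurable: "hybrid n \<gamma> (int n + 1) \<in> borel_measurable P"
proof -
  have "hybrid n \<gamma> (int n + 1) =
    (\<lambda>\<omega>. \<Sum>\<tau>=1..q. \<gamma> \<tau> * (\<Sum>(s, t)\<in>{(s, t) \<in> times n \<times> times n. s + int q < t}. ip s t \<omega> * ip (s - int \<tau>) (t - int \<tau>) \<omega>))"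
    by (rule ext) (rule hybrid_noise)
  then show ?thesis by (simp add: case_prod_beta)
qed

lemma integrable_cos:
  fixes X :: "'w \<Rightarrow> real"
  assumes [measurable]: "X \<in> borel_measurable P"
  shows "integrable P (\<lambda>\<omega>. cos (X \<omega> + \<phi>))"
  by (rule integrable_const_bound[of _ 1]) auto

text \<open>Only the \<open>near\<close> pairs separate the two expressions. There are O(n) of them,
  and for weights of order 1/(n p) their sum is of order n^(-1/2) in mean square.\<close>

lemma combo_near_hybrid:
  assumes n: "2 * q < n" and \<gamma>: "\<And>\<tau>. \<tau> \<in> {1..q} \<Longrightarrow> \<bar>\<gamma> \<tau>\<bar> \<le> \<kappa>"
    and s: "s > 0" "(\<kappa> / 2)\<^sup>2 * (real (5 * q * n) * 64 * (C0 * (real p)\<^sup>2)) \<le> s\<^sup>2"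
    and p: "p \<ge> 1"
  shows "\<bar>expectation (\<lambda>\<omega>. cos (combo n \<gamma> \<omega> + \<phi>)) - expectation (\<lambda>\<omega>. cos (hybrid n \<gamma> (int n + 1) \<omega> + \<phi>))\<bar> \<le> real q * s"
proof -
  define X where "X = (\<lambda>\<tau> \<omega>. \<gamma> \<tau> / 2 * (\<Sum>z\<in>near n \<tau>. lagged n \<tau> z \<omega>))"
  have diff: "combo n \<gamma> \<omega> - hybrid n \<gamma> (int n + 1) \<omega> = (\<Sum>\<tau>=1..q. X \<tau> \<omega>)" for \<omega>
    unfolding combo_def hybrid_noise X_def sum_subtractf[symmetric]
    by (rule sum.cong) (use n in \<open>auto simp: offdiag_sum_split algebra_simps\<close>)
  have Xm [measurable]: "X \<tau> \<in> borel_measurable P" for \<tau>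
    unfolding X_def lagged_def by (simp add: case_prod_beta)
  have X: "integrable P (X \<tau>) \<and> expectation (\<lambda>\<omega>. \<bar>X \<tau> \<omega>\<bar>) \<le> s" if \<tau>: "\<tau> \<in> {1..q}" for \<tau>
  proof -
    have t: "1 \<le> \<tau>" "2 * \<tau> < n" using \<tau> n by auto
    note sm = lagged_second_moment[OF t, of "near n \<tau>"]
    have sub: "near n \<tau> \<subseteq> offdiag n" by (auto simp: near_def)
    have sq: "(\<lambda>\<omega>. (X \<tau> \<omega>)\<^sup>2) = (\<lambda>\<omega>. (\<gamma> \<tau> / 2)\<^sup>2 * (\<Sum>z\<in>near n \<tau>. lagged n \<tau> z \<omega>)\<^sup>2)"
      by (rule ext) (simp add: X_def power_mult_distrib power_divide)
    have "expectation (\<lambda>\<omega>. (X \<tau> \<omega>)\<^sup>2) = (\<gamma> \<tau> / 2)\<^sup>2 * expectation (\<lambda>\<omega>. (\<Sum>z\<in>near n \<tau>. lagged n \<tau> z \<omega>)\<^sup>2)"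
      unfolding sq by simp
    also have "\<dots> \<le> (\<kappa> / 2)\<^sup>2 * (real (card (near n \<tau>)) * 64 * (C0 * (real p)\<^sup>2))"
    proof (intro mult_mono sm(2) sub)
      have "\<bar>\<gamma> \<tau> / 2\<bar>\<^sup>2 \<le> (\<kappa> / 2)\<^sup>2" using \<gamma>[OF \<tau>] by (intro power_mono) auto
      then show "(\<gamma> \<tau> / 2)\<^sup>2 \<le> (\<kappa> / 2)\<^sup>2" by (simp add: power_divide)
    qed auto
    also have "\<dots> \<le> (\<kappa> / 2)\<^sup>2 * (real (5 * q * n) * 64 * (C0 * (real p)\<^sup>2))"
      using card_near[OF \<tau>, of n] C0_nonneg[OF p]
      by (intro mult_left_mono mult_right_mono) (auto simp only: of_nat_le_iff intro: mult_nonneg_nonneg zero_le_power2)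
    finally have "expectation (\<lambda>\<omega>. (X \<tau> \<omega>)\<^sup>2) \<le> s\<^sup>2" using s(2) by (rule order_trans)
    moreover have "integrable P (\<lambda>\<omega>. (X \<tau> \<omega>)\<^sup>2)" unfolding sq using sm(1)[OF sub] by simp
    ultimately show ?thesis using expectation_abs_le[OF Xm _ _ s(1)] by blast
  qed
  note Hm = hybrid_noise_measurable[of n \<gamma>] and Cm = combo_measurable[of n \<gamma>]
  have "\<bar>expectation (\<lambda>\<omega>. cos (combo n \<gamma> \<omega> + \<phi>)) - expectation (\<lambda>\<omega>. cos (hybrid n \<gamma> (int n + 1) \<omega> + \<phi>))\<bar> =
      \<bar>expectation (\<lambda>\<omega>. cos (combo n \<gamma> \<omega> + \<phi>) - cos (hybrid n \<gamma> (int n + 1) \<omega> + \<phi>))\<bar>"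
    using integrable_cos[OF Hm] integrable_cos[OF Cm] by simp
  also have "\<dots> \<le> expectation (\<lambda>\<omega>. \<bar>cos (combo n \<gamma> \<omega> + \<phi>) - cos (hybrid n \<gamma> (int n + 1) \<omega> + \<phi>)\<bar>)"
    by (rule integral_abs_bound)
  also have "\<dots> \<le> expectation (\<lambda>\<omega>. \<Sum>\<tau>=1..q. \<bar>X \<tau> \<omega>\<bar>)"
  proof (rule integral_mono)
    show "integrable P (\<lambda>\<omega>. \<bar>cos (combo n \<gamma> \<omega> + \<phi>) - cos (hybrid n \<gamma> (int n + 1) \<omega> + \<phi>)\<bar>)"
      using integrable_cos[OF Hm] integrable_cos[OF Cm] by auto
    show "integrable P (\<lambda>\<omega>. \<Sum>\<tau>=1..q. \<bar>X \<tau> \<omega>\<bar>)" using X by auto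
    show "\<bar>cos (combo n \<gamma> \<omega> + \<phi>) - cos (hybrid n \<gamma> (int n + 1) \<omega> + \<phi>)\<bar> \<le> (\<Sum>\<tau>=1..q. \<bar>X \<tau> \<omega>\<bar>)" for \<omega>
      using abs_cos_diff_le[of "combo n \<gamma> \<omega> + \<phi>" "hybrid n \<gamma> (int n + 1) \<omega> + \<phi>"] diff[of \<omega>]
        sum_abs[of "\<lambda>\<tau>. X \<tau> \<omega>" "{1..q}"] by linarith
  qed
  also have "\<dots> = (\<Sum>\<tau>=1..q. expectation (\<lambda>\<omega>. \<bar>X \<tau> \<omega>\<bar>))"
    using X by (intro Bochner_Integration.integral_sum) auto
  also have "\<dots> \<le> (\<Sum>\<tau>=1..q. s)" using X by (intro sum_mono) auto
  finally show ?thesis by simp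
qed

text \<open>For \<kappa> of order 1/(n p) the bound depends on neither \<open>n\<close> nor
  \<open>p\<close>; it is what the comparison in \<open>slutsky\<close> requires.\<close>

lemma combo_second_moment:
  assumes n: "2 * q < n" and \<gamma>: "\<And>\<tau>. \<tau> \<in> {1..q} \<Longrightarrow> \<bar>\<gamma> \<tau>\<bar> \<le> \<kappa>" and p: "p \<ge> 1"
  shows "integrable P (\<lambda>\<omega>. (combo n \<gamma> \<omega>)\<^sup>2)"
    "expectation (\<lambda>\<omega>. (combo n \<gamma> \<omega>)\<^sup>2) \<le> 16 * (real q)\<^sup>2 * (\<kappa> * (real n * real p))\<^sup>2 * C0"
proof -
  define X where "X = (\<lambda>\<tau> \<omega>. \<gamma> \<tau> / 2 * (\<Sum>z\<in>offdiag n. lagged n \<tau> z \<omega>))"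
  have Xm [measurable]: "X \<tau> \<in> borel_measurable P" for \<tau>
    unfolding X_def lagged_def by (simp add: case_prod_beta)
  have X: "integrable P (\<lambda>\<omega>. (X \<tau> \<omega>)\<^sup>2) \<and> expectation (\<lambda>\<omega>. (X \<tau> \<omega>)\<^sup>2) \<le> 16 * (\<kappa> * (real n * real p))\<^sup>2 * C0"
    if \<tau>: "\<tau> \<in> {1..q}" for \<tau>
  proof -
    have t: "1 \<le> \<tau>" "2 * \<tau> < n" using \<tau> n by auto
    note sm = lagged_second_moment[OF t order_refl]
    have sq: "(\<lambda>\<omega>. (X \<tau> \<omega>)\<^sup>2) = (\<lambda>\<omega>. (\<gamma> \<tau> / 2)\<^sup>2 * (\<Sum>z\<in>offdiag n. lagged n \<tau> z \<omega>)\<^sup>2)"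
      by (rule ext) (simp add: X_def power_mult_distrib power_divide)
    have "expectation (\<lambda>\<omega>. (X \<tau> \<omega>)\<^sup>2) = (\<gamma> \<tau> / 2)\<^sup>2 * expectation (\<lambda>\<omega>. (\<Sum>z\<in>offdiag n. lagged n \<tau> z \<omega>)\<^sup>2)"
      unfolding sq by simp
    also have "\<dots> \<le> (\<kappa> / 2)\<^sup>2 * (real (card (offdiag n)) * 64 * (C0 * (real p)\<^sup>2))"
    proof (intro mult_mono sm(2))
      have "\<bar>\<gamma> \<tau> / 2\<bar>\<^sup>2 \<le> (\<kappa> / 2)\<^sup>2" using \<gamma>[OF \<tau>] by (intro power_mono) auto
      then show "(\<gamma> \<tau> / 2)\<^sup>2 \<le> (\<kappa> / 2)\<^sup>2" by (simp add: power_divide)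
    qed auto
    also have "\<dots> \<le> (\<kappa> / 2)\<^sup>2 * ((real n * real n) * 64 * (C0 * (real p)\<^sup>2))"
    proof (intro mult_left_mono mult_right_mono)
      have "card (offdiag n) \<le> n * n" by (simp add: card_offdiag)
      then show "real (card (offdiag n)) \<le> real n * real n" by (metis of_nat_le_iff of_nat_mult)
    qed (use C0_nonneg[OF p] in auto)
    also have "\<dots> = 16 * (\<kappa> * (real n * real p))\<^sup>2 * C0"
      by (simp add: power_mult_distrib power_divide power2_eq_square)
    finally show ?thesis unfolding sq using sm(1) by (simp add: sq)
  qed
  have le: "(combo n \<gamma> \<omega>)\<^sup>2 \<le> (\<Sum>\<tau>=1..q. (X \<tau> \<omega>)\<^sup>2) * real q" for \<omega>
    unfolding combo_def using sum_squared_le_sum_of_squares[of "\<lambda>\<tau>. X \<tau> \<omega>" "{1..q}"] by (simp add: X_def)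
  have iR: "integrable P (\<lambda>\<omega>. (\<Sum>\<tau>=1..q. (X \<tau> \<omega>)\<^sup>2) * real q)"
    using X by (intro integrable_mult_left Bochner_Integration.integrable_sum) auto
  show i: "integrable P (\<lambda>\<omega>. (combo n \<gamma> \<omega>)\<^sup>2)"
    by (rule Bochner_Integration.integrable_bound[OF iR]) (auto intro!: AE_I2 order_trans[OF le])
  have "expectation (\<lambda>\<omega>. (combo n \<gamma> \<omega>)\<^sup>2) \<le> expectation (\<lambda>\<omega>. (\<Sum>\<tau>=1..q. (X \<tau> \<omega>)\<^sup>2) * real q)"
    by (rule integral_mono[OF i iR le])
  also have "\<dots> = (\<Sum>\<tau>=1..q. expectation (\<lambda>\<omega>. (X \<tau> \<omega>)\<^sup>2)) * real q"
    using X by (simp add: Bochner_Integration.integral_sum)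
  also have "\<dots> \<le> (\<Sum>\<tau>=1..q. 16 * (\<kappa> * (real n * real p))\<^sup>2 * C0) * real q"
    using X by (intro mult_right_mono sum_mono) auto
  also have "\<dots> = 16 * (real q)\<^sup>2 * (\<kappa> * (real n * real p))\<^sup>2 * C0"
    by (simp add: power2_eq_square)
  finally show "expectation (\<lambda>\<omega>. (combo n \<gamma> \<omega>)\<^sup>2) \<le> 16 * (real q)\<^sup>2 * (\<kappa> * (real n * real p))\<^sup>2 * C0" .
qed

lemma slutsky:
  assumes r: "r > 0" and i: "integrable P (\<lambda>\<omega>. (combo n \<gamma> \<omega>)\<^sup>2)" "integrable P (\<lambda>\<omega>. (dev n \<omega>)\<^sup>2)"
  shows "\<bar>expectation (\<lambda>\<omega>. cos (combo n \<gamma> \<omega> / (1 + dev n \<omega>) + \<phi>)) - expectation (\<lambda>\<omega>. cos (combo n \<gamma> \<omega> + \<phi>))\<bar> \<le>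
    r * expectation (\<lambda>\<omega>. (combo n \<gamma> \<omega>)\<^sup>2) + expectation (\<lambda>\<omega>. (dev n \<omega>)\<^sup>2) / r + 8 * expectation (\<lambda>\<omega>. (dev n \<omega>)\<^sup>2)"
proof -
  have m: "(\<lambda>\<omega>. combo n \<gamma> \<omega> / (1 + dev n \<omega>)) \<in> borel_measurable P" by measurable
  have "\<bar>expectation (\<lambda>\<omega>. cos (combo n \<gamma> \<omega> / (1 + dev n \<omega>) + \<phi>)) - expectation (\<lambda>\<omega>. cos (combo n \<gamma> \<omega> + \<phi>))\<bar> =
      \<bar>expectation (\<lambda>\<omega>. cos (combo n \<gamma> \<omega> / (1 + dev n \<omega>) + \<phi>) - cos (combo n \<gamma> \<omega> + \<phi>))\<bar>"
    using integrable_cos[OF m] integrable_cos[OF combo_measurable] by simp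
  also have "\<dots> \<le> expectation (\<lambda>\<omega>. \<bar>cos (combo n \<gamma> \<omega> / (1 + dev n \<omega>) + \<phi>) - cos (combo n \<gamma> \<omega> + \<phi>)\<bar>)"
    by (rule integral_abs_bound)
  also have "\<dots> \<le> expectation (\<lambda>\<omega>. r * (combo n \<gamma> \<omega>)\<^sup>2 + (dev n \<omega>)\<^sup>2 / r + 8 * (dev n \<omega>)\<^sup>2)"
    using integrable_cos[OF m] integrable_cos[OF combo_measurable] i
    by (intro integral_mono cos_ratio_le r) auto
  also have "\<dots> = r * expectation (\<lambda>\<omega>. (combo n \<gamma> \<omega>)\<^sup>2) + expectation (\<lambda>\<omega>. (dev n \<omega>)\<^sup>2) / r + 8 * expectation (\<lambda>\<omega>. (dev n \<omega>)\<^sup>2)"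
    using i by simp
  finally show ?thesis .
qed

end

text \<open>The summands belong, in this order, to the \<open>near\<close> pairs, Lindeberg's
  replacement, the Gaussian band and the estimated variance. The summands 1 + x keep the error sizes
  positive and use x <= (1 + x)^2 in place of square roots. The constants are 80 = 5 * 64 / 4, 144 =
  16 * 9 and 72 = 8 + 64.\<close>

definition clt_rate :: "nat \<Rightarrow> real \<Rightarrow> real \<Rightarrow> real \<Rightarrow> real \<Rightarrow> real" where
  "clt_rate q C0 C2 c \<Theta> = (let \<kappa> = sqrt 2 * \<Theta> / c in
     real q * (1 + 80 * real q * \<kappa>\<^sup>2 * C0) + 8 * (1 + 144 * real q ^ 8 * \<kappa> ^ 4 * C0\<^sup>2) ^ 3 +
     (1 + real (q + 1) * real q * \<kappa>\<^sup>2 * C2 ^ 4) + (16 * (real q)\<^sup>2 * \<kappa>\<^sup>2 * C0 + 72 * C0 / c\<^sup>2))"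

lemma le_square_1_plus: "0 \<le> (x :: real) \<Longrightarrow> x \<le> (1 + x)\<^sup>2"
  by (simp add: power2_eq_square algebra_simps)

section \<open>Collecting the errors\<close>

context noise
begin

lemma H_stat_cos_approx:
  assumes q: "q \<ge> 1" and n: "2 * q < n" and p: "p \<ge> 1" and c: "c > 0" "c * real p \<le> trS2"
    and C2: "\<And>i. i < p \<Longrightarrow> lam i \<le> C2"
    and \<theta>: "\<And>\<tau>. \<tau> \<in> {1..q} \<Longrightarrow> \<bar>\<theta> \<tau>\<bar> \<le> \<Theta>"
  shows "\<bar>expectation (\<lambda>\<omega>. cos ((\<Sum>\<tau>=1..q. \<theta> \<tau> * H_stat p n \<tau> (\<lambda>t i. w t i \<omega>)) + \<phi>)) -
    Re (iexp \<phi> * (\<Prod>a\<in>idx. chi_cf (sqrt 2 * \<theta> (fst a) / (real n * trS2) * vr a * real (n - q) / 2)))\<bar>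
    \<le> clt_rate q C0 C2 c \<Theta> / sqrt (real n)"
proof -
  define \<kappa>0 where "\<kappa>0 = sqrt 2 * \<Theta> / c"
  \<comment> \<open>A common bound for the weights \<gamma>, in which c p has replaced
    \<open>trS2\<close>; thus \<kappa> n p is a constant \<open>\<kappa>0\<close>.\<close>
  define \<kappa> where "\<kappa> = \<kappa>0 / (real n * real p)"
  define \<gamma> where "\<gamma> = (\<lambda>\<tau>. sqrt 2 * \<theta> \<tau> / (real n * trS2))"
  have np: "real n > 0" "real p > 0" "real q \<ge> 1" using n p q by auto
  have n2: "n \<ge> 2" using n q by auto
  have S: "trS2 > 0" using c np by (metis less_le_trans mult_pos_pos)
  have C0: "C0 \<ge> 0" by (rule C0_nonneg[OF p])
  have \<Theta>: "\<Theta> \<ge> 0" using \<theta>[of 1] q by (smt (verit) abs_ge_zero atLeastAtMost_iff order_refl)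
  have \<kappa>0: "\<kappa>0 \<ge> 0" using \<Theta> c by (simp add: \<kappa>0_def)
  have C2_0: "0 \<le> C2" using C2[of 0] lam_nonneg[of 0] p by simp
  have \<gamma>: "\<bar>\<gamma> \<tau>\<bar> \<le> \<kappa>" if "\<tau> \<in> {1..q}" for \<tau>
  proof -
    have "\<bar>\<gamma> \<tau>\<bar> = sqrt 2 * \<bar>\<theta> \<tau>\<bar> / (real n * trS2)"
      using S np by (simp add: \<gamma>_def abs_mult abs_divide)
    also have "\<dots> \<le> sqrt 2 * \<Theta> / (real n * (c * real p))"
      using \<theta>[OF that] c S np \<Theta> by (intro frac_le mult_left_mono mult_nonneg_nonneg) auto
    also have "\<dots> = \<kappa>" by (simp add: \<kappa>_def \<kappa>0_def mult_ac)
    finally show ?thesis .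
  qed
  define s1 where "s1 = (1 + 80 * real q * \<kappa>0\<^sup>2 * C0) / sqrt (real n)"
  have a1: "0 \<le> 80 * real q * \<kappa>0\<^sup>2 * C0" using C0 by simp
  have "(\<kappa> / 2)\<^sup>2 * (real (5 * q * n) * 64 * (C0 * (real p)\<^sup>2)) = (80 * real q * \<kappa>0\<^sup>2 * C0) / real n"
    unfolding \<kappa>_def using np by (simp add: field_simps power2_eq_square)
  also have "\<dots> \<le> (1 + 80 * real q * \<kappa>0\<^sup>2 * C0)\<^sup>2 / real n"
    using np by (intro divide_right_mono le_square_1_plus[OF a1]) auto
  also have "\<dots> = s1\<^sup>2" by (simp add: s1_def power_divide)
  finally have s1: "(\<kappa> / 2)\<^sup>2 * (real (5 * q * n) * 64 * (C0 * (real p)\<^sup>2)) \<le> s1\<^sup>2" .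
  have s1_pos: "s1 > 0" unfolding s1_def using a1 np by (intro divide_pos_pos add_pos_nonneg) auto
  have edge: "\<bar>expectation (\<lambda>\<omega>. cos (combo n \<gamma> \<omega> + \<phi>)) -
      expectation (\<lambda>\<omega>. cos (hybrid n \<gamma> (int n + 1) \<omega> + \<phi>))\<bar> \<le> real q * s1"
    by (rule combo_near_hybrid[OF n _ s1_pos s1 p]) (rule \<gamma>)
  define B where "B = 9 * ((real q * \<kappa>) ^ 4 * (C0 * (real p)\<^sup>2)\<^sup>2)"
  \<comment> \<open>The order n^(-1/2) is that of a row in the fourth mean, and it makes n d^3 of
    order n^(-1/2). The power q^8 combines q^4 from \<open>form_fourth\<close> with q^4 for the rows
    of the window.\<close>
  define d where "d = (1 + 144 * real q ^ 8 * \<kappa>0 ^ 4 * C0\<^sup>2) / sqrt (real n)"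
  have a2: "0 \<le> 144 * real q ^ 8 * \<kappa>0 ^ 4 * C0\<^sup>2" by simp
  have d_pos: "d > 0" unfolding d_def using a2 np by (intro divide_pos_pos add_pos_nonneg) auto
  have d4: "144 * real q ^ 8 * \<kappa>0 ^ 4 * C0\<^sup>2 / (real n)\<^sup>2 \<le> d ^ 4"
  proof -
    have "144 * real q ^ 8 * \<kappa>0 ^ 4 * C0\<^sup>2 \<le> (1 + 144 * real q ^ 8 * \<kappa>0 ^ 4 * C0\<^sup>2) ^ 1" using a2 by simp
    also have "\<dots> \<le> (1 + 144 * real q ^ 8 * \<kappa>0 ^ 4 * C0\<^sup>2) ^ 4" using a2 by (intro power_increasing) auto
    finally have "144 * real q ^ 8 * \<kappa>0 ^ 4 * C0\<^sup>2 / (real n)\<^sup>2 \<le> (1 + 144 * real q ^ 8 * \<kappa>0 ^ 4 * C0\<^sup>2) ^ 4 / (real n)\<^sup>2"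
      by (rule divide_right_mono) simp
    also have "\<dots> = d ^ 4"
      using np power_mult[of "sqrt (real n)" 2 2] by (simp add: d_def power_divide)
    finally show ?thesis .
  qed
  have Bn: "16 * (real n)\<^sup>2 * B = 144 * real q ^ 4 * \<kappa>0 ^ 4 * C0\<^sup>2 / (real n)\<^sup>2"
    unfolding B_def \<kappa>_def using np by (simp add: field_simps power2_eq_square power4_eq_xxxx)
  have d2: "real q ^ 4 * (16 * (real n)\<^sup>2 * B) \<le> d ^ 4"
  proof -
    have "real q ^ 4 * (16 * (real n)\<^sup>2 * B) = 144 * real q ^ 8 * \<kappa>0 ^ 4 * C0\<^sup>2 / (real n)\<^sup>2"
      unfolding Bn by (simp add: power_add[of _ 4 4, simplified])
    with d4 show ?thesis by simp
  qed
  have d1: "16 * (real n)\<^sup>2 * B \<le> d ^ 4"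
  proof -
    have "1 * (16 * (real n)\<^sup>2 * B) \<le> real q ^ 4 * (16 * (real n)\<^sup>2 * B)"
      using np by (intro mult_right_mono one_le_power) (auto simp: B_def)
    with d2 show ?thesis by simp
  qed
  have lind: "\<bar>expectation (\<lambda>\<omega>. cos (hybrid n \<gamma> (int n + 1) \<omega> + \<phi>)) - expectation (\<lambda>\<omega>. cos (hybrid n \<gamma> (int q + 1) \<omega> + \<phi>))\<bar> \<le>
      8 * real n * d ^ 3"
  proof (rule lindeberg[OF _ d_pos d1 d2])
    show "expectation (\<lambda>\<omega>. form \<gamma> b s b' t \<omega> ^ 4) \<le> B" if "\<bar>s - t\<bar> > int q" for b s b' t
      unfolding B_def by (rule form_fourth[OF that]) (rule \<gamma>)
  qed
  have nd: "8 * real n * d ^ 3 = 8 * (1 + 144 * real q ^ 8 * \<kappa>0 ^ 4 * C0\<^sup>2) ^ 3 / sqrt (real n)"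
  proof -
    have "8 * (r * r) * (a / r) ^ 3 = 8 * a ^ 3 / r" if "r > 0" for a r :: real
      using that by (simp add: power3_eq_cube field_simps)
    from this[of "sqrt (real n)"] show ?thesis using np by (simp add: d_def)
  qed
  define s3 where "s3 = (1 + real (q + 1) * real q * \<kappa>0\<^sup>2 * C2 ^ 4) / sqrt (real n)"
  have a3: "0 \<le> real (q + 1) * real q * \<kappa>0\<^sup>2 * C2 ^ 4" by simp
  have s3_pos: "s3 > 0" unfolding s3_def using a3 np by (intro divide_pos_pos add_pos_nonneg) auto
  have "real (n * (q + 1) * (q * p * p)) * (\<kappa> * C2\<^sup>2)\<^sup>2 = (real (q + 1) * real q * \<kappa>0\<^sup>2 * C2 ^ 4) / real n"
    unfolding \<kappa>_def using np by (simp add: field_simps power2_eq_square power4_eq_xxxx)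
  also have "\<dots> \<le> (1 + real (q + 1) * real q * \<kappa>0\<^sup>2 * C2 ^ 4)\<^sup>2 / real n"
    using np by (intro divide_right_mono le_square_1_plus[OF a3]) auto
  also have "\<dots> = s3\<^sup>2" by (simp add: s3_def power_divide)
  finally have s3: "real (n * (q + 1) * (q * p * p)) * (\<kappa> * C2\<^sup>2)\<^sup>2 \<le> s3\<^sup>2" .
  have V: "vr a \<le> C2\<^sup>2" if "a \<in> idx" for a
    using that C2 lam_nonneg C2_0 by (auto simp: idx_def vr_def power2_eq_square intro!: mult_mono)
  have qn: "q < n" using n by simp
  have gauss: "\<bar>expectation (\<lambda>\<omega>. cos (hybrid n \<gamma> (int q + 1) \<omega> + \<phi>)) -
      Re (iexp \<phi> * (\<Prod>a\<in>idx. chi_cf (\<gamma> (fst a) * vr a * real (n - q) / 2)))\<bar> \<le> s3"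
    by (rule gaussian_end[OF qn _ _ s3_pos s3]) (rule \<gamma> V, assumption)+
  note dm = dev_second_moment[OF n2 p c]
  have cm: "integrable P (\<lambda>\<omega>. (combo n \<gamma> \<omega>)\<^sup>2)"
    "expectation (\<lambda>\<omega>. (combo n \<gamma> \<omega>)\<^sup>2) \<le> 16 * (real q)\<^sup>2 * (\<kappa> * (real n * real p))\<^sup>2 * C0"
    by (rule combo_second_moment[OF n _ p], rule \<gamma>, assumption)+
  \<comment> \<open>This value of \<open>r\<close> in \<open>slutsky\<close> balances the bounded
    second moment of \<open>combo\<close> against that of \<open>dev\<close>, which is of order
    1/n.\<close>
  have r: "1 / sqrt (real n) > 0" using np by simp
  have slut: "\<bar>expectation (\<lambda>\<omega>. cos (combo n \<gamma> \<omega> / (1 + dev n \<omega>) + \<phi>)) - expectation (\<lambda>\<omega>. cos (combo n \<gamma> \<omega> + \<phi>))\<bar> \<le>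
      (16 * (real q)\<^sup>2 * \<kappa>0\<^sup>2 * C0 + 72 * C0 / c\<^sup>2) / sqrt (real n)"
  proof -
    have "\<bar>expectation (\<lambda>\<omega>. cos (combo n \<gamma> \<omega> / (1 + dev n \<omega>) + \<phi>)) - expectation (\<lambda>\<omega>. cos (combo n \<gamma> \<omega> + \<phi>))\<bar> \<le>
        1 / sqrt (real n) * expectation (\<lambda>\<omega>. (combo n \<gamma> \<omega>)\<^sup>2) + expectation (\<lambda>\<omega>. (dev n \<omega>)\<^sup>2) / (1 / sqrt (real n)) +
        8 * expectation (\<lambda>\<omega>. (dev n \<omega>)\<^sup>2)"
      by (rule slutsky[OF r cm(1) dm(1)])
    also have "\<dots> \<le> 1 / sqrt (real n) * (16 * (real q)\<^sup>2 * (\<kappa> * (real n * real p))\<^sup>2 * C0) +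
        (8 * C0 / c\<^sup>2 / real n) / (1 / sqrt (real n)) + 8 * (8 * C0 / c\<^sup>2 / real n)"
      using r by (intro add_mono mult_left_mono divide_right_mono cm(2) dm(2)) auto
    also have "\<kappa> * (real n * real p) = \<kappa>0" using np by (simp add: \<kappa>_def)
    also have "(8 * C0 / c\<^sup>2 / real n) / (1 / sqrt (real n)) = (8 * C0 / c\<^sup>2) / sqrt (real n)"
    proof -
      have "x / (r * r) / (1 / r) = x / r" if "r > 0" for x r :: real
        using that by (simp add: field_simps)
      from this[of "sqrt (real n)" "8 * C0 / c\<^sup>2"] show ?thesis using np by simp
    qed
    also have "8 * (8 * C0 / c\<^sup>2 / real n) \<le> (64 * C0 / c\<^sup>2) / sqrt (real n)"
    proof -
      have "sqrt (real n) \<le> real n" using np by (intro real_le_lsqrt) (auto simp: power2_eq_square)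
      then have "(64 * C0 / c\<^sup>2) / real n \<le> (64 * C0 / c\<^sup>2) / sqrt (real n)"
        using np C0 by (intro divide_left_mono) auto
      then show ?thesis by simp
    qed
    finally show ?thesis by (simp add: add_divide_distrib add.commute mult.commute)
  qed
  have tri: "\<bar>a - e\<bar> \<le> x4 + x1 + x2 + x3"
    if "\<bar>a - b\<bar> \<le> x4" "\<bar>b - c'\<bar> \<le> x1" "\<bar>c' - d'\<bar> \<le> x2" "\<bar>d' - e\<bar> \<le> x3" for a b c' d' e x1 x2 x3 x4 :: real
    using that by linarith
  have "\<bar>expectation (\<lambda>\<omega>. cos (combo n \<gamma> \<omega> / (1 + dev n \<omega>) + \<phi>)) -
    Re (iexp \<phi> * (\<Prod>a\<in>idx. chi_cf (\<gamma> (fst a) * vr a * real (n - q) / 2)))\<bar> \<le>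
    (16 * (real q)\<^sup>2 * \<kappa>0\<^sup>2 * C0 + 72 * C0 / c\<^sup>2) / sqrt (real n) + real q * s1 +
    8 * (1 + 144 * real q ^ 8 * \<kappa>0 ^ 4 * C0\<^sup>2) ^ 3 / sqrt (real n) + s3"
    by (rule tri[OF slut edge lind[unfolded nd] gauss])
  also have "\<dots> = clt_rate q C0 C2 c \<Theta> / sqrt (real n)"
    by (simp add: clt_rate_def Let_def \<kappa>0_def[symmetric] s1_def s3_def add_divide_distrib[symmetric])
  finally show ?thesis
    unfolding H_stat_combination[OF n2 S, of \<gamma> \<theta>, OF \<gamma>_def[THEN fun_cong]] by (simp only: \<gamma>_def)
qed

end

section \<open>Limits of the characteristic functions\<close>

lemma chi_cf_eq_char: "chi_cf x = char (distr std_normal_distribution borel (\<lambda>g. g\<^sup>2 - 1)) x"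
  unfolding chi_cf_def char_def by (subst integral_distr) auto

lemma real_distribution_chi: "real_distribution (distr std_normal_distribution borel (\<lambda>g. g\<^sup>2 - 1))"
proof -
  interpret real_distribution std_normal_distribution by (rule real_dist_normal_dist)
  show ?thesis by (rule real_distribution_distr) simp
qed

lemma isCont_chi_cf: "isCont chi_cf x"
proof -
  interpret real_distribution "distr std_normal_distribution borel (\<lambda>g. g\<^sup>2 - 1)"
    by (rule real_distribution_chi)
  have "chi_cf = char (distr std_normal_distribution borel (\<lambda>g. g\<^sup>2 - 1))"
    by (rule ext) (rule chi_cf_eq_char)
  then show ?thesis using isCont_char by simp
qed

lemma norm_chi_cf_le: "norm (chi_cf x) \<le> 1"
  unfolding chi_cf_eq_char by (rule real_distribution.cmod_char_le_1[OF real_distribution_chi])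

text \<open>The square of a standard normal variable has variance 2, so that \<open>chi_cf\<close>
  expands as 1 - x^2 with an error of third order, and exp (- x^2) agrees with this up to
  x^4.\<close>

lemma chi_cf_approx: "\<exists>C\<ge>0. \<forall>x. \<bar>x\<bar> \<le> 1 \<longrightarrow> norm (chi_cf x - of_real (exp (- x\<^sup>2))) \<le> C * \<bar>x\<bar> ^ 3"
proof -
  let ?\<mu> = "std_normal_distribution"
  interpret real_distribution ?\<mu> by (rule real_dist_normal_dist)
  note mi = integrable_std_normal_distribution_moment
  have m: "expectation (\<lambda>g. g\<^sup>2) = 1" "expectation (\<lambda>g. g ^ 4) = 3"
    using std_normal_distribution_even_moments(1)[of 1] std_normal_distribution_even_moments(1)[of 2]
    by (simp_all add: fact_numeral)
  let ?X = "\<lambda>g :: real. g\<^sup>2 - 1"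
  have X1: "integrable ?\<mu> ?X" "expectation ?X = 0"
    using mi[of 2] m(1) prob_space by auto
  have X2eq: "(\<lambda>g. (?X g)\<^sup>2) = (\<lambda>g. g ^ 4 - 2 * g\<^sup>2 + 1)"
    by (rule ext) (simp add: power2_eq_square power4_eq_xxxx algebra_simps)
  have X2: "integrable ?\<mu> (\<lambda>g. (?X g)\<^sup>2)" "expectation (\<lambda>g. (?X g)\<^sup>2) = 2"
    unfolding X2eq using mi[of 2] mi[of 4] m prob_space by auto
  have var: "variance ?X = 2" unfolding X1(2) using X2(2) by simp
  have X3: "integrable ?\<mu> (\<lambda>g. \<bar>?X g\<bar> ^ 3)"
  proof -
    have "(\<lambda>g :: real. (?X g) ^ 3) = (\<lambda>g. g ^ 6 - 3 * g ^ 4 + 3 * g\<^sup>2 - 1)"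
      by (rule ext) (simp add: power2_eq_square power3_eq_cube eval_nat_numeral algebra_simps)
    then have "integrable ?\<mu> (\<lambda>g. (?X g) ^ 3)" using mi[of 6] mi[of 4] mi[of 2] by auto
    from integrable_abs[OF this] show ?thesis by (simp add: power_abs)
  qed
  define C where "C = expectation (\<lambda>g. \<bar>?X g\<bar> ^ 3)"
  have C: "0 \<le> C" unfolding C_def by (rule Bochner_Integration.integral_nonneg) simp
  have "norm (chi_cf x - of_real (exp (- x\<^sup>2))) \<le> (C + 1) * \<bar>x\<bar> ^ 3" if x: "\<bar>x\<bar> \<le> 1" for x
  proof -
    have "cmod (char (distr ?\<mu> borel ?X) x - (1 - x\<^sup>2 * 2 / 2)) \<le>
        (x\<^sup>2 / 6) * expectation (\<lambda>g. min (6 * (?X g)\<^sup>2) (\<bar>x\<bar> * \<bar>?X g\<bar> ^ 3))"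
      by (rule char_approx3'[OF _ X1(1) X2(1) X1(2) var refl]) simp
    also have "\<dots> \<le> (x\<^sup>2 / 6) * expectation (\<lambda>g. \<bar>x\<bar> * \<bar>?X g\<bar> ^ 3)"
    proof (intro mult_left_mono integral_mono)
      show "integrable ?\<mu> (\<lambda>g. min (6 * (?X g)\<^sup>2) (\<bar>x\<bar> * \<bar>?X g\<bar> ^ 3))"
        using X2(1) X3 by (intro integrable_min) auto
    qed (use X3 in auto)
    also have "\<dots> = \<bar>x\<bar> ^ 3 * C / 6"
      using X3 by (simp add: C_def power3_eq_cube power2_eq_square)
    also have "\<dots> \<le> C * \<bar>x\<bar> ^ 3" using C by (simp add: field_simps)
    finally have 1: "norm (chi_cf x - of_real (1 - x\<^sup>2)) \<le> C * \<bar>x\<bar> ^ 3"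
      by (simp add: chi_cf_eq_char)
    \<comment> \<open>With y = x^2 this rests on 1 - y <= exp (- y) <= 1 / (1 + y) <= 1 - y +
      y^2.\<close>
    have 2: "norm (complex_of_real (1 - x\<^sup>2) - of_real (exp (- x\<^sup>2))) \<le> \<bar>x\<bar> ^ 3"
    proof -
      have x2: "0 \<le> x\<^sup>2" "x\<^sup>2 \<le> 1" using x by (auto simp: abs_square_le_1)
      have lo: "1 - x\<^sup>2 \<le> exp (- x\<^sup>2)" using exp_ge_add_one_self[of "- x\<^sup>2"] by simp
      have "exp (- x\<^sup>2) * (1 + x\<^sup>2) \<le> exp (- x\<^sup>2) * exp (x\<^sup>2)"
        by (intro mult_left_mono exp_ge_add_one_self) auto
      then have "exp (- x\<^sup>2) * (1 + x\<^sup>2) \<le> 1" by (simp add: exp_minus)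
      then have "exp (- x\<^sup>2) \<le> 1 / (1 + x\<^sup>2)" 
        using x2 by (subst pos_le_divide_eq) linarith+
      also have "\<dots> \<le> 1 - x\<^sup>2 + x ^ 4"
      proof -
        have "1 / (1 + y) \<le> 1 - y + y\<^sup>2" if "y \<ge> 0" for y :: real
        proof -
          have "(1 - y + y\<^sup>2) * (1 + y) = 1 + y ^ 3"
            by (simp add: power2_eq_square power3_eq_cube algebra_simps)
          then have "1 \<le> (1 - y + y\<^sup>2) * (1 + y)" using that by simp
          then show ?thesis using that by (subst pos_divide_le_eq) auto
        qed
        from this[OF x2(1)] show ?thesis by simp
      qed
      finally have "\<bar>(1 - x\<^sup>2) - exp (- x\<^sup>2)\<bar> \<le> x ^ 4" using lo by simp
      also have "x ^ 4 = \<bar>x\<bar> ^ 4" by simp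
      also have "\<dots> \<le> \<bar>x\<bar> ^ 3" using x by (intro power_decreasing) auto
      finally show ?thesis unfolding of_real_diff[symmetric] norm_of_real .
    qed
    have "norm (chi_cf x - of_real (exp (- x\<^sup>2))) \<le>
        norm (chi_cf x - of_real (1 - x\<^sup>2)) + norm (complex_of_real (1 - x\<^sup>2) - of_real (exp (- x\<^sup>2)))"
      using norm_triangle_ineq[of "chi_cf x - of_real (1 - x\<^sup>2)" "complex_of_real (1 - x\<^sup>2) - of_real (exp (- x\<^sup>2))"]
      by simp
    with 1 2 show ?thesis by (simp add: distrib_right)
  qed
  then show ?thesis using C by (intro exI[of _ "C + 1"]) auto
qed

text \<open>This is how the normal law arises when the weights become small. All factors have
  modulus at most 1, so the errors of the factors add up to at most a constant times the sum of
  |x|^3, hence to at most a constant times \<open>m n\<close> times the convergent sum of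
  squares.\<close>

lemma chi_cf_prod_tendsto:
  fixes x :: "nat \<Rightarrow> 'i \<Rightarrow> real" and m :: "nat \<Rightarrow> real"
  assumes fin: "\<And>n. finite (A n)"
    and sq: "(\<lambda>n. \<Sum>a\<in>A n. (x n a)\<^sup>2) \<longlonglongrightarrow> v"
    and sup: "\<And>n a. a \<in> A n \<Longrightarrow> \<bar>x n a\<bar> \<le> m n" "m \<longlonglongrightarrow> 0"
  shows "(\<lambda>n. \<Prod>a\<in>A n. chi_cf (x n a)) \<longlonglongrightarrow> of_real (exp (- v))"
proof -
  obtain C where C: "C \<ge> 0" "\<And>x. \<bar>x\<bar> \<le> 1 \<Longrightarrow> norm (chi_cf x - of_real (exp (- x\<^sup>2))) \<le> C * \<bar>x\<bar> ^ 3"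
    using chi_cf_approx by blast
  have m1: "\<forall>\<^sub>F n in sequentially. m n < 1"
    by (rule order_tendstoD(2)[OF sup(2)]) simp
  have ev: "\<forall>\<^sub>F n in sequentially. norm ((\<Prod>a\<in>A n. chi_cf (x n a)) - (\<Prod>a\<in>A n. of_real (exp (- (x n a)\<^sup>2)))) \<le>
      C * (m n * (\<Sum>a\<in>A n. (x n a)\<^sup>2))"
    using m1
  proof eventually_elim
    case (elim n)
    have "norm ((\<Prod>a\<in>A n. chi_cf (x n a)) - (\<Prod>a\<in>A n. of_real (exp (- (x n a)\<^sup>2)))) \<le>
        (\<Sum>a\<in>A n. norm (chi_cf (x n a) - of_real (exp (- (x n a)\<^sup>2))))"
      by (rule norm_prod_diff) (auto simp: norm_chi_cf_le)
    also have "\<dots> \<le> (\<Sum>a\<in>A n. C * (m n * (x n a)\<^sup>2))"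
    proof (rule sum_mono)
      fix a assume a: "a \<in> A n"
      have "norm (chi_cf (x n a) - of_real (exp (- (x n a)\<^sup>2))) \<le> C * \<bar>x n a\<bar> ^ 3"
        using sup(1)[OF a] elim by (intro C) linarith
      also have "\<bar>x n a\<bar> ^ 3 = \<bar>x n a\<bar> * (x n a)\<^sup>2" by (simp add: power3_eq_cube power2_eq_square)
      also have "C * (\<bar>x n a\<bar> * (x n a)\<^sup>2) \<le> C * (m n * (x n a)\<^sup>2)"
        using C(1) sup(1)[OF a] by (intro mult_left_mono mult_right_mono) auto
      finally show "norm (chi_cf (x n a) - of_real (exp (- (x n a)\<^sup>2))) \<le> C * (m n * (x n a)\<^sup>2)" .
    qed
    also have "\<dots> = C * (m n * (\<Sum>a\<in>A n. (x n a)\<^sup>2))" by (simp add: sum_distrib_left)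
    finally show ?case .
  qed
  have "(\<lambda>n. C * (m n * (\<Sum>a\<in>A n. (x n a)\<^sup>2))) \<longlonglongrightarrow> C * (0 * v)"
    by (intro tendsto_intros sup sq)
  then have "(\<lambda>n. (\<Prod>a\<in>A n. chi_cf (x n a)) - (\<Prod>a\<in>A n. of_real (exp (- (x n a)\<^sup>2)))) \<longlonglongrightarrow> 0"
    using Lim_null_comparison[OF ev] by simp
  moreover have "(\<lambda>n. \<Prod>a\<in>A n. complex_of_real (exp (- (x n a)\<^sup>2))) \<longlonglongrightarrow> of_real (exp (- v))"
  proof -
    have "(\<Prod>a\<in>A n. complex_of_real (exp (- (x n a)\<^sup>2))) = of_real (exp (- (\<Sum>a\<in>A n. (x n a)\<^sup>2)))" for n
      unfolding of_real_prod[symmetric] sum_negf[symmetric] by (simp add: exp_sum[OF fin])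
    then show ?thesis by (simp del: of_real_prod) (intro tendsto_intros sq)
  qed
  ultimately show ?thesis using tendsto_add by fastforce
qed

section \<open>A probability space that carries noise and Gaussian variables\<close>

text \<open>\<open>F J\<close> is generated by the restriction to the coordinates in
  \<open>J\<close>. Monotonicity then comes from composing restrictions, and independence from that
  of disjoint blocks of coordinates.\<close>

lemma indep_fields_PiM:
  fixes Mi :: "'j \<Rightarrow> 'v measure"
  assumes Mi: "\<And>i. prob_space (Mi i)"
  shows "indep_fields (PiM UNIV Mi) (\<lambda>J. vimage_algebra (space (PiM UNIV Mi)) (\<lambda>\<omega>. restrict \<omega> J) (PiM J Mi))"
proof -
  let ?P = "PiM UNIV Mi"
  interpret prob_space ?P by (rule prob_space_PiM) (rule Mi)
  have rm: "(\<lambda>\<omega>. restrict \<omega> J) \<in> measurable (PiM K Mi) (PiM J Mi)" if "J \<subseteq> K" for J K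
    by (rule measurable_restrict_subset[OF that])
  have rs: "(\<lambda>\<omega>. restrict \<omega> J) \<in> space ?P \<rightarrow> space (PiM J Mi)" for J
    using measurable_space[OF rm[of J UNIV]] by auto
  note sets = sets_vimage_algebra2[OF rs]
  have coord: "indep_vars Mi (\<lambda>i \<omega>. \<omega> i) UNIV"
  proof (subst indep_vars_iff_distr_eq_PiM)
    have "distr ?P ?P (\<lambda>\<omega>. \<lambda>i\<in>UNIV. \<omega> i) = ?P" by (simp add: restrict_UNIV distr_id2)
    moreover have "distr ?P (Mi i) (\<lambda>\<omega>. \<omega> i) = Mi i" for i
      by (rule distr_PiM_component) (auto intro: Mi)
    ultimately show "distr ?P (PiM UNIV Mi) (\<lambda>\<omega>. \<lambda>i\<in>UNIV. \<omega> i) = PiM UNIV (\<lambda>i. distr ?P (Mi i) (\<lambda>\<omega>. \<omega> i))"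
      by simp
  qed auto
  show ?thesis
  proof
    fix J K :: "'j set"
    show "space (vimage_algebra (space ?P) (\<lambda>\<omega>. restrict \<omega> J) (PiM J Mi)) = space ?P" by simp
    show "sets (vimage_algebra (space ?P) (\<lambda>\<omega>. restrict \<omega> J) (PiM J Mi)) \<subseteq> sets ?P"
      unfolding sets using measurable_sets[OF rm[of J UNIV]] by auto
    show "sets (vimage_algebra (space ?P) (\<lambda>\<omega>. restrict \<omega> J) (PiM J Mi)) \<subseteq>
        sets (vimage_algebra (space ?P) (\<lambda>\<omega>. restrict \<omega> K) (PiM K Mi))" if JK: "J \<subseteq> K"
    proof
      fix A assume "A \<in> sets (vimage_algebra (space ?P) (\<lambda>\<omega>. restrict \<omega> J) (PiM J Mi))"
      then obtain B where B: "B \<in> sets (PiM J Mi)" "A = (\<lambda>\<omega>. restrict \<omega> J) -` B \<inter> space ?P"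
        unfolding sets by auto
      let ?C = "(\<lambda>\<omega>. restrict \<omega> J) -` B \<inter> space (PiM K Mi)"
      have "A = (\<lambda>\<omega>. restrict \<omega> K) -` ?C \<inter> space ?P"
        using B(2) rs[of K] JK by (auto simp: Int_absorb1)
      moreover have "?C \<in> sets (PiM K Mi)" by (rule measurable_sets[OF rm[OF JK] B(1)])
      ultimately show "A \<in> sets (vimage_algebra (space ?P) (\<lambda>\<omega>. restrict \<omega> K) (PiM K Mi))"
        unfolding sets by (intro CollectI exI[of _ ?C] conjI)
    qed
    show "indep_set (sets (vimage_algebra (space ?P) (\<lambda>\<omega>. restrict \<omega> J) (PiM J Mi)))
        (sets (vimage_algebra (space ?P) (\<lambda>\<omega>. restrict \<omega> K) (PiM K Mi)))" if JK: "J \<inter> K = {}"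
    proof -
      have "indep_var (PiM J Mi) (\<lambda>\<omega>. restrict \<omega> J) (PiM K Mi) (\<lambda>\<omega>. restrict \<omega> K)"
        using indep_var_restrict[OF coord JK] by (simp add: restrict_def)
      then have "indep_set (sigma_sets (space ?P) {(\<lambda>\<omega>. restrict \<omega> J) -` A \<inter> space ?P |A. A \<in> sets (PiM J Mi)})
         (sigma_sets (space ?P) {(\<lambda>\<omega>. restrict \<omega> K) -` A \<inter> space ?P |A. A \<in> sets (PiM K Mi)})"
        unfolding indep_var_eq by simp
      then show ?thesis unfolding indep_set_def
        by (rule indep_sets_mono_sets) (auto simp: sets split: bool.split intro: sigma_sets.Basic)
    qed
  qed
qed

lemma coordinate_measurable_field:
  assumes "i \<in> J"
  shows "(\<lambda>\<omega>. \<omega> i) \<in> measurable (vimage_algebra (space (PiM UNIV Mi)) (\<lambda>\<omega>. restrict \<omega> J) (PiM J Mi)) (Mi i)"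
proof -
  have "(\<lambda>\<omega>. restrict \<omega> J) \<in> space (PiM UNIV Mi) \<rightarrow> space (PiM J Mi)"
    using measurable_space[OF measurable_restrict_subset[of J UNIV Mi]] by auto
  from measurable_compose[OF measurable_vimage_algebra1[OF this] measurable_component_singleton[OF assms]]
  show ?thesis using assms by simp
qed

section \<open>Rotation of the noise to its principal axes\<close>

lemma mat_trace_square:
  fixes A :: "real mat"
  assumes A: "A \<in> carrier_mat k k" and U: "U \<in> carrier_mat k k" "transpose_mat U * U = 1\<^sub>m k"
    and D: "transpose_mat U * A * U = mat k k (\<lambda>(i, j). if i = j then l i else 0)"
  shows "mat_trace (A ^\<^sub>m 2) = (\<Sum>i<k. (l i)\<^sup>2)"
proof -
  let ?Ut = "transpose_mat U"
  have Ut: "?Ut \<in> carrier_mat k k" using U by simp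
  have UU: "U * ?Ut = 1\<^sub>m k" by (rule mat_mult_left_right_inverse[OF Ut U])
  have A2: "A ^\<^sub>m 2 = A * A" using A by (simp add: numeral_2_eq_2)
  have AA: "A * A \<in> carrier_mat k k" using A by simp
  have DD: "(?Ut * A * U) * (?Ut * A * U) = ?Ut * ((A * A) * U)"
  proof -
    have "(?Ut * A * U) * (?Ut * A * U) = ?Ut * (A * ((U * ?Ut) * (A * U)))"
      using A U Ut by (simp add: assoc_mult_mat[of _ k k _ k _ k])
    then show ?thesis unfolding UU using A U by (simp add: assoc_mult_mat[of _ k k _ k _ k])
  qed
  have cyc: "mat_trace (X * Y) = mat_trace (Y * X)" if "X \<in> carrier_mat k k" "Y \<in> carrier_mat k k" for X Y :: "real mat"
  proof -
    have "mat_trace (X * Y) = (\<Sum>i<k. \<Sum>j<k. X $$ (i, j) * Y $$ (j, i))"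
      using that by (simp add: mat_trace_def scalar_prod_def atLeast0LessThan)
    also have "\<dots> = (\<Sum>j<k. \<Sum>i<k. Y $$ (j, i) * X $$ (i, j))"
      by (subst sum.swap) (simp add: mult.commute)
    also have "\<dots> = mat_trace (Y * X)"
      using that by (simp add: mat_trace_def scalar_prod_def atLeast0LessThan)
    finally show ?thesis .
  qed
  have "mat_trace (A * A) = mat_trace (((A * A) * U) * ?Ut)"
    using A U Ut UU by (simp add: assoc_mult_mat[of _ k k _ k _ k])
  also have "\<dots> = mat_trace (?Ut * ((A * A) * U))" using AA U Ut by (intro cyc) auto
  also have "\<dots> = mat_trace (mat k k (\<lambda>(i, j). if i = j then l i else 0) * mat k k (\<lambda>(i, j). if i = j then l i else 0))"
    unfolding DD[symmetric] D ..
  also have "\<dots> = (\<Sum>i<k. (l i)\<^sup>2)"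
  proof -
    have "(\<Sum>j<k. (if i = j then l i else 0) * (if j = i then l j else 0)) = (l i)\<^sup>2" if "i < k" for i
    proof -
      have "(\<Sum>j<k. (if i = j then l i else 0) * (if j = i then l j else 0)) = (\<Sum>j<k. if i = j then (l i)\<^sup>2 else 0)"
        by (intro sum.cong) (auto simp: power2_eq_square)
      then show ?thesis using that by simp
    qed
    then show ?thesis by (simp add: mat_trace_def scalar_prod_def atLeast0LessThan)
  qed
  finally show ?thesis unfolding A2 .
qed

locale white_noise = prob_space M for M :: "'a measure" +
  fixes k :: nat and z :: "int \<Rightarrow> 'a \<Rightarrow> nat \<Rightarrow> real" and \<Sigma> :: "real mat" and lam :: "nat \<Rightarrow> real" and C0 :: real
  assumes indep: "indep_vars (\<lambda>_. vec_space k) (\<lambda>t \<omega>. restrict (z t \<omega>) {..<k}) UNIV"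
    and ident: "\<And>t s. distr M (vec_space k) (\<lambda>\<omega>. restrict (z t \<omega>) {..<k}) =
                  distr M (vec_space k) (\<lambda>\<omega>. restrict (z s \<omega>) {..<k})"
    and mean_zero: "\<And>t i. i < k \<Longrightarrow> integrable M (\<lambda>\<omega>. z t \<omega> i) \<and> (LINT \<omega>|M. z t \<omega> i) = 0"
    and cov: "\<And>t. \<Sigma> = cov_mat M k (z t)"
    and eigenvalues: "ordered_eigenvalues \<Sigma> lam"
    and moment_inner: "\<And>t s. t \<noteq> s \<Longrightarrow> integrable M (\<lambda>\<omega>. (dotp k (z t \<omega>) (z s \<omega>)) ^ 4) \<and>
                  (LINT \<omega>|M. (dotp k (z t \<omega>) (z s \<omega>)) ^ 4) \<le> C0 * (real k)\<^sup>2"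
    and moment_coord: "\<And>t i. i < k \<Longrightarrow> integrable M (\<lambda>\<omega>. (z t \<omega> i) ^ 4)"
begin

lemma z_L4: "i < k \<Longrightarrow> L4 (\<lambda>\<omega>. z t \<omega> i)"
  using mean_zero[of i t] moment_coord[of i t] by (auto simp: L4_def)

lemma Sigma_carrier: "\<Sigma> \<in> carrier_mat k k"
  using cov[of 0] by (simp add: cov_mat_def)

lemma Sigma_entry: "a < k \<Longrightarrow> b < k \<Longrightarrow> \<Sigma> $$ (a, b) = expectation (\<lambda>\<omega>. z t \<omega> a * z t \<omega> b)"
  using mean_zero by (simp add: cov[of t] cov_mat_def)

lemma diagonalization:
  obtains U where "U \<in> carrier_mat k k" "transpose_mat U * U = 1\<^sub>m k"
    "transpose_mat U * \<Sigma> * U = mat k k (\<lambda>(i, j). if i = j then lam i else 0)"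
proof -
  have sym: "transpose_mat \<Sigma> = \<Sigma>"
  proof (rule eq_matI)
    fix i j assume "i < dim_row \<Sigma>" "j < dim_col \<Sigma>"
    then have ij: "i < k" "j < k" using Sigma_carrier by auto
    then show "transpose_mat \<Sigma> $$ (i, j) = \<Sigma> $$ (i, j)"
      using Sigma_carrier Sigma_entry[OF ij, of 0] Sigma_entry[OF ij(2,1), of 0] by (simp add: mult.commute)
  qed (use Sigma_carrier in auto)
  have "char_poly \<Sigma> = (\<Prod>i\<in>set [0..<k]. [:- lam i, 1:])"
    using eigenvalues Sigma_carrier by (simp add: ordered_eigenvalues_def atLeast0LessThan)
  also have "\<dots> = (\<Prod>e\<leftarrow>map lam [0..<k]. [:- e, 1:])"
    by (subst prod.distinct_set_conv_list) (simp_all add: o_def)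
  finally obtain U where U: "U \<in> carrier_mat k k" "transpose_mat U * U = 1\<^sub>m k"
    "transpose_mat U * \<Sigma> * U = mat k k (\<lambda>(i, j). if i = j then map lam [0..<k] ! i else 0)"
    using real_symmetric_diagonalization[OF Sigma_carrier sym] by blast
  have "mat k k (\<lambda>(i, j). if i = j then map lam [0..<k] ! i else 0) = mat k k (\<lambda>(i, j). if i = j then lam i else 0)"
    by (rule eq_matI) auto
  with U show ?thesis using that by simp
qed

lemma trace_eq: "mat_trace (\<Sigma> ^\<^sub>m 2) = (\<Sum>i<k. (lam i)\<^sup>2)"
  by (rule diagonalization) (rule mat_trace_square[OF Sigma_carrier])

lemma lam_le: "i < k \<Longrightarrow> lam i \<le> lam 0"
  using eigenvalues Sigma_carrier by (auto simp: ordered_eigenvalues_def)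

definition rotated :: "real mat \<Rightarrow> int \<Rightarrow> 'a \<Rightarrow> nat \<Rightarrow> real" where
  "rotated U t \<omega> = (\<lambda>i\<in>{..<k}. \<Sum>j<k. U $$ (j, i) * z t \<omega> j)"

lemma dotp_rotated:
  assumes U: "U \<in> carrier_mat k k" "transpose_mat U * U = 1\<^sub>m k"
  shows "dotp k (rotated U s \<omega>) (rotated U t \<omega>) = dotp k (z s \<omega>) (z t \<omega>)"
proof -
  have UU: "U * transpose_mat U = 1\<^sub>m k"
    by (rule mat_mult_left_right_inverse[OF _ U]) (use U in simp)
  have orth: "(\<Sum>i<k. U $$ (a, i) * U $$ (b, i)) = (if a = b then 1 else 0)" if "a < k" "b < k" for a b
  proof -
    have "(\<Sum>i<k. U $$ (a, i) * U $$ (b, i)) = (U * transpose_mat U) $$ (a, b)"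
      using U that by (simp add: scalar_prod_def atLeast0LessThan)
    then show ?thesis unfolding UU using that by simp
  qed
  have "dotp k (rotated U s \<omega>) (rotated U t \<omega>) =
      (\<Sum>i<k. (\<Sum>a<k. U $$ (a, i) * z s \<omega> a) * (\<Sum>b<k. U $$ (b, i) * z t \<omega> b))"
    by (simp add: dotp_def rotated_def)
  also have "\<dots> = (\<Sum>i<k. \<Sum>a<k. \<Sum>b<k. (z s \<omega> a * z t \<omega> b) * (U $$ (a, i) * U $$ (b, i)))"
    unfolding sum_product by (simp add: mult_ac)
  also have "\<dots> = (\<Sum>a<k. \<Sum>i<k. \<Sum>b<k. (z s \<omega> a * z t \<omega> b) * (U $$ (a, i) * U $$ (b, i)))"
    by (rule sum.swap)
  also have "\<dots> = (\<Sum>a<k. \<Sum>b<k. \<Sum>i<k. (z s \<omega> a * z t \<omega> b) * (U $$ (a, i) * U $$ (b, i)))"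
    by (intro sum.cong refl sum.swap)
  also have "\<dots> = (\<Sum>a<k. \<Sum>b<k. (z s \<omega> a * z t \<omega> b) * (if a = b then 1 else 0))"
    by (intro sum.cong refl) (simp add: sum_distrib_left[symmetric] orth)
  also have "\<dots> = dotp k (z s \<omega>) (z t \<omega>)"
  proof -
    have "(\<Sum>b<k. (z s \<omega> a * z t \<omega> b) * (if a = b then 1 else 0)) = z s \<omega> a * z t \<omega> a" if "a < k" for a
    proof -
      have "(\<Sum>b<k. (z s \<omega> a * z t \<omega> b) * (if a = b then 1 else 0)) = (\<Sum>b<k. if a = b then z s \<omega> a * z t \<omega> a else 0)"
        by (intro sum.cong) auto
      then show ?thesis using that by simp
    qed
    then show ?thesis by (simp add: dotp_def)
  qed
  finally show ?thesis .
qed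

lemma H_stat_rotated:
  assumes U: "U \<in> carrier_mat k k" "transpose_mat U * U = 1\<^sub>m k"
  shows "H_stat k n \<tau> (\<lambda>t. rotated U t \<omega>) = H_stat k n \<tau> (\<lambda>t. z t \<omega>)"
  by (simp add: H_stat_def G_stat_def sigma_hat_def dotp_rotated[OF U])

lemma rotated_L4: "i < k \<Longrightarrow> L4 (\<lambda>\<omega>. rotated U t \<omega> i)"
  by (simp add: rotated_def) (intro L4_sum L4_cmult z_L4, simp)

lemma rotated_mean: "i < k \<Longrightarrow> expectation (\<lambda>\<omega>. rotated U t \<omega> i) = 0"
  using mean_zero by (simp add: rotated_def Bochner_Integration.integral_sum)

lemma rotated_cov:
  assumes U: "U \<in> carrier_mat k k"
    and D: "transpose_mat U * \<Sigma> * U = mat k k (\<lambda>(i, j). if i = j then lam i else 0)"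
    and ij: "i < k" "j < k"
  shows "expectation (\<lambda>\<omega>. rotated U t \<omega> i * rotated U t \<omega> j) = (if i = j then lam i else 0)"
proof -
  have int: "integrable M (\<lambda>\<omega>. z t \<omega> a * z t \<omega> b)" if "a < k" "b < k" for a b
    by (rule L4_integrable_mult[OF z_L4[OF that(1)] z_L4[OF that(2)]])
  have "expectation (\<lambda>\<omega>. rotated U t \<omega> i * rotated U t \<omega> j) =
      expectation (\<lambda>\<omega>. \<Sum>a<k. \<Sum>b<k. (U $$ (a, i) * U $$ (b, j)) * (z t \<omega> a * z t \<omega> b))"
    using ij by (simp add: rotated_def sum_product mult_ac)
  also have "\<dots> = (\<Sum>a<k. \<Sum>b<k. (U $$ (a, i) * U $$ (b, j)) * expectation (\<lambda>\<omega>. z t \<omega> a * z t \<omega> b))"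
  proof -
    have i: "integrable M (\<lambda>\<omega>. (U $$ (a, i) * U $$ (b, j)) * (z t \<omega> a * z t \<omega> b))" if "a \<in> {..<k}" "b \<in> {..<k}" for a b
      using that by (intro integrable_mult_right int) auto
    have "expectation (\<lambda>\<omega>. \<Sum>a<k. \<Sum>b<k. (U $$ (a, i) * U $$ (b, j)) * (z t \<omega> a * z t \<omega> b)) =
        (\<Sum>a<k. expectation (\<lambda>\<omega>. \<Sum>b<k. (U $$ (a, i) * U $$ (b, j)) * (z t \<omega> a * z t \<omega> b)))"
      by (intro Bochner_Integration.integral_sum Bochner_Integration.integrable_sum i)
    also have "\<dots> = (\<Sum>a<k. \<Sum>b<k. expectation (\<lambda>\<omega>. (U $$ (a, i) * U $$ (b, j)) * (z t \<omega> a * z t \<omega> b)))"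
      by (intro sum.cong refl Bochner_Integration.integral_sum i)
    finally show ?thesis by simp
  qed
  also have "\<dots> = (\<Sum>a<k. \<Sum>b<k. U $$ (a, i) * \<Sigma> $$ (a, b) * U $$ (b, j))"
    by (intro sum.cong refl) (simp add: Sigma_entry[of _ _ t])
  also have "\<dots> = (transpose_mat U * \<Sigma> * U) $$ (i, j)"
    using U Sigma_carrier ij by (simp add: scalar_prod_def atLeast0LessThan sum_distrib_left mult.assoc)
  finally show ?thesis unfolding D using ij by simp
qed

end

section \<open>Transfer to a product space\<close>

lemma measurable_PiM_coordinate:
  "i < k \<Longrightarrow> (\<lambda>x :: int \<Rightarrow> nat \<Rightarrow> real. x t i) \<in> borel_measurable (PiM UNIV (\<lambda>_. vec_space k))"
  unfolding vec_space_def
  by (rule measurable_compose[OF measurable_component_singleton[of t UNIV] measurable_component_singleton]) auto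

lemma measurable_H_stat:
  "(\<lambda>x. H_stat k n \<tau> x) \<in> borel_measurable (PiM UNIV (\<lambda>_. vec_space k))"
proof -
  have [measurable]: "(\<lambda>x :: int \<Rightarrow> nat \<Rightarrow> real. dotp k (x s) (x t)) \<in> borel_measurable (PiM UNIV (\<lambda>_. vec_space k))" for s t
    unfolding dotp_def by (intro borel_measurable_sum borel_measurable_times measurable_PiM_coordinate) auto
  show ?thesis
    unfolding H_stat_def G_stat_def sigma_hat_def case_prod_beta by measurable
qed

context white_noise
begin

lemma rotated_measurable: "rotated U t \<in> measurable M (vec_space k)"
  unfolding vec_space_def rotated_def using mean_zero
  by (intro measurable_restrict borel_measurable_sum borel_measurable_times) auto

text \<open>The law of the whole sequence is an infinite product, which allows the rotated noise to
  be copied to another probability space.\<close>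

lemma distr_rotated:
  "distr M (PiM UNIV (\<lambda>_. vec_space k)) (\<lambda>\<omega> t. rotated U t \<omega>) = PiM UNIV (\<lambda>_. distr M (vec_space k) (rotated U 0))"
proof -
  define R where "R = (\<lambda>x :: nat \<Rightarrow> real. \<lambda>i\<in>{..<k}. \<Sum>j<k. U $$ (j, i) * x j)"
  have Rm: "R \<in> measurable (vec_space k) (vec_space k)"
    unfolding R_def vec_space_def
    by (intro measurable_restrict borel_measurable_sum borel_measurable_times measurable_component_singleton) auto
  have rot: "rotated U t = (\<lambda>\<omega>. R (restrict (z t \<omega>) {..<k}))" for t
    unfolding rotated_def R_def by (intro ext restrict_ext sum.cong) auto
  have zm: "(\<lambda>\<omega>. restrict (z t \<omega>) {..<k}) \<in> measurable M (vec_space k)" for t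
    unfolding vec_space_def using mean_zero by (intro measurable_restrict) auto
  have "indep_vars (\<lambda>_. vec_space k) (\<lambda>t. rotated U t) UNIV"
    unfolding rot by (rule indep_vars_compose2[OF indep]) (rule Rm)
  then have "distr M (PiM UNIV (\<lambda>_. vec_space k)) (\<lambda>\<omega>. \<lambda>t\<in>UNIV. rotated U t \<omega>) =
      PiM UNIV (\<lambda>t. distr M (vec_space k) (rotated U t))"
    using rotated_measurable by (subst (asm) indep_vars_iff_distr_eq_PiM) auto
  moreover have "distr M (vec_space k) (rotated U t) = distr M (vec_space k) (rotated U 0)" for t
  proof -
    have "distr M (vec_space k) (rotated U s) = distr (distr M (vec_space k) (\<lambda>\<omega>. restrict (z s \<omega>) {..<k})) (vec_space k) R" for s
      unfolding rot by (subst distr_distr[OF Rm zm]) (simp add: o_def)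
    then show ?thesis using ident[of t 0] by simp
  qed
  then have "(\<lambda>t. distr M (vec_space k) (rotated U t)) = (\<lambda>_. distr M (vec_space k) (rotated U 0))"
    by (rule ext)
  ultimately show ?thesis by (simp only: restrict_UNIV)
qed

lemma lam_nonneg:
  assumes "i < k" shows "0 \<le> lam i"
proof (rule diagonalization)
  fix U assume U: "U \<in> carrier_mat k k" "transpose_mat U * U = 1\<^sub>m k"
    "transpose_mat U * \<Sigma> * U = mat k k (\<lambda>(i, j). if i = j then lam i else 0)"
  have "0 \<le> expectation (\<lambda>\<omega>. rotated U 0 \<omega> i * rotated U 0 \<omega> i)"
    by (rule Bochner_Integration.integral_nonneg) simp
  then show ?thesis using rotated_cov[OF U(1,3) assms assms, of 0] by simp
qed

lemma H_stat_measurable: "(\<lambda>\<omega>. H_stat k n \<tau> (\<lambda>t. z t \<omega>)) \<in> borel_measurable M"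
proof -
  have [measurable]: "(\<lambda>\<omega>. dotp k (z s \<omega>) (z t \<omega>)) \<in> borel_measurable M" for s t
    unfolding dotp_def using mean_zero by (intro borel_measurable_sum borel_measurable_times) auto
  show ?thesis
    unfolding H_stat_def G_stat_def sigma_hat_def case_prod_beta by measurable
qed

text \<open>The given space need not carry Gaussian variables independent of the noise. Since the
  claim concerns the law of the noise only, it is proved for a copy: a product space with one factor
  for the rotated vector at each time and one factor for each Gaussian variable.\<close>

lemma H_stat_cos_approx:
  assumes q: "q \<ge> 1" and n: "2 * q < n" and k: "k \<ge> 1"
    and c: "c > 0" "c * real k \<le> (\<Sum>i<k. (lam i)\<^sup>2)"
    and C2: "lam 0 \<le> C2"
    and \<theta>: "\<And>\<tau>. \<tau> \<in> {1..q} \<Longrightarrow> \<bar>\<theta> \<tau>\<bar> \<le> \<Theta>"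
  shows "\<bar>expectation (\<lambda>\<omega>. cos ((\<Sum>\<tau>=1..q. \<theta> \<tau> * H_stat k n \<tau> (\<lambda>t. z t \<omega>)) + \<phi>)) -
    Re (iexp \<phi> * (\<Prod>(\<tau>, i, j)\<in>{1..q} \<times> {..<k} \<times> {..<k}.
      chi_cf (sqrt 2 * \<theta> \<tau> / (real n * (\<Sum>i<k. (lam i)\<^sup>2)) * (lam i * lam j) * real (n - q) / 2)))\<bar>
    \<le> clt_rate q C0 C2 c \<Theta> / sqrt (real n)"
proof -
  obtain U where U: "U \<in> carrier_mat k k" "transpose_mat U * U = 1\<^sub>m k"
    "transpose_mat U * \<Sigma> * U = mat k k (\<lambda>(i, j). if i = j then lam i else 0)"
    by (rule diagonalization)
  define \<mu> where "\<mu> = distr M (vec_space k) (rotated U 0)"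
  \<comment> \<open>A product with a single factor, so that the Gaussian sources have values of the
    same type as the noise vectors and both fit into one product measure.\<close>
  define \<nu> where "\<nu> = PiM {..<1 :: nat} (\<lambda>_. std_normal_distribution)"
  define Mi :: "int + int \<times> nat \<times> nat \<times> nat \<Rightarrow> _" where "Mi = case_sum (\<lambda>_. \<mu>) (\<lambda>_. \<nu>)"
  define P where "P = PiM UNIV Mi"
  define F where "F = (\<lambda>J. vimage_algebra (space P) (\<lambda>\<omega>. restrict \<omega> J) (PiM J Mi))"
  define X where "X = PiM (UNIV :: int set) (\<lambda>_. vec_space k)"
  define w where "w = (\<lambda>t i (\<omega> :: int + int \<times> nat \<times> nat \<times> nat \<Rightarrow> nat \<Rightarrow> real). \<omega> (Inl t) i)"
  define eps where "eps = (\<lambda>t a (\<omega> :: int + int \<times> nat \<times> nat \<times> nat \<Rightarrow> nat \<Rightarrow> real). \<omega> (Inr (t, a)) (0 :: nat))"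
  define pr where "pr = (\<lambda>(\<omega> :: int + int \<times> nat \<times> nat \<times> nat \<Rightarrow> nat \<Rightarrow> real) t. \<omega> (Inl t))"
  have normal: "prob_space std_normal_distribution"
    using real_dist_normal_dist by (simp add: real_distribution_def)
  have \<mu>: "prob_space \<mu>" unfolding \<mu>_def by (rule prob_space_distr[OF rotated_measurable])
  have \<nu>: "prob_space \<nu>" unfolding \<nu>_def by (rule prob_space_PiM) (rule normal)
  have Mi: "prob_space (Mi s)" for s using \<mu> \<nu> by (cases s) (auto simp: Mi_def)
  interpret C: indep_fields P F unfolding P_def F_def by (rule indep_fields_PiM[OF Mi])
  have sets_\<mu>: "sets \<mu> = sets (vec_space k)" by (simp add: \<mu>_def)
  have coord_L: "(\<lambda>\<omega>. \<omega> (Inl t)) \<in> measurable (F {Inl t}) \<mu>" for t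
    using coordinate_measurable_field[of "Inl t" "{Inl t}" Mi] by (simp add: F_def P_def Mi_def)
  have coord_R: "(\<lambda>\<omega>. \<omega> (Inr s)) \<in> measurable (F {Inr s}) \<nu>" for s
    using coordinate_measurable_field[of "Inr s" "{Inr s}" Mi] by (simp add: F_def P_def Mi_def)
  have sets_X: "sets (PiM (UNIV :: int set) (\<lambda>_. \<mu>)) = sets X"
    unfolding X_def by (rule sets_PiM_cong) (auto simp: sets_\<mu>)
  have prm: "pr \<in> measurable P X"
    unfolding pr_def X_def P_def
  proof (rule measurable_PiM_single')
    show "(\<lambda>\<omega>. \<omega> (Inl t)) \<in> measurable (PiM UNIV Mi) (vec_space k)" for t
      using measurable_component_singleton[of "Inl t" UNIV Mi]
      by (simp add: Mi_def measurable_cong_sets[OF refl sets_\<mu>])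
    show "(\<lambda>\<omega> t. \<omega> (Inl t)) \<in> space (PiM UNIV Mi) \<rightarrow> (\<Pi>\<^sub>E i\<in>UNIV. space (vec_space k))"
    proof
      fix \<omega> assume "\<omega> \<in> space (PiM UNIV Mi)"
      then have "\<omega> (Inl t) \<in> space (vec_space k)" for t
        using sets_eq_imp_space_eq[OF sets_\<mu>] by (auto simp: space_PiM Mi_def PiE_iff dest: spec[of _ "Inl t"])
      then show "(\<lambda>t. \<omega> (Inl t)) \<in> (\<Pi>\<^sub>E i\<in>UNIV. space (vec_space k))" by auto
    qed
  qed
  have law: "distr P X pr = distr M X (\<lambda>\<omega> t. rotated U t \<omega>)"
  proof -
    have "distr (PiM UNIV Mi) (PiM (UNIV :: int set) (\<lambda>t. Mi (Inl t))) (\<lambda>\<omega>. \<lambda>t\<in>UNIV. \<omega> (Inl t)) = PiM UNIV (\<lambda>t. Mi (Inl t))"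
      by (rule distr_PiM_reindex) (auto intro: Mi)
    then have "distr P (PiM (UNIV :: int set) (\<lambda>_. \<mu>)) pr = PiM UNIV (\<lambda>_. \<mu>)"
      by (simp add: P_def pr_def Mi_def restrict_UNIV)
    moreover have "distr P (PiM (UNIV :: int set) (\<lambda>_. \<mu>)) pr = distr P X pr"
      by (rule distr_cong) (auto simp: sets_X)
    ultimately show ?thesis unfolding X_def distr_rotated \<mu>_def by simp
  qed
  have rotm: "(\<lambda>\<omega> t. rotated U t \<omega>) \<in> measurable M X"
    unfolding X_def using rotated_measurable measurable_space[OF rotated_measurable]
    by (intro measurable_PiM_single') auto
  \<comment> \<open>Forgetting the Gaussian coordinates leaves the law of the rotated sequence, and
    every functional of the sequence has the same integral on both spaces.\<close>
  have transfer: "C.expectation (\<lambda>\<omega>. f (pr \<omega>)) = expectation (\<lambda>\<omega>. f (\<lambda>t. rotated U t \<omega>))"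
    "integrable P (\<lambda>\<omega>. f (pr \<omega>)) \<longleftrightarrow> integrable M (\<lambda>\<omega>. f (\<lambda>t. rotated U t \<omega>))"
    if "f \<in> borel_measurable X" for f :: "(int \<Rightarrow> nat \<Rightarrow> real) \<Rightarrow> real"
    using integral_distr[OF prm that] integral_distr[OF rotm that]
      integrable_distr_eq[OF prm that] integrable_distr_eq[OF rotm that] law by auto
  have xm: "(\<lambda>x. x t i) \<in> borel_measurable X" if "i < k" for t i
    unfolding X_def by (rule measurable_PiM_coordinate[OF that])
  have dm: "(\<lambda>x. dotp k (x s) (x t)) \<in> borel_measurable X" for s t
    unfolding dotp_def by (intro borel_measurable_sum borel_measurable_times xm) auto
  interpret N: noise P F k q lam w eps C0
  proof
    fix t :: int and i assume i: "i < k"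
    have "(\<lambda>x. x i) \<in> borel_measurable \<mu>"
      using i measurable_component_singleton[of i "{..<k}" "\<lambda>_. borel"]
      unfolding measurable_cong_sets[OF sets_\<mu> refl] vec_space_def by simp
    from measurable_compose[OF coord_L this]
    show "w t i \<in> borel_measurable (F {Inl t})" by (simp add: w_def)
    then have wm: "w t i \<in> borel_measurable P" by (rule C.F_measurable)
    have m4: "(\<lambda>x. x t i ^ 4) \<in> borel_measurable X" using xm[OF i] by measurable
    have "integrable P (\<lambda>\<omega>. w t i \<omega> ^ 4)"
      using transfer(2)[OF m4] L4_integrable(5)[OF rotated_L4[OF i]] by (simp add: w_def pr_def)
    with wm show "C.L4 (w t i)" by (simp add: C.L4_def)
    show "C.expectation (w t i) = 0"
      using transfer(1)[OF xm[OF i]] rotated_mean[OF i] by (simp add: w_def pr_def)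
  next
    fix t :: int and i j assume ij: "i < k" "j < k"
    have "(\<lambda>x. x t i * x t j) \<in> borel_measurable X" using xm[OF ij(1)] xm[OF ij(2)] by measurable
    from transfer(1)[OF this] show "C.expectation (\<lambda>\<omega>. w t i \<omega> * w t j \<omega>) = (if i = j then lam i else 0)"
      using rotated_cov[OF U(1,3) ij] by (simp add: w_def pr_def)
  next
    fix s t :: int assume st: "s \<noteq> t"
    have "(\<lambda>x. dotp k (x s) (x t) ^ 4) \<in> borel_measurable X" using dm by measurable
    from transfer(1)[OF this] show "C.expectation (\<lambda>\<omega>. (\<Sum>i<k. w s i \<omega> * w t i \<omega>) ^ 4) \<le> C0 * (real k)\<^sup>2"
      using moment_inner[OF st] by (simp add: dotp_rotated[OF U(1,2)]) (simp add: dotp_def w_def pr_def)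
  next
    fix t :: int and a :: "nat \<times> nat \<times> nat"
    have n0: "(\<lambda>x. x 0) \<in> borel_measurable \<nu>"
      unfolding \<nu>_def using measurable_component_singleton[of 0 "{..<1::nat}" "\<lambda>_. std_normal_distribution"] by simp
    from measurable_compose[OF coord_R n0]
    show "eps t a \<in> borel_measurable (F {Inr (t, a)})" by (simp add: eps_def)
    have "distr P borel (eps t a) = distr (distr P \<nu> (\<lambda>\<omega>. \<omega> (Inr (t, a)))) borel (\<lambda>x. x 0)"
      using C.F_measurable[OF coord_R] by (subst distr_distr[OF n0]) (auto simp: o_def eps_def)
    also have "distr P \<nu> (\<lambda>\<omega>. \<omega> (Inr (t, a))) = \<nu>"
      using distr_PiM_component[of UNIV Mi "Inr (t, a)"] Mi by (simp add: P_def Mi_def)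
    also have "distr \<nu> borel (\<lambda>x. x 0) = distr \<nu> std_normal_distribution (\<lambda>x. x 0)"
      by (rule distr_cong) auto
    also have "\<dots> = std_normal_distribution"
      unfolding \<nu>_def using distr_PiM_component[of "{..<1::nat}" "\<lambda>_. std_normal_distribution" 0] normal by simp
    finally show "distr P borel (eps t a) = std_normal_distribution" .
  qed
  have S: "N.trS2 = (\<Sum>i<k. (lam i)\<^sup>2)" by (simp add: N.trS2_def)
  have Hm: "(\<lambda>x. cos ((\<Sum>\<tau>=1..q. \<theta> \<tau> * H_stat k n \<tau> x) + \<phi>)) \<in> borel_measurable X"
    using measurable_H_stat[of k n, folded X_def] by measurable
  have eq: "C.expectation (\<lambda>\<omega>. cos ((\<Sum>\<tau>=1..q. \<theta> \<tau> * H_stat k n \<tau> (\<lambda>t i. w t i \<omega>)) + \<phi>)) =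
      expectation (\<lambda>\<omega>. cos ((\<Sum>\<tau>=1..q. \<theta> \<tau> * H_stat k n \<tau> (\<lambda>t. z t \<omega>)) + \<phi>))"
    using transfer(1)[OF Hm] unfolding H_stat_rotated[OF U(1,2)] by (simp add: w_def pr_def)
  have lamC: "lam i \<le> C2" if "i < k" for i using lam_le[OF that] C2 by simp
  have prod: "(\<Prod>a\<in>N.idx. chi_cf (sqrt 2 * \<theta> (fst a) / (real n * N.trS2) * N.vr a * real (n - q) / 2)) =
      (\<Prod>(\<tau>, i, j)\<in>{1..q} \<times> {..<k} \<times> {..<k}.
      chi_cf (sqrt 2 * \<theta> \<tau> / (real n * (\<Sum>i<k. (lam i)\<^sup>2)) * (lam i * lam j) * real (n - q) / 2))"
    unfolding N.idx_def S by (intro prod.cong refl) (auto simp: N.vr_def)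
  have "\<bar>C.expectation (\<lambda>\<omega>. cos ((\<Sum>\<tau>=1..q. \<theta> \<tau> * H_stat k n \<tau> (\<lambda>t i. w t i \<omega>)) + \<phi>)) -
    Re (iexp \<phi> * (\<Prod>a\<in>N.idx. chi_cf (sqrt 2 * \<theta> (fst a) / (real n * N.trS2) * N.vr a * real (n - q) / 2)))\<bar>
    \<le> clt_rate q C0 C2 c \<Theta> / sqrt (real n)"
    by (rule N.H_stat_cos_approx[OF q n k c(1)]) (use c(2) S lamC \<theta> in auto)
  then show ?thesis unfolding eq prod .
qed

end

section \<open>Passage to the limit\<close>

lemma tendsto_lag_ratio: "(\<lambda>n. real (n - q) / real n) \<longlonglongrightarrow> 1"
proof -
  have "(\<lambda>n. 1 - real q * (1 / real n)) \<longlonglongrightarrow> 1 - real q * 0"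
    by (intro tendsto_intros lim_1_over_n)
  moreover have "\<forall>\<^sub>F n in sequentially. 1 - real q * (1 / real n) = real (n - q) / real n"
    using eventually_ge_at_top[of "max 1 q"]
  proof eventually_elim
    case (elim n)
    then show ?case by (simp add: of_nat_diff field_simps)
  qed
  ultimately show ?thesis by (auto elim: Lim_transform_eventually)
qed

lemma (in prob_space) char_weighted_chi_sum:
  fixes eps :: "nat \<Rightarrow> nat \<Rightarrow> nat \<Rightarrow> 'a \<Rightarrow> real" and l :: "nat \<Rightarrow> real"
  assumes ind: "indep_vars (\<lambda>_. borel) (\<lambda>(i, j, \<tau>). eps i j \<tau>) ({..<d} \<times> {..<d} \<times> {1..q})"
    and normal: "\<And>i j. i < d \<Longrightarrow> j < d \<Longrightarrow> distributed M lborel (eps i j \<tau>) std_normal_density"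
    and \<tau>: "\<tau> \<in> {1..q}"
  shows "char (distr M borel (\<lambda>\<omega>. (\<Sum>i<d. \<Sum>j<d. l i * l j * ((eps i j \<tau> \<omega>)\<^sup>2 - 1)) / D)) x =
    (\<Prod>i<d. \<Prod>j<d. chi_cf (x * (l i * l j) / D))"
proof -
  let ?I = "{..<d} \<times> {..<d} \<times> {\<tau>}"
  define Y where "Y = (\<lambda>(i, j, \<tau>) \<omega>. l i * l j / D * ((eps i j \<tau> \<omega>)\<^sup>2 - 1))"
  define Z where "Z = (\<lambda>(i, j, \<tau>). eps i j \<tau>)"
  define g where "g = (\<lambda>(i, j, \<tau> :: nat) e. l i * l j / D * (e\<^sup>2 - 1))"
  have em: "eps i j \<tau> \<in> borel_measurable M" if "i < d" "j < d" for i j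
    using distributed_measurable[OF normal[OF that]] by simp
  have "indep_vars (\<lambda>_. borel) (\<lambda>a \<omega>. g a (Z a \<omega>)) ?I"
  proof (rule indep_vars_compose2[where X = Z and Y = g and M' = "\<lambda>_. borel"])
    show "indep_vars (\<lambda>_. borel) Z ?I"
      unfolding Z_def by (rule indep_vars_subset[OF ind]) (use \<tau> in auto)
    show "g a \<in> borel_measurable borel" for a
      by (cases a) (simp add: g_def)
  qed
  also have "(\<lambda>a \<omega>. g a (Z a \<omega>)) = Y"
    by (rule ext, rule ext) (auto simp: Y_def g_def Z_def)
  finally have indY: "indep_vars (\<lambda>_. borel) Y ?I" .
  have sum: "(\<Sum>i<d. \<Sum>j<d. l i * l j * ((eps i j \<tau> \<omega>)\<^sup>2 - 1)) / D = (\<Sum>a\<in>?I. Y a \<omega>)" for \<omega>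
    unfolding sum.cartesian_product' by (simp add: Y_def sum_divide_distrib)
  have "char (distr M borel (\<lambda>\<omega>. \<Sum>a\<in>?I. Y a \<omega>)) x = (\<Prod>a\<in>?I. char (distr M borel (Y a)) x)"
    by (rule char_distr_sum[OF indY])
  also have "\<dots> = (\<Prod>a\<in>?I. case a of (i, j, \<tau>) \<Rightarrow> chi_cf (x * (l i * l j) / D))"
  proof (rule prod.cong[OF refl], clarsimp)
    fix i j assume ij: "i < d" "j < d"
    note [measurable] = em[OF ij]
    have law: "distr M borel (eps i j \<tau>) = std_normal_distribution"
    proof -
      have "distr M borel (eps i j \<tau>) = distr M lborel (eps i j \<tau>)" by (rule distr_cong) auto
      then show ?thesis using distributed_distr_eq_density[OF normal[OF ij]] by simp
    qed
    have "char (distr M borel (Y (i, j, \<tau>))) x = (CLINT \<omega>|M. iexp (x * (l i * l j) / D * ((eps i j \<tau> \<omega>)\<^sup>2 - 1)))"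
      unfolding char_def Y_def by (subst integral_distr) (auto simp: mult_ac)
    also have "\<dots> = (CLINT g|distr M borel (eps i j \<tau>). iexp (x * (l i * l j) / D * (g\<^sup>2 - 1)))"
      by (subst integral_distr) auto
    finally show "char (distr M borel (Y (i, j, \<tau>))) x = chi_cf (x * (l i * l j) / D)"
      unfolding law chi_cf_def .
  qed
  also have "\<dots> = (\<Prod>i<d. \<Prod>j<d. chi_cf (x * (l i * l j) / D))"
    unfolding prod.cartesian_product' by simp
  finally show ?thesis unfolding sum .
qed

lemma (in prob_space) cos_combination_char:
  assumes ind: "indep_vars (\<lambda>_. borel) H {1..q}"
  shows "expectation (\<lambda>\<omega>. cos ((\<Sum>\<tau>=1..q. \<theta> \<tau> * H \<tau> \<omega>) + \<phi>)) =
    Re (iexp \<phi> * (\<Prod>\<tau>=1..q. char (distr M borel (H \<tau>)) (\<theta> \<tau>)))"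
proof -
  have H: "H \<tau> \<in> borel_measurable M" if "\<tau> \<in> {1..q}" for \<tau>
    using ind that by (auto simp: indep_vars_def)
  have "indep_vars (\<lambda>_. borel) (\<lambda>\<tau> \<omega>. \<theta> \<tau> * H \<tau> \<omega>) {1..q}"
    by (rule indep_vars_compose2[OF ind]) auto
  from char_distr_sum[OF this, of 1]
  have "char (distr M borel (\<lambda>\<omega>. \<Sum>\<tau>=1..q. \<theta> \<tau> * H \<tau> \<omega>)) 1 = (\<Prod>\<tau>=1..q. char (distr M borel (\<lambda>\<omega>. \<theta> \<tau> * H \<tau> \<omega>)) 1)" .
  also have "\<dots> = (\<Prod>\<tau>=1..q. char (distr M borel (H \<tau>)) (\<theta> \<tau>))"
    using H by (intro prod.cong refl) (simp add: char_def integral_distr)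
  finally have "char (distr M borel (\<lambda>\<omega>. \<Sum>\<tau>=1..q. \<theta> \<tau> * H \<tau> \<omega>)) 1 = (\<Prod>\<tau>=1..q. char (distr M borel (H \<tau>)) (\<theta> \<tau>))" .
  then show ?thesis using H by (subst cos_shift_char) auto
qed

text \<open>The coefficients are those of \<open>white_noise.H_stat_cos_approx\<close>.\<close>

lemma chi_cf_prod_fixed:
  assumes "S \<noteq> 0"
  shows "(\<lambda>n. \<Prod>(\<tau>, i, j)\<in>{1..q} \<times> {..<d} \<times> {..<d}.
      chi_cf (sqrt 2 * \<theta> \<tau> / (real n * S) * (l i * l j) * real (n - q) / 2)) \<longlonglongrightarrow>
    (\<Prod>\<tau>=1..q. \<Prod>i<d. \<Prod>j<d. chi_cf (\<theta> \<tau> * (l i * l j) / (sqrt 2 * S)))"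
proof -
  have lim: "(\<lambda>n. chi_cf (sqrt 2 * \<theta> \<tau> / (real n * S) * (l i * l j) * real (n - q) / 2)) \<longlonglongrightarrow>
      chi_cf (\<theta> \<tau> * (l i * l j) / (sqrt 2 * S))" for \<tau> i j
  proof (rule isCont_tendsto_compose[OF isCont_chi_cf])
    have "(\<lambda>n. \<theta> \<tau> * (l i * l j) / (sqrt 2 * S) * (real (n - q) / real n)) \<longlonglongrightarrow> \<theta> \<tau> * (l i * l j) / (sqrt 2 * S) * 1"
      by (intro tendsto_intros tendsto_lag_ratio)
    moreover have "sqrt 2 * \<theta> \<tau> / (real n * S) * (l i * l j) * real (n - q) / 2 =
        \<theta> \<tau> * (l i * l j) / (sqrt 2 * S) * (real (n - q) / real n)" for n
    proof -
      have "sqrt 2 * \<theta> \<tau> / (real n * S) * (l i * l j) * real (n - q) / 2 =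
          (sqrt 2 / 2) * (\<theta> \<tau> * (l i * l j) / S * (real (n - q) / real n))" by (simp add: mult_ac)
      also have "sqrt 2 / 2 = 1 / sqrt 2" by (simp add: real_div_sqrt field_simps)
      finally show ?thesis by simp
    qed
    ultimately show "(\<lambda>n. sqrt 2 * \<theta> \<tau> / (real n * S) * (l i * l j) * real (n - q) / 2) \<longlonglongrightarrow>
        \<theta> \<tau> * (l i * l j) / (sqrt 2 * S)" by simp
  qed
  have "(\<Prod>\<tau>=1..q. \<Prod>i<d. \<Prod>j<d. chi_cf (\<theta> \<tau> * (l i * l j) / (sqrt 2 * S))) =
      (\<Prod>(\<tau>, i, j)\<in>{1..q} \<times> {..<d} \<times> {..<d}. chi_cf (\<theta> \<tau> * (l i * l j) / (sqrt 2 * S)))"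
    unfolding prod.cartesian_product' by simp
  then show ?thesis
    using lim by (auto simp: case_prod_beta intro!: tendsto_prod)
qed

text \<open>Summed over i and j, the squares of l i * l j make up S^2, which cancels the
  normalization: each lag contributes \<theta>^2 / 2 in the limit, as for a standard normal
  variable. Each single weight is at most of order 1/S and vanishes.\<close>

lemma chi_cf_prod_diverging:
  fixes l :: "nat \<Rightarrow> nat \<Rightarrow> real" and S :: "nat \<Rightarrow> real"
  assumes S: "\<And>n. S n = (\<Sum>i<p n. (l n i)\<^sup>2)" and S_lim: "filterlim S at_top sequentially"
    and l: "\<And>n i. i < p n \<Longrightarrow> 0 \<le> l n i \<and> l n i \<le> C"
    and \<theta>: "\<And>\<tau>. \<tau> \<in> {1..q} \<Longrightarrow> \<bar>\<theta> \<tau>\<bar> \<le> \<Theta>"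
  shows "(\<lambda>n. \<Prod>(\<tau>, i, j)\<in>{1..q} \<times> {..<p n} \<times> {..<p n}.
      chi_cf (sqrt 2 * \<theta> \<tau> / (real n * S n) * (l n i * l n j) * real (n - q) / 2)) \<longlonglongrightarrow>
    of_real (exp (- (\<Sum>\<tau>=1..q. (\<theta> \<tau>)\<^sup>2 / 2)))"
proof -
  define A where "A = (\<lambda>n. {1..q} \<times> {..<p n} \<times> {..<p n})"
  define x where "x = (\<lambda>n (\<tau>, i, j). sqrt 2 * \<theta> \<tau> / (real n * S n) * (l n i * l n j) * real (n - q) / 2)"
  have S0: "0 \<le> S n" for n unfolding S by (intro sum_nonneg) auto
  have "(\<lambda>n. \<Prod>a\<in>A n. chi_cf (x n a)) \<longlonglongrightarrow> of_real (exp (- (\<Sum>\<tau>=1..q. (\<theta> \<tau>)\<^sup>2 / 2)))"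
  proof (rule chi_cf_prod_tendsto[where m = "\<lambda>n. \<bar>\<Theta>\<bar> * C\<^sup>2 * inverse (S n)"])
    show "finite (A n)" for n by (simp add: A_def)
    show "(\<lambda>n. \<bar>\<Theta>\<bar> * C\<^sup>2 * inverse (S n)) \<longlonglongrightarrow> 0"
      by (intro tendsto_mult_right_zero tendsto_inverse_0_at_top S_lim)
    show "\<bar>x n a\<bar> \<le> \<bar>\<Theta>\<bar> * C\<^sup>2 * inverse (S n)" if a: "a \<in> A n" for n a
    proof -
      obtain \<tau> i j where at: "a = (\<tau>, i, j)" by (cases a) auto
      from a have ij: "i < p n" "j < p n" "\<tau> \<in> {1..q}" by (auto simp: A_def at)
      have "l n i * l n j \<le> C * C" using l ij by (intro mult_mono) (auto intro: order_trans)
      then have ll: "\<bar>l n i * l n j\<bar> \<le> C\<^sup>2" using l[OF ij(1)] l[OF ij(2)] by (simp add: power2_eq_square)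
      have r: "real (n - q) / real n \<le> 1" by (cases "n = 0") auto
      have s2: "sqrt 2 / 2 \<le> (1 :: real)" using real_sqrt_le_iff[of 2 4] by simp
      have "x n a = (sqrt 2 / 2) * \<theta> \<tau> * (l n i * l n j) * (real (n - q) / real n) * inverse (S n)"
        by (simp add: x_def at field_simps)
      then have "\<bar>x n a\<bar> = (sqrt 2 / 2) * \<bar>\<theta> \<tau>\<bar> * \<bar>l n i * l n j\<bar> * (real (n - q) / real n) * inverse (S n)"
        using S0[of n] by (simp add: abs_mult)
      also have "\<dots> \<le> 1 * \<bar>\<Theta>\<bar> * C\<^sup>2 * 1 * inverse (S n)"
        using S0[of n] \<theta>[OF ij(3)] by (intro mult_right_mono mult_mono ll r s2) auto
      finally show ?thesis by simp
    qed
    have "(\<lambda>n. (\<Sum>\<tau>=1..q. (\<theta> \<tau>)\<^sup>2 / 2) * (real (n - q) / real n)\<^sup>2) \<longlonglongrightarrow> (\<Sum>\<tau>=1..q. (\<theta> \<tau>)\<^sup>2 / 2) * 1\<^sup>2"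
      by (intro tendsto_intros tendsto_lag_ratio)
    moreover have "\<forall>\<^sub>F n in sequentially. (\<Sum>\<tau>=1..q. (\<theta> \<tau>)\<^sup>2 / 2) * (real (n - q) / real n)\<^sup>2 = (\<Sum>a\<in>A n. (x n a)\<^sup>2)"
      using filterlim_at_top_dense[THEN iffD1, OF S_lim, rule_format, of 0]
    proof eventually_elim
      case (elim n)
      have xx: "(x n (\<tau>, i, j))\<^sup>2 = (\<theta> \<tau>)\<^sup>2 / 2 * (real (n - q) / real n)\<^sup>2 / (S n)\<^sup>2 * ((l n i)\<^sup>2 * (l n j)\<^sup>2)" for \<tau> i j
        by (simp add: x_def power_mult_distrib power_divide mult_ac)
      have SS: "(\<Sum>i<p n. \<Sum>j<p n. K * ((l n i)\<^sup>2 * (l n j)\<^sup>2)) = K * (S n * S n)" for K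
        unfolding S[of n] sum_product by (simp add: sum_distrib_left)
      have "(\<Sum>a\<in>A n. (x n a)\<^sup>2) = (\<Sum>\<tau>=1..q. \<Sum>i<p n. \<Sum>j<p n. (x n (\<tau>, i, j))\<^sup>2)"
        unfolding A_def sum.cartesian_product' ..
      also have "\<dots> = (\<Sum>\<tau>=1..q. (\<theta> \<tau>)\<^sup>2 / 2 * (real (n - q) / real n)\<^sup>2 / (S n)\<^sup>2 * (S n * S n))"
        unfolding xx SS ..
      also have "\<dots> = (\<Sum>\<tau>=1..q. (\<theta> \<tau>)\<^sup>2 / 2 * (real (n - q) / real n)\<^sup>2)"
        using elim by (intro sum.cong refl) (simp add: power2_eq_square)
      finally show ?case by (simp add: sum_distrib_right)
    qed
    ultimately show "(\<lambda>n. \<Sum>a\<in>A n. (x n a)\<^sup>2) \<longlonglongrightarrow> (\<Sum>\<tau>=1..q. (\<theta> \<tau>)\<^sup>2 / 2)"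
      by (auto elim: Lim_transform_eventually)
  qed
  then show ?thesis by (simp add: A_def x_def case_prod_beta)
qed

theorem theorem1:
  fixes q :: nat and p :: "nat \<Rightarrow> nat" and d :: nat
    and M :: "nat \<Rightarrow> 'a measure"
    and z :: "nat \<Rightarrow> int \<Rightarrow> 'a \<Rightarrow> nat \<Rightarrow> real"
    and \<Sigma> :: "nat \<Rightarrow> real mat" and lam :: "nat \<Rightarrow> nat \<Rightarrow> real"
    and C\<^sub>0 C\<^sub>1 C\<^sub>2 :: real
    and N :: "'b measure" and H :: "nat \<Rightarrow> 'b \<Rightarrow> real"
    and E :: "'c measure" and eps :: "nat \<Rightarrow> nat \<Rightarrow> nat \<Rightarrow> 'c \<Rightarrow> real"
  assumes q: "q \<ge> 1"
    \<comment> \<open>the dimension \<open>p n\<close> is constantly \<open>d\<close> or diverges\<close>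
    and p_pos: "\<And>n. p n \<ge> 1"
    and regime: "(\<forall>n. p n = d) \<or> filterlim p at_top sequentially"
    \<comment> \<open>\<open>z k t\<close> is the noise vector at time \<open>t\<close> in dimension \<open>k\<close>\<close>
    and prob: "\<And>k. k \<in> range p \<Longrightarrow> prob_space (M k)"
    and indep: "\<And>k. k \<in> range p \<Longrightarrow> prob_space.indep_vars (M k) (\<lambda>_. vec_space k)
                  (\<lambda>t \<omega>. restrict (z k t \<omega>) {..<k}) UNIV"
    and ident: "\<And>k t s. k \<in> range p \<Longrightarrow>
                  distr (M k) (vec_space k) (\<lambda>\<omega>. restrict (z k t \<omega>) {..<k}) =
                  distr (M k) (vec_space k) (\<lambda>\<omega>. restrict (z k s \<omega>) {..<k})"
    and mean_zero: "\<And>k t i. k \<in> range p \<Longrightarrow> i < k \<Longrightarrow>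
                  integrable (M k) (\<lambda>\<omega>. z k t \<omega> i) \<and> (LINT \<omega>|M k. z k t \<omega> i) = 0"
    and cov: "\<And>k t. k \<in> range p \<Longrightarrow> \<Sigma> k = cov_mat (M k) k (z k t)"
    and eigenvalues: "\<And>k. k \<in> range p \<Longrightarrow> ordered_eigenvalues (\<Sigma> k) (lam k)"
    and moment_inner: "\<And>k t s. k \<in> range p \<Longrightarrow> t \<noteq> s \<Longrightarrow>
                  integrable (M k) (\<lambda>\<omega>. (dotp k (z k t \<omega>) (z k s \<omega>)) ^ 4) \<and>
                  (LINT \<omega>|M k. (dotp k (z k t \<omega>) (z k s \<omega>)) ^ 4) \<le> C\<^sub>0 * (real k)\<^sup>2"
    and C1_pos: "C\<^sub>1 > 0"
    and moment_coord: "\<And>k t i. k \<in> range p \<Longrightarrow> i < k \<Longrightarrow>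
                  integrable (M k) (\<lambda>\<omega>. (z k t \<omega> i) ^ 4) \<and>
                  (LINT \<omega>|M k. (z k t \<omega> i) ^ 4) \<le> C\<^sub>1"
    and eig_bound: "\<And>k. k \<in> range p \<Longrightarrow> lam k 0 \<le> C\<^sub>2"
    and trace_fixed: "\<And>l. l \<in> {1, 2} \<Longrightarrow> \<forall>n. p n = d \<Longrightarrow> mat_trace (\<Sigma> d ^\<^sub>m l) > 0"
    and trace_diverging: "\<And>l. l \<in> {1, 2} \<Longrightarrow> filterlim p at_top sequentially \<Longrightarrow>
                  \<exists>L>0. (\<lambda>n. mat_trace (\<Sigma> (p n) ^\<^sub>m l) / real (p n)) \<longlonglongrightarrow> L"
    \<comment> \<open>the limit variables\<close>
    and prob_N: "prob_space N"
    and H_indep: "prob_space.indep_vars N (\<lambda>_. borel) H {1..q}"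
    and prob_E: "prob_space E"
    and eps_indep: "\<forall>n. p n = d \<Longrightarrow>
                  prob_space.indep_vars E (\<lambda>_. borel) (\<lambda>(i, j, \<tau>). eps i j \<tau>)
                    ({..<d} \<times> {..<d} \<times> {1..q})"
    and eps_normal: "\<And>i j \<tau>. \<forall>n. p n = d \<Longrightarrow> i < d \<Longrightarrow> j < d \<Longrightarrow> \<tau> \<in> {1..q} \<Longrightarrow>
                  distributed E lborel (eps i j \<tau>) std_normal_density"
    and H_fixed: "\<And>\<tau>. \<forall>n. p n = d \<Longrightarrow> \<tau> \<in> {1..q} \<Longrightarrow>
                  distr N borel (H \<tau>) = distr E borel (\<lambda>\<omega>.
                    (\<Sum>i<d. \<Sum>j<d. lam d i * lam d j * ((eps i j \<tau> \<omega>)\<^sup>2 - 1)) /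
                    (sqrt 2 * (\<Sum>i<d. (lam d i)\<^sup>2)))"
    and H_diverging: "\<And>\<tau>. filterlim p at_top sequentially \<Longrightarrow> \<tau> \<in> {1..q} \<Longrightarrow>
                  distr N borel (H \<tau>) = std_normal_distribution"
  shows "weak_conv_joint {1..q}
           (\<lambda>n. joint_law {1..q} (M (p n)) (\<lambda>\<tau> \<omega>. H_stat (p n) n \<tau> (\<lambda>t. z (p n) t \<omega>)))
           (joint_law {1..q} N H)"
proof (rule weak_conv_joint_if_cos)
  have wn: "white_noise (M k) k (z k) (\<Sigma> k) (lam k) C\<^sub>0" if k: "k \<in> range p" for k
    by (intro white_noise.intro white_noise_axioms.intro prob[OF k] indep[OF k] ident[OF k] mean_zero[OF k]
        cov[OF k] eigenvalues[OF k] moment_inner[OF k] moment_coord[OF k, THEN conjunct1])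
  show "finite {1..q}" "prob_space N" using prob_N by auto
  show "prob_space (M (p n))" for n by (rule prob) simp
  show "(\<lambda>\<omega>. H_stat (p n) n \<tau> (\<lambda>t. z (p n) t \<omega>)) \<in> borel_measurable (M (p n))" for n \<tau>
    by (rule white_noise.H_stat_measurable[OF wn]) simp
  show "H \<tau> \<in> borel_measurable N" if "\<tau> \<in> {1..q}" for \<tau>
    using H_indep that by (auto simp: prob_space.indep_vars_def[OF prob_N])
  fix \<theta> :: "nat \<Rightarrow> real" and \<phi> :: real
  define \<Theta> where "\<Theta> = (\<Sum>\<tau>=1..q. \<bar>\<theta> \<tau>\<bar>)"
  have \<Theta>: "\<bar>\<theta> \<tau>\<bar> \<le> \<Theta>" if "\<tau> \<in> {1..q}" for \<tau>
    unfolding \<Theta>_def using that by (intro member_le_sum) auto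
  define S where "S = (\<lambda>n. \<Sum>i<p n. (lam (p n) i)\<^sup>2)"
  have trace: "mat_trace (\<Sigma> (p n) ^\<^sub>m 2) = S n" for n
    unfolding S_def by (rule white_noise.trace_eq[OF wn]) simp
  define E_n where "E_n = (\<lambda>n. LINT \<omega>|M (p n). cos ((\<Sum>\<tau>=1..q. \<theta> \<tau> * H_stat (p n) n \<tau> (\<lambda>t. z (p n) t \<omega>)) + \<phi>))"
  define T where "T = (\<lambda>n. \<Prod>(\<tau>, i, j)\<in>{1..q} \<times> {..<p n} \<times> {..<p n}.
      chi_cf (sqrt 2 * \<theta> \<tau> / (real n * S n) * (lam (p n) i * lam (p n) j) * real (n - q) / 2))"
  \<comment> \<open>For a fixed dimension \<open>c\<close> is the normalized trace itself; for a
    diverging one the normalized trace eventually exceeds half its limit.\<close>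
  have "\<exists>c>0. \<forall>\<^sub>F n in sequentially. c * real (p n) \<le> S n"
    using regime
  proof
    assume fixed: "\<forall>n. p n = d"
    then have "S n = mat_trace (\<Sigma> d ^\<^sub>m 2)" for n using trace[of n] by simp
    moreover have "mat_trace (\<Sigma> d ^\<^sub>m 2) > 0" using trace_fixed[of 2] fixed by simp
    moreover have "d \<ge> 1" using p_pos[of 0] fixed by simp
    ultimately show ?thesis
      using fixed by (intro exI[of _ "mat_trace (\<Sigma> d ^\<^sub>m 2) / real d"]) auto
  next
    assume div: "filterlim p at_top sequentially"
    obtain L where L: "L > 0" "(\<lambda>n. mat_trace (\<Sigma> (p n) ^\<^sub>m 2) / real (p n)) \<longlonglongrightarrow> L"
      using trace_diverging[of 2] div by auto
    have "\<forall>\<^sub>F n in sequentially. L / 2 < S n / real (p n)"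
      using order_tendstoD(1)[OF L(2), of "L / 2"] L(1) by (simp add: trace)
    then have "\<forall>\<^sub>F n in sequentially. L / 2 * real (p n) \<le> S n"
    proof eventually_elim
      case (elim n)
      have "real (p n) > 0" using p_pos[of n] by simp
      then show ?case using elim by (simp add: field_simps)
    qed
    then show ?thesis using L(1) by (intro exI[of _ "L / 2"]) auto
  qed
  then obtain c where c: "c > 0" "\<forall>\<^sub>F n in sequentially. c * real (p n) \<le> S n" by blast
  have "\<forall>\<^sub>F n in sequentially. norm (E_n n - Re (iexp \<phi> * T n)) \<le> clt_rate q C\<^sub>0 C\<^sub>2 c \<Theta> / sqrt (real n)"
    using c(2) eventually_gt_at_top[of "2 * q"]
  proof eventually_elim
    case (elim n)
    show ?case unfolding E_n_def T_def S_def real_norm_def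
      by (rule white_noise.H_stat_cos_approx[OF wn q elim(2) p_pos c(1) elim(1)[unfolded S_def] eig_bound])
         (use \<Theta> in auto)
  qed
  moreover have "(\<lambda>n. clt_rate q C\<^sub>0 C\<^sub>2 c \<Theta> / sqrt (real n)) \<longlonglongrightarrow> 0"
    by (intro tendsto_divide_0[OF tendsto_const] filterlim_at_top_imp_at_infinity
        filterlim_compose[OF sqrt_at_top filterlim_real_sequentially])
  ultimately have close: "(\<lambda>n. E_n n - Re (iexp \<phi> * T n)) \<longlonglongrightarrow> 0"
    by (rule Lim_null_comparison)
  \<comment> \<open>So far the approximation is common to both regimes; they differ only in the
    limit of \<open>T\<close>.\<close>
  have "T \<longlonglongrightarrow> (\<Prod>\<tau>=1..q. char (distr N borel (H \<tau>)) (\<theta> \<tau>))"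
    using regime
  proof
    assume fixed: "\<forall>n. p n = d"
    define S\<^sub>d where "S\<^sub>d = (\<Sum>i<d. (lam d i)\<^sup>2)"
    have "S\<^sub>d = mat_trace (\<Sigma> d ^\<^sub>m 2)" using trace[of 0] fixed by (simp add: S_def S\<^sub>d_def)
    then have S\<^sub>d: "S\<^sub>d \<noteq> 0" using trace_fixed[of 2] fixed by simp
    have "char (distr N borel (H \<tau>)) (\<theta> \<tau>) = (\<Prod>i<d. \<Prod>j<d. chi_cf (\<theta> \<tau> * (lam d i * lam d j) / (sqrt 2 * S\<^sub>d)))"
      if \<tau>: "\<tau> \<in> {1..q}" for \<tau>
      unfolding H_fixed[OF fixed \<tau>] S\<^sub>d_def
      by (rule prob_space.char_weighted_chi_sum[OF prob_E eps_indep[OF fixed] eps_normal[OF fixed _ _ \<tau>] \<tau>])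
    moreover have "T = (\<lambda>n. \<Prod>(\<tau>, i, j)\<in>{1..q} \<times> {..<d} \<times> {..<d}.
      chi_cf (sqrt 2 * \<theta> \<tau> / (real n * S\<^sub>d) * (lam d i * lam d j) * real (n - q) / 2))"
      unfolding T_def S_def S\<^sub>d_def using fixed by simp
    ultimately show ?thesis using chi_cf_prod_fixed[where S = S\<^sub>d and q = q and d = d and \<theta> = \<theta> and l = "lam d", OF S\<^sub>d] by simp
  next
    assume div: "filterlim p at_top sequentially"
    \<comment> \<open>The trace of the squared covariance matrix grows at least linearly in the
      dimension, while the eigenvalues stay bounded: hence no single weight survives in the
      limit.\<close>
    have "filterlim (\<lambda>n. c * real (p n)) at_top sequentially"
      by (intro filterlim_tendsto_pos_mult_at_top[OF tendsto_const c(1)]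
          filterlim_compose[OF filterlim_real_sequentially div])
    then have S_lim: "filterlim S at_top sequentially"
      by (rule filterlim_at_top_mono[OF _ c(2)])
    have l: "0 \<le> lam (p n) i \<and> lam (p n) i \<le> C\<^sub>2" if "i < p n" for n i
      using white_noise.lam_nonneg[OF wn that] white_noise.lam_le[OF wn that] eig_bound[of "p n"] by force
    have "char (distr N borel (H \<tau>)) (\<theta> \<tau>) = complex_of_real (exp (- (\<theta> \<tau>)\<^sup>2 / 2))" if "\<tau> \<in> {1..q}" for \<tau>
      unfolding H_diverging[OF div that] char_std_normal_distribution by simp
    then have "(\<Prod>\<tau>=1..q. char (distr N borel (H \<tau>)) (\<theta> \<tau>)) = of_real (exp (- (\<Sum>\<tau>=1..q. (\<theta> \<tau>)\<^sup>2 / 2)))"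
      by (simp add: sum_negf[symmetric] exp_sum)
    then show ?thesis
      using chi_cf_prod_diverging[where S = S and p = p and l = "\<lambda>n. lam (p n)" and \<Theta> = \<Theta> and \<theta> = \<theta>,
          OF S_def[THEN fun_cong] S_lim l] \<Theta> by (simp add: T_def)
  qed
  then have "(\<lambda>n. Re (iexp \<phi> * T n)) \<longlonglongrightarrow> Re (iexp \<phi> * (\<Prod>\<tau>=1..q. char (distr N borel (H \<tau>)) (\<theta> \<tau>)))"
    by (intro tendsto_intros)
  from tendsto_add[OF close this]
  show "(\<lambda>n. LINT \<omega>|M (p n). cos ((\<Sum>\<tau>\<in>{1..q}. \<theta> \<tau> * H_stat (p n) n \<tau> (\<lambda>t. z (p n) t \<omega>)) + \<phi>)) \<longlonglongrightarrow>
      (LINT \<omega>|N. cos ((\<Sum>\<tau>\<in>{1..q}. \<theta> \<tau> * H \<tau> \<omega>) + \<phi>))"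
    unfolding prob_space.cos_combination_char[OF prob_N H_indep] by (simp add: E_n_def)
qed

end
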